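(* Let $u:M\times[a,b]\to\mathbb{R}^n$ be a smooth function which solves the weighted heat-type equation $$u_t(x,t)-\mathcal{L}u(x,t)=\phi(t)\,u(x,t)\quad\text{on } M\times[a,b],$$ where $\phi$ is a smooth function of the time variable $t$. Then $U(t)=D(t)/I(t)$ is a nondecreasing function. Moreover, if $U$ is constant, then $u$ is an eigenfunction of $\mathcal{L}$ and $$u(x,t)=e^{tU(t)-aU(a)+\int_a^t\phi(\tau)\,d\tau}\,u(x,a).$$ Also, if $\phi(t)$ is a nondecreasing function, then $\log I$ is convex.
   Context: $(M,g)$ is a closed (compact, without boundary) Riemannian manifold with Riemannian volume form $d\nu$, $f\in C^\infty(M)$ (or at least $C^2$) is a real-valued function, and $d\mu=e^{-f}d\nu$ is the weighted measure. $T$ is a symmetric positive definite $(1,1)$-tensor on $M$; for vector fields $X,Y$ write $T(X,Y)=\langle T(X),Y\rangle$. The operator $\mathcal{L}$ acts on $C^2$ functions by $$\mathcal{L}u=\mathrm{div}_f(T(\nabla u))=\mathrm{div}(T(\nabla u))-\langle\nabla f,T(\nabla u)\rangle .$$ For a function $u$ on $M\times[a,b]$, $\nabla$ and $\mathcal{L}$ act in the $M$-variable, and $$D(t)=-\int_M T(\nabla u,\nabla u)\,d\mu=\int_M u\,\mathcal{L}u\,d\mu,\qquad I(t)=\int_M u^2\,d\mu,\qquad U(t)=\frac{D(t)}{I(t)},$$ where it is understood that $I(t)\neq0$ wherever $U(t)$ is used. For $\mathbb{R}^n$-valued $u$, $\nabla$ and $\mathcal{L}$ act componentwise, products such as $u^2$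 and $u\,\mathcal{L}u$ are Euclidean inner products, and $T(\nabla u,\nabla u)$ is the sum over the components of $u$. That $u$ is an eigenfunction of $\mathcal{L}$ means that, for each $t$, $\mathcal{L}u(\cdot,t)=\lambda u(\cdot,t)$ for some constant $\lambda$. *)

theory Defs
  imports "HOL-Analysis.Analysis"
begin

text \<open>
  Derivatives are taken within \<open>S\<close>, so that the notion applies both to open sets (ordinary
  derivatives) and to products of an open set with a nondegenerate compact interval (one-sided
  time derivatives at the two end points). On such sets the derivative within \<open>S\<close> is unique, so
  \<^const>\<open>frechet_derivative\<close> denotes it unambiguously.
\<close>

primrec Ck_on :: "nat \<Rightarrow> 'a::euclidean_space set \<Rightarrow> ('a \<Rightarrow> 'b::real_normed_vector) \<Rightarrow> bool" where
  "Ck_on 0 S F \<longleftrightarrow> continuous_on S F"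
| "Ck_on (Suc k) S F \<longleftrightarrow> F differentiable_on S \<and>
     (\<forall>v. Ck_on k S (\<lambda>x. frechet_derivative F (at x within S) v))"

definition smooth_on :: "'a::euclidean_space set \<Rightarrow> ('a \<Rightarrow> 'b::real_normed_vector) \<Rightarrow> bool" where
  "smooth_on S F \<longleftrightarrow> (\<forall>k. Ck_on k S F)"

text \<open>
  The underlying set of the manifold is the whole type \<open>'a\<close>; its dimension is \<open>CARD('m)\<close>.
  A chart is its domain together with its coordinate map (whose values outside the domain are
  irrelevant).
\<close>

type_synonym ('a, 'm) chart = "'a set \<times> ('a \<Rightarrow> real ^ 'm)"

abbreviation cdom :: "('a, 'm) chart \<Rightarrow> 'a set" where
  "cdom c \<equiv> fst c"

abbreviation cmap :: "('a, 'm) chart \<Rightarrow> 'a \<Rightarrow> real ^ 'm" where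
  "cmap c \<equiv> snd c"

abbreviation cimg :: "('a, 'm) chart \<Rightarrow> (real ^ 'm) set" where
  "cimg c \<equiv> cmap c ` cdom c"

definition cinv :: "('a, 'm) chart \<Rightarrow> real ^ 'm \<Rightarrow> 'a" where
  "cinv c = inv_into (cdom c) (cmap c)"

definition is_chart :: "('a::topological_space, 'm::finite) chart \<Rightarrow> bool" where
  "is_chart c \<longleftrightarrow> open (cdom c) \<and> open (cimg c) \<and> homeomorphism (cdom c) (cimg c) (cmap c) (cinv c)"

definition closed_manifold ::
  "('a::{t2_space, second_countable_topology}, 'm::finite) chart set \<Rightarrow> bool" where
  "closed_manifold A \<longleftrightarrow> compact (UNIV :: 'a set) \<and> (\<Union>c\<in>A. cdom c) = UNIV \<and> (\<forall>c\<in>A. is_chart c) \<and>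
     (\<forall>c\<in>A. \<forall>c'\<in>A. smooth_on (cmap c ` (cdom c \<inter> cdom c')) (cmap c' \<circ> cinv c))"

definition Ck_fun :: "('a, 'm::finite) chart set \<Rightarrow> nat \<Rightarrow> ('a \<Rightarrow> real) \<Rightarrow> bool" where
  "Ck_fun A k h \<longleftrightarrow> (\<forall>c\<in>A. Ck_on k (cimg c) (h \<circ> cinv c))"

definition smooth_spacetime ::
  "('a, 'm::finite) chart set \<Rightarrow> real \<Rightarrow> real \<Rightarrow> ('a \<Rightarrow> real \<Rightarrow> real ^ 'n::finite) \<Rightarrow> bool" where
  "smooth_spacetime A a b u \<longleftrightarrow>
     (\<forall>c\<in>A. smooth_on (cimg c \<times> {a..b}) (\<lambda>(y, t). u (cinv c y) t))"

definition chart_at :: "('a, 'm) chart set \<Rightarrow> 'a \<Rightarrow> ('a, 'm) chart" where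
  "chart_at A p = (SOME c. c \<in> A \<and> p \<in> cdom c)"

text \<open>
  A tensor field is given by its components in every chart of the atlas, subject to the
  transformation law. Vector fields have components \<open>X c p\<close>, and \<open>(0,2)\<close>- and \<open>(1,1)\<close>-tensors
  have matrices \<open>g c p\<close> and \<open>T c p\<close> with respect to the coordinate frame of \<open>c\<close> at \<open>p\<close>; only
  \<open>c \<in> A\<close> and \<open>p \<in> cdom c\<close> matter.
\<close>

type_synonym ('a, 'm) vfield = "('a, 'm) chart \<Rightarrow> 'a \<Rightarrow> real ^ 'm"
type_synonym ('a, 'm) tensor2 = "('a, 'm) chart \<Rightarrow> 'a \<Rightarrow> real ^ 'm ^ 'm"

definition jac :: "('a, 'm::finite) chart \<Rightarrow> ('a, 'm) chart \<Rightarrow> 'a \<Rightarrow> real ^ 'm ^ 'm" where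
  "jac c c' p = matrix (frechet_derivative (cmap c' \<circ> cinv c) (at (cmap c p)))"

definition riemannian_metric :: "('a, 'm::finite) chart set \<Rightarrow> ('a, 'm) tensor2 \<Rightarrow> bool" where
  "riemannian_metric A g \<longleftrightarrow>
     (\<forall>c\<in>A. smooth_on (cimg c) (g c \<circ> cinv c)) \<and>
     (\<forall>c\<in>A. \<forall>c'\<in>A. \<forall>p\<in>cdom c \<inter> cdom c'.
        g c p = transpose (jac c c' p) ** g c' p ** jac c c' p) \<and>
     (\<forall>c\<in>A. \<forall>p\<in>cdom c. transpose (g c p) = g c p \<and> (\<forall>v. v \<noteq> 0 \<longrightarrow> v \<bullet> (g c p *v v) > 0))"

definition closed_riemannian_manifold ::
  "('a::{t2_space, second_countable_topology}, 'm::finite) chart set \<Rightarrow> ('a, 'm) tensor2 \<Rightarrow> bool" where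
  "closed_riemannian_manifold A g \<longleftrightarrow> closed_manifold A \<and> riemannian_metric A g"

definition spd_tensor ::
  "('a, 'm::finite) chart set \<Rightarrow> ('a, 'm) tensor2 \<Rightarrow> ('a, 'm) tensor2 \<Rightarrow> bool" where
  "spd_tensor A g T \<longleftrightarrow>
     (\<forall>c\<in>A. smooth_on (cimg c) (T c \<circ> cinv c)) \<and>
     (\<forall>c\<in>A. \<forall>c'\<in>A. \<forall>p\<in>cdom c \<inter> cdom c'. jac c c' p ** T c p = T c' p ** jac c c' p) \<and>
     (\<forall>c\<in>A. \<forall>p\<in>cdom c.
        (\<forall>v w. (T c p *v v) \<bullet> (g c p *v w) = v \<bullet> (g c p *v (T c p *v w))) \<and>
        (\<forall>v. v \<noteq> 0 \<longrightarrow> (T c p *v v) \<bullet> (g c p *v v) > 0))"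

definition apply_tensor ::
  "('a, 'm::finite) tensor2 \<Rightarrow> ('a, 'm) vfield \<Rightarrow> ('a, 'm) vfield" where
  "apply_tensor T X = (\<lambda>c p. T c p *v X c p)"

text \<open>
  Scalars built from tensor fields are evaluated in the chart \<^const>\<open>chart_at\<close>; by the
  transformation laws the value is the same in every chart around the point.
\<close>

definition inner_g :: "('a, 'm::finite) chart set \<Rightarrow> ('a, 'm) tensor2 \<Rightarrow>
    ('a, 'm) vfield \<Rightarrow> ('a, 'm) vfield \<Rightarrow> 'a \<Rightarrow> real" where
  "inner_g A g X Y p = (let c = chart_at A p in X c p \<bullet> (g c p *v Y c p))"

definition pderiv_at :: "(real ^ 'm::finite \<Rightarrow> real) \<Rightarrow> real ^ 'm \<Rightarrow> 'm \<Rightarrow> real" where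
  "pderiv_at F y j = frechet_derivative F (at y) (axis j 1)"

text \<open>\<open>(\<nabla>h)\<^sup>i = g\<^sup>i\<^sup>j \<partial>\<^sub>j h\<close>\<close>

definition grad :: "('a, 'm::finite) tensor2 \<Rightarrow> ('a \<Rightarrow> real) \<Rightarrow> ('a, 'm) vfield" where
  "grad g h = (\<lambda>c p. matrix_inv (g c p) *v (\<chi> j. pderiv_at (h \<circ> cinv c) (cmap c p) j))"

text \<open>\<open>div X = (det g)\<^sup>-\<^sup>1\<^sup>/\<^sup>2 \<partial>\<^sub>i ((det g)\<^sup>1\<^sup>/\<^sup>2 X\<^sup>i)\<close>\<close>

definition divergence ::
  "('a, 'm::finite) chart set \<Rightarrow> ('a, 'm) tensor2 \<Rightarrow> ('a, 'm) vfield \<Rightarrow> 'a \<Rightarrow> real" where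
  "divergence A g X p = (let c = chart_at A p in
     (\<Sum>i\<in>UNIV. pderiv_at (\<lambda>y. sqrt (det (g c (cinv c y))) * X c (cinv c y) $ i) (cmap c p) i)
       / sqrt (det (g c p)))"

text \<open>
  The Riemannian volume is the unique Borel measure with density \<open>(det g)\<^sup>1\<^sup>/\<^sup>2\<close> in each chart.
  No orientability is needed for this.
\<close>

definition riemannian_volume ::
  "('a::topological_space, 'm::finite) chart set \<Rightarrow> ('a, 'm) tensor2 \<Rightarrow> 'a measure" where
  "riemannian_volume A g = (THE \<nu>. sets \<nu> = sets borel \<and>
     (\<forall>c\<in>A. \<forall>B\<in>sets borel. B \<subseteq> cdom c \<longrightarrow>
        emeasure \<nu> B = (\<integral>\<^sup>+ y \<in> cmap c ` B. ennreal (sqrt (det (g c (cinv c y)))) \<partial>lborel)))"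

definition weighted_measure :: "('a::topological_space, 'm::finite) chart set \<Rightarrow>
    ('a, 'm) tensor2 \<Rightarrow> ('a \<Rightarrow> real) \<Rightarrow> 'a measure" where
  "weighted_measure A g f = density (riemannian_volume A g) (\<lambda>x. ennreal (exp (- f x)))"

definition L_op :: "('a, 'm::finite) chart set \<Rightarrow> ('a, 'm) tensor2 \<Rightarrow> ('a, 'm) tensor2 \<Rightarrow>
    ('a \<Rightarrow> real) \<Rightarrow> ('a \<Rightarrow> real) \<Rightarrow> 'a \<Rightarrow> real" where
  "L_op A g T f h p = divergence A g (apply_tensor T (grad g h)) p
     - inner_g A g (grad g f) (apply_tensor T (grad g h)) p"

definition L_vec :: "('a, 'm::finite) chart set \<Rightarrow> ('a, 'm) tensor2 \<Rightarrow> ('a, 'm) tensor2 \<Rightarrow>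
    ('a \<Rightarrow> real) \<Rightarrow> ('a \<Rightarrow> real ^ 'n::finite) \<Rightarrow> 'a \<Rightarrow> real ^ 'n" where
  "L_vec A g T f h p = (\<chi> i. L_op A g T f (\<lambda>x. h x $ i) p)"

definition energy_D :: "('a::topological_space, 'm::finite) chart set \<Rightarrow> ('a, 'm) tensor2 \<Rightarrow>
    ('a, 'm) tensor2 \<Rightarrow> ('a \<Rightarrow> real) \<Rightarrow> ('a \<Rightarrow> real \<Rightarrow> real ^ 'n::finite) \<Rightarrow> real \<Rightarrow> real" where
  "energy_D A g T f u t = - (\<integral>x. (\<Sum>i\<in>UNIV. inner_g A g
       (apply_tensor T (grad g (\<lambda>x. u x t $ i))) (grad g (\<lambda>x. u x t $ i)) x)
     \<partial>weighted_measure A g f)"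

definition mass_I :: "('a::topological_space, 'm::finite) chart set \<Rightarrow> ('a, 'm) tensor2 \<Rightarrow>
    ('a \<Rightarrow> real) \<Rightarrow> ('a \<Rightarrow> real \<Rightarrow> real ^ 'n::finite) \<Rightarrow> real \<Rightarrow> real" where
  "mass_I A g f u t = (\<integral>x. u x t \<bullet> u x t \<partial>weighted_measure A g f)"

definition frequency_U :: "('a::topological_space, 'm::finite) chart set \<Rightarrow> ('a, 'm) tensor2 \<Rightarrow>
    ('a, 'm) tensor2 \<Rightarrow> ('a \<Rightarrow> real) \<Rightarrow> ('a \<Rightarrow> real \<Rightarrow> real ^ 'n::finite) \<Rightarrow> real \<Rightarrow> real" where
  "frequency_U A g T f u t = energy_D A g T f u t / mass_I A g f u t"

definition is_eigenfunction :: "('a, 'm::finite) chart set \<Rightarrow> ('a, 'm) tensor2 \<Rightarrow>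
    ('a, 'm) tensor2 \<Rightarrow> ('a \<Rightarrow> real) \<Rightarrow> real \<Rightarrow> real \<Rightarrow> ('a \<Rightarrow> real \<Rightarrow> real ^ 'n::finite) \<Rightarrow> bool" where
  "is_eigenfunction A g T f a b u \<longleftrightarrow>
     (\<forall>t\<in>{a..b}. \<exists>l::real. \<forall>x. L_vec A g T f (\<lambda>x. u x t) x = l *\<^sub>R u x t)"

end

theory Submission imports Defs
begin

text \<open>
  The mass and the energy satisfy
    \<open>I' = 2 D + 2 \<phi> I\<close> and \<open>D' = 2 Q + 2 \<phi> D\<close> with \<open>Q = \<integral> \<bar>\<L>u\<bar>\<^sup>2 d\<mu>\<close>,
  so \<open>\<phi>\<close> drops out of the derivative of the quotient \<open>U = D / I\<close>:
    \<open>U' = 2 (Q I - D\<^sup>2) / I\<^sup>2 = (2 / I) \<integral> \<bar>\<L>u - U u\<bar>\<^sup>2 d\<mu> \<ge> 0\<close>.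
  If \<open>U\<close> is constant, the continuous integrand vanishes; thus \<open>\<L>u = U u\<close>, the equation turns into
  \<open>u\<^sub>t = (U + \<phi>) u\<close> at each point, and it integrates to the stated exponential. Finally
  \<open>(log I)' = 2 U + 2 \<phi>\<close> is nondecreasing when \<open>\<phi>\<close> is (\<open>frequency_derivative\<close>, \<open>eigen_of_constant\<close>,
  \<open>solution_of_constant\<close>, \<open>log_mass_convex\<close>).

  All of this rests on Green's formula \<open>\<integral> h \<L>k d\<mu> = - \<integral> T(\<nabla>k, \<nabla>h) d\<mu>\<close> (\<open>green\<close>). It gives
  \<open>D = \<integral> u \<bullet> \<L>u d\<mu>\<close> and the symmetry of \<open>\<L>\<close>, and by symmetry
    \<open>D(s) - D(t) = \<integral> (u(s) - u(t)) \<bullet> (\<L>u(s) + \<L>u(t)) d\<mu>\<close>.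
  Since \<open>\<L>u = u\<^sub>t - \<phi> u\<close> is continuous in space-time, dominated convergence yields
  \<open>D' = 2 \<integral> u\<^sub>t \<bullet> \<L>u d\<mu>\<close> with only one time derivative of \<open>u\<close> involved
  (\<open>has_derivative_bilinear_energy\<close>).

  Green's formula follows from the divergence theorem on the manifold (\<open>integration_by_parts\<close>). A
  partition of unity reduces it to one chart. There the coordinate expression of the divergence
  reduces it to the fact that the derivative of a compactly supported function has integral zero,
  a consequence of translation invariance of Lebesgue measure. Two preparations are needed to make
  sense of the objects involved. The Riemannian volume exists and is unique by the change of
  variables formula on overlaps of charts (\<open>is_volume_exists\<close>, \<open>is_volume_unique\<close>). The divergence
  does not depend on the chart, because its coordinate expressions represent the same functional
  on test functions (\<open>chart_div_indep\<close>).
\<close>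

section \<open>Calculus of functions with one continuous derivative\<close>

text \<open>
  The divergence theorem is an identity about first derivatives, so bumps, partitions of unity and
  vector fields are all treated at this level of regularity.
\<close>
abbreviation C1_on :: "'a::euclidean_space set \<Rightarrow> ('a \<Rightarrow> 'b::real_normed_vector) \<Rightarrow> bool" where
  "C1_on \<equiv> Ck_on (Suc 0)"

lemma Ck_on_Suc_imp:
  "Ck_on (Suc k) S F \<Longrightarrow> Ck_on k S F"
proof (induction k arbitrary: F)
  case 0
  then show ?case by (simp add: differentiable_imp_continuous_on)
next
  case (Suc k)
  then show ?case by simp
qed

lemma C1_onI:
  assumes S: "open S"
    and d: "\<And>x. x \<in> S \<Longrightarrow> (F has_derivative F' x) (at x)"
    and c: "\<And>v. continuous_on S (\<lambda>x. F' x v)"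
  shows "C1_on S F"
proof -
  have *: "frechet_derivative F (at x within S) = F' x" if "x \<in> S" for x
    unfolding at_within_open[OF that S] using frechet_derivative_at[OF d[OF that]] by simp
  have "continuous_on S (\<lambda>x. frechet_derivative F (at x within S) v)" for v
    using c[of v] * by (simp cong: continuous_on_cong)
  moreover have "F differentiable_on S"
    using d unfolding differentiable_on_def differentiable_def by (blast intro: has_derivative_at_withinI)
  ultimately show ?thesis by simp
qed

lemma C1_on_differentiable:
  assumes "C1_on S F" "open S" "x \<in> S"
  shows "F differentiable at x"
  using assms(1,3) at_within_open[OF assms(3,2)] unfolding Ck_on.simps differentiable_on_def by metis

lemma C1_on_has_derivative:
  assumes "C1_on S F" "open S" "x \<in> S"
  shows "(F has_derivative frechet_derivative F (at x)) (at x)"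
  using C1_on_differentiable[OF assms] by (simp only: frechet_derivative_works)

lemma C1_on_continuous_derivative:
  assumes "C1_on S F" "open S"
  shows "continuous_on S (\<lambda>x. frechet_derivative F (at x) v)"
proof -
  have "continuous_on S (\<lambda>x. frechet_derivative F (at x within S) v)"
    using assms(1) by simp
  moreover have "at x within S = at x" if "x \<in> S" for x
    using that assms(2) by (rule at_within_open)
  ultimately show ?thesis
    by (simp cong: continuous_on_cong)
qed

lemma C1_on_continuous: "C1_on S F \<Longrightarrow> continuous_on S F"
  by (simp add: differentiable_imp_continuous_on)

lemma C1_on_cong:
  assumes "C1_on S F" "open S" "\<And>x. x \<in> S \<Longrightarrow> G x = F x"
  shows "C1_on S G"
proof (intro C1_onI[where F' = "\<lambda>x. frechet_derivative F (at x)"])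
  show "(G has_derivative frechet_derivative F (at x)) (at x)" if "x \<in> S" for x
    using C1_on_has_derivative[OF assms(1,2) that] assms(2) that
    by (rule has_derivative_transform_within_open) (simp add: assms(3))
qed (use C1_on_continuous_derivative[OF assms(1,2)] assms(2) in blast)+

text \<open>
  Continuity of the derivative is a local matter. This makes functions glued from several
  formulas, such as a bump extended by zero, accessible to the rules below.
\<close>
lemma C1_on_local:
  assumes "open S" "\<And>x. x \<in> S \<Longrightarrow> \<exists>U. open U \<and> x \<in> U \<and> C1_on U F"
  shows "C1_on S F"
proof (intro C1_onI[where F' = "\<lambda>x. frechet_derivative F (at x)"])
  show "(F has_derivative frechet_derivative F (at x)) (at x)" if "x \<in> S" for x
    using assms(2)[OF that] C1_on_has_derivative by blast
  show "continuous_on S (\<lambda>x. frechet_derivative F (at x) v)" for v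
  proof (rule continuous_at_imp_continuous_on, rule ballI)
    fix x assume "x \<in> S"
    then obtain U where "open U" "x \<in> U" "C1_on U F" using assms(2) by blast
    then show "isCont (\<lambda>x. frechet_derivative F (at x) v) x"
      using C1_on_continuous_derivative continuous_on_eq_continuous_at by blast
  qed
qed (fact assms(1))

lemma C1_on_const: "open S \<Longrightarrow> C1_on S (\<lambda>x. k)"
  by (rule C1_onI[where F' = "\<lambda>x v. 0"]) auto

lemma C1_on_add:
  assumes "open S" "C1_on S F" "C1_on S G"
  shows "C1_on S (\<lambda>x. F x + G x)"
proof (rule C1_onI[where F' = "\<lambda>x v. frechet_derivative F (at x) v + frechet_derivative G (at x) v"])
  show "((\<lambda>x. F x + G x) has_derivative
      (\<lambda>v. frechet_derivative F (at x) v + frechet_derivative G (at x) v)) (at x)" if "x \<in> S" for x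
    by (intro has_derivative_add C1_on_has_derivative[OF _ assms(1) that] assms)
  show "continuous_on S (\<lambda>x. frechet_derivative F (at x) v + frechet_derivative G (at x) v)" for v
    by (intro continuous_on_add C1_on_continuous_derivative assms)
qed (fact assms)

lemma C1_on_mult:
  fixes F G :: "'a::euclidean_space \<Rightarrow> real"
  assumes "open S" "C1_on S F" "C1_on S G"
  shows "C1_on S (\<lambda>x. F x * G x)"
proof (rule C1_onI[where F' = "\<lambda>x v. F x * frechet_derivative G (at x) v + frechet_derivative F (at x) v * G x"])
  show "((\<lambda>x. F x * G x) has_derivative
      (\<lambda>v. F x * frechet_derivative G (at x) v + frechet_derivative F (at x) v * G x)) (at x)" if "x \<in> S" for x
    by (intro has_derivative_mult C1_on_has_derivative[OF _ assms(1) that] assms)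
  show "continuous_on S (\<lambda>x. F x * frechet_derivative G (at x) v + frechet_derivative F (at x) v * G x)" for v
    by (intro continuous_on_add continuous_on_mult C1_on_continuous_derivative
        C1_on_continuous[OF assms(2)] C1_on_continuous[OF assms(3)] assms)
qed (fact assms)

lemma C1_on_sum:
  assumes S: "open S" and F: "\<And>i. i \<in> I \<Longrightarrow> C1_on S (F i)"
  shows "C1_on S (\<lambda>x. \<Sum>i\<in>I. F i x)"
  using F
proof (induction I rule: infinite_finite_induct)
  case (insert i I)
  then have "C1_on S (\<lambda>x. F i x + (\<Sum>i\<in>I. F i x))"
    by (intro C1_on_add[OF S]) blast+
  then show ?case using insert by (simp del: Ck_on.simps)
qed (use C1_on_const[OF S, of 0] in \<open>simp_all del: Ck_on.simps\<close>)

lemma C1_on_prod: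
  fixes F :: "'i \<Rightarrow> 'a::euclidean_space \<Rightarrow> real"
  assumes S: "open S" and F: "\<And>i. i \<in> I \<Longrightarrow> C1_on S (F i)"
  shows "C1_on S (\<lambda>x. \<Prod>i\<in>I. F i x)"
  using F
proof (induction I rule: infinite_finite_induct)
  case (insert i I)
  then have "C1_on S (\<lambda>x. F i x * (\<Prod>i\<in>I. F i x))"
    by (intro C1_on_mult[OF S]) blast+
  then show ?case using insert by (simp del: Ck_on.simps)
qed (use C1_on_const[OF S, of 1] in \<open>simp_all del: Ck_on.simps\<close>)

lemma C1_on_real_compose:
  fixes F :: "'a::euclidean_space \<Rightarrow> real" and h :: "real \<Rightarrow> real"
  assumes S: "open S" and F: "C1_on S F"
    and h: "\<And>x. x \<in> S \<Longrightarrow> (h has_real_derivative h' (F x)) (at (F x))"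
    and h': "continuous_on (F ` S) h'"
  shows "C1_on S (\<lambda>x. h (F x))"
proof (rule C1_onI[where F' = "\<lambda>x v. h' (F x) * frechet_derivative F (at x) v"])
  fix x assume x: "x \<in> S"
  show "((\<lambda>x. h (F x)) has_derivative (\<lambda>v. h' (F x) * frechet_derivative F (at x) v)) (at x)"
    using has_derivative_compose[OF C1_on_has_derivative[OF F S x] h[OF x, unfolded has_field_derivative_def]]
    by simp
next
  fix v
  show "continuous_on S (\<lambda>x. h' (F x) * frechet_derivative F (at x) v)"
    by (intro continuous_on_mult continuous_on_compose2[OF h'] C1_on_continuous[OF F]
        C1_on_continuous_derivative[OF F S]) auto
qed (fact S)

lemma C1_on_inverse:
  fixes F :: "'a::euclidean_space \<Rightarrow> real"
  assumes "open S" "C1_on S F" "\<And>x. x \<in> S \<Longrightarrow> F x \<noteq> 0"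
  shows "C1_on S (\<lambda>x. inverse (F x))"
  by (rule C1_on_real_compose[OF assms(1,2), where h' = "\<lambda>y. - (inverse y ^ 2)"])
    (use assms(3) in \<open>auto intro!: derivative_eq_intros continuous_intros simp: power2_eq_square\<close>)

lemma C1_on_divide:
  fixes F G :: "'a::euclidean_space \<Rightarrow> real"
  assumes "open S" "C1_on S F" "C1_on S G" "\<And>x. x \<in> S \<Longrightarrow> G x \<noteq> 0"
  shows "C1_on S (\<lambda>x. F x / G x)"
  unfolding divide_inverse by (intro C1_on_mult C1_on_inverse assms)

lemma C1_on_sqrt:
  fixes F :: "'a::euclidean_space \<Rightarrow> real"
  assumes "open S" "C1_on S F" "\<And>x. x \<in> S \<Longrightarrow> F x > 0"
  shows "C1_on S (\<lambda>x. sqrt (F x))"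
  by (rule C1_on_real_compose[OF assms(1,2), where h' = "\<lambda>y. inverse (sqrt y) / 2"])
    (use assms(3) in \<open>force intro!: DERIV_real_sqrt continuous_intros\<close>)+

lemma C1_on_exp:
  fixes F :: "'a::euclidean_space \<Rightarrow> real"
  assumes "open S" "C1_on S F"
  shows "C1_on S (\<lambda>x. exp (F x))"
  by (rule C1_on_real_compose[OF assms(1,2), where h' = exp])
    (auto intro!: DERIV_exp continuous_intros)

text \<open>
  On an arbitrary \<open>S\<close> derivatives within \<open>S\<close> need not be unique, but the set of all of them only
  depends on the values on \<open>S\<close>, and so does the one chosen by \<^const>\<open>frechet_derivative\<close>.
\<close>
lemma Ck_on_cong:
  assumes "\<And>x. x \<in> S \<Longrightarrow> F x = G x"
  shows "Ck_on k S F = Ck_on k S G"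
  using assms
proof (induction k arbitrary: F G)
  case 0
  then show ?case by (simp cong: continuous_on_cong)
next
  case (Suc k)
  have d: "(F has_derivative D) (at x within S) = (G has_derivative D) (at x within S)"
    if "x \<in> S" for x D
    using has_derivative_transform[OF that, of G F] has_derivative_transform[OF that, of F G]
      Suc.prems by (metis (no_types, lifting))
  then have "frechet_derivative F (at x within S) = frechet_derivative G (at x within S)" if "x \<in> S" for x
    using that by (simp add: frechet_derivative_def)
  then have "Ck_on k S (\<lambda>x. frechet_derivative F (at x within S) v) =
      Ck_on k S (\<lambda>x. frechet_derivative G (at x within S) v)" for v
    by (intro Suc.IH) simp
  moreover have "F differentiable_on S \<longleftrightarrow> G differentiable_on S"
    using d by (simp add: differentiable_on_def differentiable_def)
  ultimately show ?case by simp
qed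

lemma Ck_on_linear_compose:
  fixes F :: "'a::euclidean_space \<Rightarrow> 'b::real_normed_vector"
  assumes l: "bounded_linear l" and S: "open S"
  shows "Ck_on k S F \<Longrightarrow> Ck_on k S (\<lambda>x. l (F x))"
proof (induction k arbitrary: F)
  case 0
  then show ?case
    using bounded_linear.continuous_on[OF l] by simp
next
  case (Suc k)
  have d: "((\<lambda>x. l (F x)) has_derivative (\<lambda>v. l (frechet_derivative F (at x within S) v))) (at x within S)"
    if "x \<in> S" for x
    using Suc.prems that
    by (auto intro!: bounded_linear.has_derivative[OF l] simp: differentiable_on_def frechet_derivative_works)
  have e: "frechet_derivative (\<lambda>x. l (F x)) (at x within S) = (\<lambda>v. l (frechet_derivative F (at x within S) v))"
    if "x \<in> S" for x
    using frechet_derivative_at[OF d[OF that, unfolded at_within_open[OF that S]]] at_within_open[OF that S] by simp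
  have "Ck_on k S (\<lambda>x. frechet_derivative (\<lambda>x. l (F x)) (at x within S) v)" for v
  proof -
    have "Ck_on k S (\<lambda>x. l (frechet_derivative F (at x within S) v))"
      using Suc by simp
    then show ?thesis
      by (subst Ck_on_cong[where G = "\<lambda>x. l (frechet_derivative F (at x within S) v)"]) (simp_all add: e)
  qed
  then show ?case
    using d by (auto simp: differentiable_on_def differentiable_def)
qed

text \<open>
  The derivative of a slice in direction \<open>v\<close> is the slice of the derivative in the horizontal
  direction \<open>(v, 0)\<close>, and the latter is of class \<open>C\<^sup>k\<close> again, so the claim follows by induction.
\<close>
lemma Ck_on_slice:
  fixes F :: "'a::euclidean_space \<times> real \<Rightarrow> 'b::real_normed_vector"
  assumes S: "open S" and t: "t \<in> J"
  shows "Ck_on k (S \<times> J) F \<Longrightarrow> Ck_on k S (\<lambda>y. F (y, t))"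
proof (induction k arbitrary: F)
  case 0
  then show ?case
    using t by (auto intro!: continuous_on_compose2[of "S \<times> J" F] continuous_intros)
next
  case (Suc k)
  let ?D = "\<lambda>x. frechet_derivative F (at x within S \<times> J)"
  have d: "((\<lambda>y. F (y, t)) has_derivative (\<lambda>v. ?D (y, t) (v, 0))) (at y within S)" if "y \<in> S" for y
  proof -
    have "(F has_derivative ?D (y, t)) (at (y, t) within S \<times> J)"
      using Suc.prems that t by (auto simp: differentiable_on_def frechet_derivative_works)
    then have "(F has_derivative ?D (y, t)) (at (y, t) within (\<lambda>y. (y, t)) ` S)"
      by (rule has_derivative_subset) (use t in auto)
    moreover have "((\<lambda>y. (y, t)) has_derivative (\<lambda>v. (v, 0))) (at y within S)"
      by (intro has_derivative_Pair has_derivative_ident has_derivative_const)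
    ultimately show ?thesis
      using has_derivative_in_compose by fast
  qed
  have e: "frechet_derivative (\<lambda>y. F (y, t)) (at y within S) = (\<lambda>v. ?D (y, t) (v, 0))" if "y \<in> S" for y
    using frechet_derivative_at[OF d[OF that, unfolded at_within_open[OF that S]]] at_within_open[OF that S] by simp
  have "Ck_on k S (\<lambda>y. frechet_derivative (\<lambda>y. F (y, t)) (at y within S) v)" for v
  proof -
    have "Ck_on k S (\<lambda>y. ?D (y, t) (v, 0))"
      using Suc.prems by (intro Suc.IH) simp
    then show ?thesis
      by (subst Ck_on_cong[where G = "\<lambda>y. ?D (y, t) (v, 0)"]) (simp_all add: e)
  qed
  then show ?case
    using d by (auto simp: differentiable_on_def differentiable_def)
qed

lemma frechet_derivative_axis_sum:
  fixes F :: "real ^ 'm::finite \<Rightarrow> 'b::real_normed_vector"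
  assumes "F differentiable at y"
  shows "frechet_derivative F (at y) w = (\<Sum>i\<in>UNIV. w $ i *\<^sub>R frechet_derivative F (at y) (axis i 1))"
proof -
  have "linear (frechet_derivative F (at y))"
    using assms by (rule linear_frechet_derivative)
  then show ?thesis
    by (subst (1) basis_expansion[symmetric, of w]) (simp add: linear_sum linear_scale scalar_mult_eq_scaleR)
qed

text \<open>
  By the chain rule the derivative is \<open>F'(G x)\<close> applied to a direction that moves with \<open>x\<close>. Expanding
  this direction in the standard basis leaves only partial derivatives of \<open>F\<close>, which are continuous.
\<close>
lemma C1_on_compose:
  fixes F :: "real ^ 'm::finite \<Rightarrow> real" and G :: "real ^ 'k::finite \<Rightarrow> real ^ 'm"
  assumes U: "open U" and S: "open S" and F: "C1_on S F" and G: "C1_on U G" and GU: "G ` U \<subseteq> S"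
  shows "C1_on U (\<lambda>x. F (G x))"
proof (rule C1_onI[where F' = "\<lambda>x v. frechet_derivative F (at (G x)) (frechet_derivative G (at x) v)"])
  show "((\<lambda>x. F (G x)) has_derivative (\<lambda>v. frechet_derivative F (at (G x)) (frechet_derivative G (at x) v))) (at x)"
    if "x \<in> U" for x
    using has_derivative_compose[OF C1_on_has_derivative[OF G U that] C1_on_has_derivative[OF F S, of "G x"]]
      that GU by blast
next
  fix v
  have *: "frechet_derivative F (at (G x)) w = (\<Sum>i\<in>UNIV. w $ i * frechet_derivative F (at (G x)) (axis i 1))"
    if "x \<in> U" for x w
    using frechet_derivative_axis_sum[OF C1_on_differentiable[OF F S], of "G x" w] GU that by auto
  have "continuous_on U (\<lambda>x. \<Sum>i\<in>UNIV. frechet_derivative G (at x) v $ i * frechet_derivative F (at (G x)) (axis i 1))"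
    by (intro continuous_intros C1_on_continuous_derivative[OF G U]
        continuous_on_compose2[OF C1_on_continuous_derivative[OF F S] C1_on_continuous[OF G] GU])
  then show "continuous_on U (\<lambda>x. frechet_derivative F (at (G x)) (frechet_derivative G (at x) v))"
    by (subst continuous_on_cong[OF refl *]) auto
qed (fact U)

lemma C1_on_det:
  fixes M :: "'a::euclidean_space \<Rightarrow> real ^ 'm::finite ^ 'm"
  assumes "open S" "\<And>i j. C1_on S (\<lambda>x. M x $ i $ j)"
  shows "C1_on S (\<lambda>x. det (M x))"
  unfolding det_def
  by (intro C1_on_sum C1_on_mult C1_on_prod C1_on_const assms)

lemma C1_on_vec_nth:
  fixes F :: "'a::euclidean_space \<Rightarrow> 'b::real_normed_vector ^ 'm::finite"
  assumes "open S" "C1_on S F"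
  shows "C1_on S (\<lambda>x. F x $ i)"
  using Ck_on_linear_compose[OF bounded_linear_vec_nth assms] .

section \<open>Inverse and determinant of a positive definite matrix\<close>

lemma matrix_inv_right_inverse:
  fixes M :: "real ^ 'm::finite ^ 'm"
  assumes "det M \<noteq> 0"
  shows "M ** matrix_inv M = mat 1"
  using someI_ex[of "\<lambda>M'. M ** M' = mat 1 \<and> M' ** M = mat 1"] assms
  unfolding matrix_inv_def invertible_det_nz[symmetric] invertible_def by blast

text \<open>
  Cramer's rule writes the entries of \<open>M\<^sup>-\<^sup>1 b\<close> as quotients of polynomials in the entries of
  \<open>M\<close> and \<open>b\<close>. This is how the gradient inherits its regularity from the metric.
\<close>
lemma matrix_inv_mult_nth:
  fixes M :: "real ^ 'm::finite ^ 'm"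
  assumes "det M \<noteq> 0"
  shows "(matrix_inv M *v b) $ k = det (\<chi> i j. if j = k then b $ i else M $ i $ j) / det M"
proof -
  have "M ** matrix_inv M = mat 1"
    using assms by (rule matrix_inv_right_inverse)
  then have "M *v (matrix_inv M *v b) = b"
    by (simp add: matrix_vector_mul_assoc)
  then have "matrix_inv M *v b = (\<chi> k. det (\<chi> i j. if j = k then b $ i else M $ i $ j) / det M)"
    using cramer[OF assms] by blast
  then show ?thesis by simp
qed

lemma C1_on_matrix_inv_mult:
  fixes M :: "'a::euclidean_space \<Rightarrow> real ^ 'm::finite ^ 'm"
  assumes S: "open S" and M: "\<And>i j. C1_on S (\<lambda>x. M x $ i $ j)" and b: "\<And>i. C1_on S (\<lambda>x. b x $ i)"
    and d: "\<And>x. x \<in> S \<Longrightarrow> det (M x) \<noteq> 0"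
  shows "C1_on S (\<lambda>x. (matrix_inv (M x) *v b x) $ k)"
proof -
  have "C1_on S (\<lambda>x. det (\<chi> i j. if j = k then b x $ i else M x $ i $ j) / det (M x))"
  proof (intro C1_on_divide C1_on_det S)
    show "C1_on S (\<lambda>x. (\<chi> i j. if j = k then b x $ i else M x $ i $ j) $ i $ j)" for i j
      using M b by (cases "j = k") (simp_all del: Ck_on.simps)
  qed (use M d in auto)
  then show ?thesis
    by (rule C1_on_cong[OF _ S]) (simp add: matrix_inv_mult_nth d)
qed

lemma C1_on_matrix_vector_mult:
  fixes M :: "'a::euclidean_space \<Rightarrow> real ^ 'm::finite ^ 'k::finite"
  assumes "open S" "\<And>i j. C1_on S (\<lambda>x. M x $ i $ j)" "\<And>i. C1_on S (\<lambda>x. b x $ i)"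
  shows "C1_on S (\<lambda>x. (M x *v b x) $ k)"
  unfolding matrix_vector_mult_def vec_lambda_beta by (intro C1_on_sum C1_on_mult assms)

text \<open>
  The segment from the identity to \<open>M\<close> consists of positive definite, hence nonsingular, matrices.
  The determinant is \<open>1\<close> at one end and cannot change its sign on the way.
\<close>
lemma det_pos_of_pos_def:
  fixes M :: "real ^ 'm::finite ^ 'm"
  assumes M: "\<And>v. v \<noteq> 0 \<Longrightarrow> v \<bullet> (M *v v) > 0"
  shows "det M > 0"
proof (rule ccontr)
  assume "\<not> det M > 0"
  define N where "N s = (1 - s) *\<^sub>R mat 1 + s *\<^sub>R M" for s :: real
  have "continuous_on {0..1} (\<lambda>s. det (N s))"
    unfolding det_def N_def by (intro continuous_intros)
  moreover have "det (N 0) = 1" "det (N 1) \<le> 0"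
    using \<open>\<not> det M > 0\<close> by (auto simp: N_def)
  ultimately obtain s where s: "0 \<le> s" "s \<le> 1" "det (N s) = 0"
    using IVT2'[of "\<lambda>s. det (N s)" 1 0 0] by auto
  then have "\<not> invertible (N s)" by (simp add: invertible_det_nz)
  then obtain v where v: "N s *v v = 0" "v \<noteq> 0"
    using matrix_left_invertible_ker[of "N s"] invertible_left_inverse by blast
  have "(1 - s) * (v \<bullet> v) + s * (v \<bullet> (M *v v)) = v \<bullet> (N s *v v)"
    unfolding N_def matrix_vector_mult_add_rdistrib scaleR_matrix_vector_assoc[symmetric] inner_add_right
      matrix_vector_mul_lid inner_scaleR_right ..
  also have "\<dots> = 0" unfolding v(1) by simp
  finally have zero: "(1 - s) * (v \<bullet> v) + s * (v \<bullet> (M *v v)) = 0" .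
  have pos: "v \<bullet> v > 0" "v \<bullet> (M *v v) > 0" using M[OF v(2)] v(2) by simp_all
  show False
  proof (cases "s = 0")
    case False
    then have "s * (v \<bullet> (M *v v)) > 0" using s(1) pos(2) by simp
    moreover have "(1 - s) * (v \<bullet> v) \<ge> 0" using s(2) pos(1) by simp
    ultimately show ?thesis using zero by linarith
  next
    case True
    then show ?thesis using zero pos(1) by simp
  qed
qed

section \<open>Change of variables for nonnegative functions\<close>

text \<open>
  Translates between absolute gauge integrability, in which the change of variables theorem is
  phrased, and the Lebesgue integral of a nonnegative function, in which measures are computed.
\<close>
lemma absolutely_integrable_nn_integral_iff:
  fixes A :: "'a::euclidean_space set" and h :: "'a \<Rightarrow> real"
  assumes A: "A \<in> sets borel" and m: "(\<lambda>y. indicator A y * h y) \<in> borel_measurable borel"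
    and h: "\<And>y. y \<in> A \<Longrightarrow> 0 \<le> h y"
  shows "h absolutely_integrable_on A \<and> integral A h = b \<longleftrightarrow>
    (\<integral>\<^sup>+ y. ennreal (indicator A y * h y) \<partial>lborel) = ennreal b \<and> 0 \<le> b"
proof -
  let ?f = "\<lambda>y. indicator A y * h y"
  have pos: "0 \<le> ?f y" for y using h by (auto simp: indicator_def)
  have i: "h absolutely_integrable_on A \<longleftrightarrow> integrable lborel ?f"
    using integrable_completion[of ?f lborel] m by (simp add: set_integrable_def)
  have v: "integral A h = integral\<^sup>L lborel ?f" if "integrable lborel ?f"
    using set_borel_integral_eq_integral[of A h] that
    by (simp add: set_integrable_def set_lebesgue_integral_def)
  have n: "(\<integral>\<^sup>+ y. ennreal (?f y) \<partial>lborel) = ennreal (integral\<^sup>L lborel ?f)" if "integrable lborel ?f"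
    using nn_integral_eq_integral[OF that] pos by simp
  have p: "integral\<^sup>L lborel ?f \<ge> 0" using pos by (intro integral_nonneg_AE) auto
  show ?thesis
  proof
    assume "h absolutely_integrable_on A \<and> integral A h = b"
    then show "(\<integral>\<^sup>+ y. ennreal (?f y) \<partial>lborel) = ennreal b \<and> 0 \<le> b"
      using i v n p by auto
  next
    assume r: "(\<integral>\<^sup>+ y. ennreal (?f y) \<partial>lborel) = ennreal b \<and> 0 \<le> b"
    then have "integrable lborel ?f"
      using m pos by (intro integrableI_nonneg) auto
    then show "h absolutely_integrable_on A \<and> integral A h = b"
      using i v n p r by auto
  qed
qed

text \<open>
  The change of variables theorem says that one side has the finite value \<open>b\<close> if and only if the
  other side does. Two elements of \<open>[0, \<infinity>]\<close> with this property for every \<open>b\<close> are equal, whether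
  finite or not.
\<close>
lemma nn_integral_change_of_variables_wellorder:
  fixes G :: "real ^ 'm::{finite,wellorder} \<Rightarrow> real ^ 'm::_" and h :: "real ^ 'm::_ \<Rightarrow> real"
  assumes S: "S \<in> sets borel" and GS: "G ` S \<in> sets borel" and inj: "inj_on G S"
    and d: "\<And>x. x \<in> S \<Longrightarrow> (G has_derivative G' x) (at x within S)"
    and h: "\<And>y. y \<in> G ` S \<Longrightarrow> 0 \<le> h y"
    and m1: "(\<lambda>y. indicator (G ` S) y * h y) \<in> borel_measurable borel"
    and m2: "(\<lambda>x. indicator S x * (\<bar>det (matrix (G' x))\<bar> * h (G x))) \<in> borel_measurable borel"
  shows "(\<integral>\<^sup>+ y. ennreal (indicator (G ` S) y * h y) \<partial>lborel) =
    (\<integral>\<^sup>+ x. ennreal (indicator S x * (\<bar>det (matrix (G' x))\<bar> * h (G x))) \<partial>lborel)"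
    (is "?L = ?R")
proof -
  \<comment> \<open>the scalar integrand is regarded as one with values in the one-dimensional vector space\<close>
  have cov: "(\<lambda>x. \<bar>det (matrix (G' x))\<bar> *\<^sub>R (vec (h (G x)) :: real^1)) absolutely_integrable_on S \<and>
           integral S (\<lambda>x. \<bar>det (matrix (G' x))\<bar> *\<^sub>R (vec (h (G x)) :: real^1)) = vec b
     \<longleftrightarrow> (\<lambda>y. vec (h y) :: real^1) absolutely_integrable_on (G ` S) \<and> integral (G ` S) (\<lambda>y. vec (h y) :: real^1) = vec b"
    for b
    using S by (intro has_absolute_integral_change_of_variables d inj) simp_all
  have "(\<lambda>x. \<bar>det (matrix (G' x))\<bar> * h (G x)) absolutely_integrable_on S \<and>
           integral S (\<lambda>x. \<bar>det (matrix (G' x))\<bar> * h (G x)) = b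
     \<longleftrightarrow> h absolutely_integrable_on (G ` S) \<and> integral (G ` S) h = b" for b
    using cov[of b] unfolding absolutely_integrable_on_1_iff integral_on_1_eq
    by (simp add: vec_eq_iff)
  then have iff: "?L = ennreal b \<and> 0 \<le> b \<longleftrightarrow> ?R = ennreal b \<and> 0 \<le> b" for b
    using absolutely_integrable_nn_integral_iff[OF GS m1 h, of b]
      absolutely_integrable_nn_integral_iff[OF S m2, of b] h by auto
  show ?thesis
  proof (cases ?L)
    case (real b)
    then show ?thesis using iff[of b] by simp
  next
    case top
    then show ?thesis using iff by (cases ?R) (metis ennreal_neq_top)+
  qed
qed

text \<open>
  The change of variables theorem is about index types with a well-order. An arbitrary finite index
  type has a copy that is ordered by an enumeration, and relabelling the coordinates changes neither
  Lebesgue measure nor determinants, so the theorem carries over to all finite index types.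
\<close>
typedef 'm ordered_copy = "UNIV :: 'm set"
  morphisms of_copy to_copy ..

lemma bij_of_copy: "bij of_copy"
  by (metis bijI' of_copy_inject to_copy_inverse UNIV_I)

instance ordered_copy :: (finite) finite
  by standard (simp add: bij_betw_finite[OF bij_of_copy])

instantiation ordered_copy :: (finite) wellorder
begin

definition less_eq_ordered_copy :: "'a ordered_copy \<Rightarrow> 'a ordered_copy \<Rightarrow> bool" where
  "less_eq_ordered_copy i j \<longleftrightarrow> to_nat (of_copy i) \<le> to_nat (of_copy j)"

definition less_ordered_copy :: "'a ordered_copy \<Rightarrow> 'a ordered_copy \<Rightarrow> bool" where
  "less_ordered_copy i j \<longleftrightarrow> to_nat (of_copy i) < to_nat (of_copy j)"

instance
proof
  fix P :: "'a ordered_copy \<Rightarrow> bool" and a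
  assume step: "\<And>x. (\<And>y. y < x \<Longrightarrow> P y) \<Longrightarrow> P x"
  show "P a"
    by (induction "to_nat (of_copy a)" arbitrary: a rule: less_induct)
      (rule step, simp add: less_ordered_copy_def)
qed (auto simp: less_eq_ordered_copy_def less_ordered_copy_def of_copy_inject)

end

text \<open>
  Conjugation with \<open>f\<close> is a bijection between the permutations of the two index types that
  preserves signs, and it matches the terms of the two Leibniz expansions.
\<close>
lemma det_reindex:
  fixes M :: "real ^ 'm::finite ^ 'm" and f :: "'k::finite \<Rightarrow> 'm"
  assumes f: "bij f"
  shows "det (\<chi> i j. M $ f i $ f j) = det M"
proof -
  have inv: "inv f (f x) = x" "f (inv f y) = y" for x y
    using f by (simp_all add: bij_is_inj bij_is_surj surj_f_inv_f)
  have perm: "p permutes UNIV \<longleftrightarrow> bij p" for p :: "'k \<Rightarrow> 'k"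
    using bij_imp_permutes[of p UNIV] permutes_bij by blast
  have perm': "p permutes UNIV \<longleftrightarrow> bij p" for p :: "'m \<Rightarrow> 'm"
    using bij_imp_permutes[of p UNIV] permutes_bij by blast
  have b: "bij_betw (\<lambda>p. f \<circ> p \<circ> inv f) {p. p permutes UNIV} {q. q permutes UNIV}"
  proof (rule bij_betw_byWitness[where f' = "\<lambda>q. inv f \<circ> q \<circ> f"])
    show "(\<lambda>p. f \<circ> p \<circ> inv f) ` {p. p permutes UNIV} \<subseteq> {q. q permutes UNIV}"
      using f by (auto simp: perm perm' intro!: bij_comp bij_imp_bij_inv)
    show "(\<lambda>q. inv f \<circ> q \<circ> f) ` {q. q permutes UNIV} \<subseteq> {p. p permutes UNIV}"
      using f by (auto simp: perm perm' intro!: bij_comp bij_imp_bij_inv)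
  qed (auto simp: inv fun_eq_iff)
  have s: "sign (f \<circ> p \<circ> inv f) = sign p" if "p permutes UNIV" for p
    using sign_map_permutation[of f UNIV p] that f
    by (simp add: map_permutation_def bij_is_inj bij_is_surj restrict_id_def fun_eq_iff comp_def)
  have q: "(\<Prod>i\<in>UNIV. M $ f i $ f (p i)) = (\<Prod>i\<in>UNIV. M $ i $ (f \<circ> p \<circ> inv f) i)" for p
    using prod.reindex_bij_betw[OF f, of "\<lambda>i. M $ i $ (f \<circ> p \<circ> inv f) i"] by (simp add: inv)
  have "det M = (\<Sum>p | p permutes UNIV. of_int (sign (f \<circ> p \<circ> inv f)) * (\<Prod>i\<in>UNIV. M $ i $ (f \<circ> p \<circ> inv f) i))"
    unfolding det_def
    using sum.reindex_bij_betw[OF b, of "\<lambda>q. of_int (sign q) * (\<Prod>i\<in>UNIV. M $ i $ q i)"] by simp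
  also have "\<dots> = (\<Sum>p | p permutes (UNIV :: 'k set). of_int (sign p) * (\<Prod>i\<in>UNIV. M $ f i $ f (p i)))"
    by (rule sum.cong) (simp_all only: s q mem_Collect_eq)
  also have "\<dots> = det (\<chi> i j. M $ f i $ f j)"
    by (simp add: det_def)
  finally show ?thesis ..
qed

definition reindex :: "real ^ 'm ordered_copy \<Rightarrow> real ^ 'm::finite" where
  "reindex x = (\<chi> i. x $ to_copy i)"

definition unindex :: "real ^ 'm::finite \<Rightarrow> real ^ 'm ordered_copy" where
  "unindex y = (\<chi> i. y $ of_copy i)"

lemma reindex_unindex [simp]: "reindex (unindex y) = y" "unindex (reindex x) = x"
  by (simp_all add: reindex_def unindex_def vec_eq_iff to_copy_inverse of_copy_inverse)

lemma bounded_linear_reindex: "bounded_linear reindex"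
  by (simp add: reindex_def linear_conv_bounded_linear[symmetric] linear_iff vec_eq_iff)

lemma bounded_linear_unindex: "bounded_linear unindex"
  by (simp add: unindex_def linear_conv_bounded_linear[symmetric] linear_iff vec_eq_iff)

lemma measurable_reindex [measurable]: "reindex \<in> borel_measurable borel"
  by (intro borel_measurable_continuous_onI linear_continuous_on bounded_linear_reindex)

lemma prod_Basis_vec:
  fixes z :: "real ^ 'm::finite"
  shows "(\<Prod>b\<in>Basis. z \<bullet> b) = (\<Prod>i\<in>UNIV. z $ i)"
proof -
  have "bij_betw (\<lambda>i::'m. axis i (1::real)) UNIV Basis"
    by (auto simp: bij_betw_def Basis_vec_def inj_on_def axis_eq_axis)
  from prod.reindex_bij_betw[OF this, of "\<lambda>b. z \<bullet> b"] show ?thesis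
    by (simp add: inner_axis)
qed

text \<open>
  Relabelling maps boxes to boxes with the same side lengths, and boxes determine Lebesgue measure.
\<close>
lemma distr_reindex: "distr lborel borel reindex = (lborel :: (real ^ 'm::finite) measure)"
proof (rule lborel_eqI[symmetric])
  fix l u :: "real ^ 'm"
  assume lu: "\<And>b. b \<in> Basis \<Longrightarrow> l \<bullet> b \<le> u \<bullet> b"
  have le: "l $ i \<le> u $ i" for i
    using lu[of "axis i 1"] by (simp add: inner_axis axis_in_Basis_iff)
  have bij: "bij (to_copy :: 'm \<Rightarrow> 'm ordered_copy)"
    by (metis bijI' of_copy_inverse to_copy_inverse UNIV_I)
  have all: "(\<forall>i. P (to_copy i)) \<longleftrightarrow> (\<forall>i. P i)" for P :: "'m ordered_copy \<Rightarrow> bool"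
    by (metis of_copy_inverse)
  have box: "reindex -` box l u = box (unindex l) (unindex u)"
    by (auto simp: mem_box_cart reindex_def unindex_def) (metis of_copy_inverse to_copy_inverse UNIV_I)+
  have "emeasure (distr lborel borel reindex) (box l u) = emeasure lborel (box (unindex l) (unindex u))"
    by (subst emeasure_distr) (auto simp: box)
  also have "\<dots> = ennreal (\<Prod>b\<in>Basis. (unindex u - unindex l) \<bullet> b)"
    using le by (subst emeasure_lborel_box) (auto simp: Basis_vec_def inner_axis unindex_def)
  also have "(\<Prod>b\<in>Basis. (unindex u - unindex l) \<bullet> b) = (\<Prod>b\<in>Basis. (u - l) \<bullet> b)"
    using prod.reindex_bij_betw[OF bij_of_copy, of "\<lambda>i. (u - l) $ i"]
    by (simp add: prod_Basis_vec) (simp add: unindex_def)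
  finally show "emeasure (distr lborel borel reindex) (box l u) = ennreal (\<Prod>b\<in>Basis. (u - l) \<bullet> b)" .
qed simp

lemma nn_integral_reindex:
  fixes F :: "real ^ 'm::finite \<Rightarrow> ennreal"
  assumes "F \<in> borel_measurable borel"
  shows "(\<integral>\<^sup>+ y. F y \<partial>lborel) = (\<integral>\<^sup>+ x. F (reindex x) \<partial>lborel)"
  by (subst distr_reindex[symmetric], subst nn_integral_distr) (use assms in simp_all)

lemma det_matrix_unindex_reindex:
  fixes L :: "real ^ 'm::finite \<Rightarrow> real ^ 'm"
  shows "det (matrix (\<lambda>x. unindex (L (reindex x)))) = det (matrix L)"
proof -
  have a: "reindex (axis j 1) = axis (of_copy j) 1" for j :: "'m ordered_copy"
    by (auto simp: reindex_def vec_eq_iff axis_def to_copy_inverse of_copy_inverse)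
  have "matrix (\<lambda>x. unindex (L (reindex x))) = (\<chi> i j. matrix L $ of_copy i $ of_copy j)"
    by (simp add: matrix_def vec_eq_iff a) (simp add: unindex_def)
  then show ?thesis
    by (simp add: det_reindex[OF bij_of_copy])
qed

lemma nn_integral_change_of_variables:
  fixes G :: "real ^ 'm::finite \<Rightarrow> real ^ 'm" and h :: "real ^ 'm \<Rightarrow> real"
  assumes S: "S \<in> sets borel" and GS: "G ` S \<in> sets borel" and inj: "inj_on G S"
    and d: "\<And>x. x \<in> S \<Longrightarrow> (G has_derivative G' x) (at x within S)"
    and h: "\<And>y. y \<in> G ` S \<Longrightarrow> 0 \<le> h y"
    and m1: "(\<lambda>y. indicator (G ` S) y * h y) \<in> borel_measurable borel"
    and m2: "(\<lambda>x. indicator S x * (\<bar>det (matrix (G' x))\<bar> * h (G x))) \<in> borel_measurable borel"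
  shows "(\<integral>\<^sup>+ y. ennreal (indicator (G ` S) y * h y) \<partial>lborel) =
    (\<integral>\<^sup>+ x. ennreal (indicator S x * (\<bar>det (matrix (G' x))\<bar> * h (G x))) \<partial>lborel)"
proof -
  define S1 where "S1 = reindex -` S"
  define G1 where "G1 x = unindex (G (reindex x))" for x
  define G1' where "G1' x = (\<lambda>v. unindex (G' (reindex x) (reindex v)))" for x
  have S1: "S1 \<in> sets borel"
    using measurable_sets_borel[OF measurable_reindex S] by (simp add: S1_def)
  have im: "G1 ` S1 = reindex -` (G ` S)"
  proof (intro set_eqI iffI)
    fix x assume "x \<in> reindex -` (G ` S)"
    then obtain s where s: "s \<in> S" "reindex x = G s" by auto
    then have "x = G1 (unindex s)" unfolding G1_def by (metis reindex_unindex)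
    then show "x \<in> G1 ` S1" using s by (auto simp: S1_def)
  qed (auto simp: G1_def S1_def)
  have GS1: "G1 ` S1 \<in> sets borel"
    using measurable_sets_borel[OF measurable_reindex GS] by (simp add: im)
  have inj1: "inj_on G1 S1"
    unfolding inj_on_def G1_def S1_def
    by (metis inj inj_onD reindex_unindex vimage_eq)
  have d1: "(G1 has_derivative G1' x) (at x within S1)" if "x \<in> S1" for x
  proof -
    have "(reindex has_derivative reindex) (at x within S1)"
      by (intro bounded_linear_imp_has_derivative bounded_linear_reindex)
    moreover have "(G has_derivative G' (reindex x)) (at (reindex x) within reindex ` S1)"
      using that d by (auto simp: S1_def intro!: has_derivative_subset[OF d])
    ultimately have "((\<lambda>x. G (reindex x)) has_derivative (\<lambda>v. G' (reindex x) (reindex v))) (at x within S1)"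
      by (rule has_derivative_in_compose)
    then show ?thesis
      unfolding G1_def G1'_def by (rule bounded_linear.has_derivative[OF bounded_linear_unindex])
  qed
  have ind1: "(\<lambda>x. indicator (G1 ` S1) x * h (reindex x)) = (\<lambda>x. indicator (G ` S) (reindex x) * h (reindex x))"
    by (auto simp: im indicator_def fun_eq_iff)
  have ind2: "(\<lambda>x. indicator S1 x * (\<bar>det (matrix (G1' x))\<bar> * h (reindex (G1 x)))) =
      (\<lambda>x. indicator S (reindex x) * (\<bar>det (matrix (G' (reindex x)))\<bar> * h (G (reindex x))))"
    by (auto simp: S1_def indicator_def fun_eq_iff G1_def G1'_def det_matrix_unindex_reindex)
  have "(\<integral>\<^sup>+ y. ennreal (indicator (G1 ` S1) y * h (reindex y)) \<partial>lborel) =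
    (\<integral>\<^sup>+ x. ennreal (indicator S1 x * (\<bar>det (matrix (G1' x))\<bar> * h (reindex (G1 x)))) \<partial>lborel)"
  proof (rule nn_integral_change_of_variables_wellorder[OF S1 GS1 inj1 d1])
    show "0 \<le> h (reindex y)" if "y \<in> G1 ` S1" for y using that h unfolding im by simp
    show "(\<lambda>y. indicator (G1 ` S1) y * h (reindex y)) \<in> borel_measurable borel"
      unfolding ind1 by (rule measurable_compose[OF measurable_reindex m1])
    show "(\<lambda>x. indicator S1 x * (\<bar>det (matrix (G1' x))\<bar> * h (reindex (G1 x)))) \<in> borel_measurable borel"
      unfolding ind2 by (rule measurable_compose[OF measurable_reindex m2])
  qed
  then show ?thesis
    using fun_cong[OF ind1] fun_cong[OF ind2] m1 m2
    by (subst (1 2) nn_integral_reindex) simp_all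
qed

section \<open>Integration by parts with compact support in Euclidean space\<close>

lemma derivative_zero_outside_support:
  fixes G :: "'a::euclidean_space \<Rightarrow> real"
  assumes "open U" "x \<in> U" "\<And>y. y \<in> U \<Longrightarrow> G y = 0"
  shows "frechet_derivative G (at x) v = 0"
proof -
  have "((\<lambda>y. 0) has_derivative (\<lambda>v. 0)) (at x)" by simp
  then have "(G has_derivative (\<lambda>v. 0)) (at x)"
    by (rule has_derivative_transform_within_open[OF _ assms(1,2)]) (simp add: assms(3))
  then show ?thesis using frechet_derivative_at by metis
qed

lemma integrable_zero_outside_compact:
  fixes F :: "'a::euclidean_space \<Rightarrow> real"
  assumes K: "compact K" and F: "continuous_on K F" and z: "\<And>x. x \<notin> K \<Longrightarrow> F x = 0"
  shows "integrable lborel F"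
proof -
  have "(\<lambda>x. indicator K x *\<^sub>R F x) = F" using z by (auto simp: indicator_def fun_eq_iff)
  then show ?thesis using borel_integrable_compact[OF K F] by simp
qed

text \<open>
  By translation invariance every difference quotient of \<open>G\<close> in direction \<open>v\<close> has integral \<open>0\<close>. For
  steps of size at most \<open>1\<close> these quotients are bounded by the maximum of the derivative and vanish
  outside a fixed ball, so dominated convergence passes to the derivative.
\<close>
lemma integral_derivative_compact_support:
  fixes G :: "'a::euclidean_space \<Rightarrow> real"
  assumes G: "C1_on UNIV G" and K: "compact K" and z: "\<And>x. x \<notin> K \<Longrightarrow> G x = 0"
  shows "integral\<^sup>L lborel (\<lambda>x. frechet_derivative G (at x) v) = 0"
proof -
  define D where "D x = frechet_derivative G (at x) v" for x
  obtain R where R: "\<And>x. x \<in> K \<Longrightarrow> norm x \<le> R"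
    using compact_imp_bounded[OF K] unfolding bounded_iff by blast
  define K' where "K' = cball (0::'a) (R + norm v)"
  have Gd: "(G has_derivative frechet_derivative G (at x)) (at x)" for x
    using C1_on_has_derivative[OF G] by simp
  have Dlin: "frechet_derivative G (at y) (h *\<^sub>R v) = D y * h" for y h
    unfolding D_def linear_scale[OF has_derivative_linear[OF Gd]] by simp
  have Dc: "continuous_on UNIV D"
    unfolding D_def using C1_on_continuous_derivative[OF G] by simp
  have D0: "D x = 0" if "x \<notin> K" for x
    unfolding D_def using K that z
    by (intro derivative_zero_outside_support[of "- K"]) (auto simp: compact_imp_closed)
  have "bounded (D ` K)"
    by (intro compact_imp_bounded compact_continuous_image K continuous_on_subset[OF Dc]) auto
  then obtain C where "\<And>x. x \<in> K \<Longrightarrow> \<bar>D x\<bar> \<le> C"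
    unfolding bounded_iff by (auto simp: Ball_def)
  then have C: "\<bar>D x\<bar> \<le> max C 0" for x
    using D0[of x] by (cases "x \<in> K") force+
  define s where "s n = inverse (real (Suc n))" for n
  have s: "0 < s n" "s n \<le> 1" for n by (auto simp: s_def field_simps)
  have s0: "s \<longlonglongrightarrow> 0" unfolding s_def by (rule LIMSEQ_inverse_real_of_nat)
  define q where "q n x = (G (x + s n *\<^sub>R v) - G x) / s n" for n x
  have Gi: "integrable lborel G"
    by (rule integrable_zero_outside_compact[OF K _ z])
      (rule continuous_on_subset[OF C1_on_continuous[OF G]], simp)
  have Gm: "G \<in> borel_measurable borel"
    using C1_on_continuous[OF G] by (intro borel_measurable_continuous_onI)
  have tr: "integrable lborel (\<lambda>x. G (x + w)) \<and> integral\<^sup>L lborel (\<lambda>x. G (x + w)) = integral\<^sup>L lborel G" for w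
  proof
    have "integrable (distr lborel borel ((+) w)) G" using Gi by (simp add: lborel_distr_plus)
    then show "integrable lborel (\<lambda>x. G (x + w))"
      by (subst (asm) integrable_distr_eq) (use Gm in \<open>simp_all add: add.commute\<close>)
    have "integral\<^sup>L (distr lborel borel ((+) w)) G = integral\<^sup>L lborel (\<lambda>x. G (x + w))"
      by (subst integral_distr) (use Gm in \<open>simp_all add: add.commute\<close>)
    then show "integral\<^sup>L lborel (\<lambda>x. G (x + w)) = integral\<^sup>L lborel G"
      by (simp add: lborel_distr_plus)
  qed
  have q0: "integral\<^sup>L lborel (q n) = 0" for n
    unfolding q_def using tr[of "s n *\<^sub>R v"] Gi by simp
  have bound: "norm (q n x) \<le> indicator K' x * max C 0" for n x
  proof (cases "x \<in> K'")
    case True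
    define \<gamma> where "\<gamma> r = G (x + r *\<^sub>R v)" for r
    have "(\<gamma> has_real_derivative D (x + r *\<^sub>R v)) (at r)" for r
    proof -
      have "((\<lambda>r. x + r *\<^sub>R v) has_derivative (\<lambda>h. h *\<^sub>R v)) (at r)"
        by (auto intro!: derivative_eq_intros)
      from has_derivative_compose[OF this Gd]
      have "(\<gamma> has_derivative (\<lambda>h. frechet_derivative G (at (x + r *\<^sub>R v)) (h *\<^sub>R v))) (at r)"
        unfolding \<gamma>_def .
      then show ?thesis
        unfolding has_field_derivative_def Dlin .
    qed
    then obtain z where "\<gamma> (s n) - \<gamma> 0 = (s n - 0) * D (x + z *\<^sub>R v)"
      using MVT2[of 0 "s n" \<gamma> "\<lambda>r. D (x + r *\<^sub>R v)"] s by blast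
    then have "q n x = D (x + z *\<^sub>R v)"
      using s(1)[of n] by (simp add: q_def \<gamma>_def)
    then show ?thesis using True C by simp
  next
    case False
    then have n: "norm x > R + norm v" by (simp add: K'_def)
    have "norm (s n *\<^sub>R v) \<le> norm v" using s[of n] by (simp add: mult_left_le_one_le)
    moreover have "norm x \<le> norm (x + s n *\<^sub>R v) + norm (s n *\<^sub>R v)"
      using norm_triangle_ineq4[of "x + s n *\<^sub>R v" "s n *\<^sub>R v"] by simp
    ultimately have "norm (x + s n *\<^sub>R v) > R" using n by linarith
    moreover have "norm x > R" using n norm_ge_zero[of v] by linarith
    ultimately have "G (x + s n *\<^sub>R v) = 0" "G x = 0" using z R by (meson not_le)+
    then show ?thesis by (simp add: q_def)
  qed
  have lim: "(\<lambda>n. q n x) \<longlonglongrightarrow> D x" for x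
  proof -
    have "((\<lambda>t. (G (x + t *\<^sub>R v) - G x) /\<^sub>R t) \<longlongrightarrow> D x) (at 0)"
    proof -
      have "((\<lambda>r. x + r *\<^sub>R v) has_derivative (\<lambda>h. h *\<^sub>R v)) (at 0)"
        by (auto intro!: derivative_eq_intros)
      from has_derivative_compose[OF this, of G "frechet_derivative G (at x)"] Gd[of x]
      have "((\<lambda>r. G (x + r *\<^sub>R v)) has_derivative (\<lambda>h. frechet_derivative G (at x) (h *\<^sub>R v))) (at 0)"
        by simp
      then have "((\<lambda>r. G (x + r *\<^sub>R v)) has_real_derivative D x) (at 0)"
        unfolding has_field_derivative_def Dlin .
      then show ?thesis
        unfolding has_field_derivative_iff by (simp add: divide_inverse mult.commute)
    qed
    then have "((\<lambda>n. (G (x + s n *\<^sub>R v) - G x) /\<^sub>R s n) \<longlonglongrightarrow> D x)"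
      by (rule filterlim_compose) (auto simp: filterlim_at s0 intro!: always_eventually less_imp_neq[OF s(1), symmetric])
    then show ?thesis by (simp add: q_def divide_inverse mult.commute)
  qed
  have "(\<lambda>n. integral\<^sup>L lborel (q n)) \<longlonglongrightarrow> integral\<^sup>L lborel D"
  proof (rule integral_dominated_convergence[where w = "\<lambda>x. indicator K' x * max C 0"])
    show "D \<in> borel_measurable lborel" using Dc by (simp add: borel_measurable_continuous_onI)
    show "q n \<in> borel_measurable lborel" for n
      unfolding q_def using Gm by measurable
    show "integrable lborel (\<lambda>x. indicator K' x * max C 0)"
      using borel_integrable_compact[of K' "\<lambda>x. max C 0"] by (simp add: K'_def)
  qed (use lim bound in auto)
  then show ?thesis
    using LIMSEQ_unique[OF _ tendsto_const[of "0::real"]] unfolding q0 D_def by blast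
qed

text \<open>
  The product \<open>\<psi> F\<close>, extended by \<open>0\<close>, has a compactly supported continuous derivative, whose
  integral vanishes; the product rule does the rest.
\<close>
lemma integration_by_parts_compact_support:
  fixes \<psi> F :: "'a::euclidean_space \<Rightarrow> real"
  assumes W: "open W" and K: "compact K" "K \<subseteq> W"
    and \<psi>: "C1_on W \<psi>" and z: "\<And>y. y \<in> W - K \<Longrightarrow> \<psi> y = 0" and F: "C1_on W F"
  shows "integrable lborel (\<lambda>y. indicator W y * (\<psi> y * frechet_derivative F (at y) v))" (is ?i1)
    and "integrable lborel (\<lambda>y. indicator W y * (frechet_derivative \<psi> (at y) v * F y))" (is ?i2)
    and "integral\<^sup>L lborel (\<lambda>y. indicator W y * (\<psi> y * frechet_derivative F (at y) v)) =
      - integral\<^sup>L lborel (\<lambda>y. indicator W y * (frechet_derivative \<psi> (at y) v * F y))"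
proof -
  define G where "G y = (if y \<in> W then \<psi> y * F y else 0)" for y
  have oK: "open (- K)" using K by (simp add: compact_imp_closed open_Compl)
  have zd: "frechet_derivative \<psi> (at y) v = 0" if "y \<in> W - K" for y
    using that W oK by (intro derivative_zero_outside_support[of "W \<inter> - K"]) (auto intro!: z)
  have Gz: "G y = 0" if "y \<notin> K" for y using that z by (auto simp: G_def)
  have "C1_on UNIV G"
  proof (rule C1_on_local)
    fix x
    show "\<exists>U. open U \<and> x \<in> U \<and> C1_on U G"
    proof (cases "x \<in> W")
      case True
      have "C1_on W G"
        by (rule C1_on_cong[OF C1_on_mult[OF W \<psi> F] W]) (simp add: G_def)
      then show ?thesis using True W by blast
    next
      case False
      have "C1_on (- K) G"
        by (rule C1_on_cong[OF C1_on_const[OF oK, of 0] oK]) (simp add: Gz)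
      then show ?thesis using False K oK by blast
    qed
  qed simp
  from integral_derivative_compact_support[OF this K(1) Gz]
  have int0: "integral\<^sup>L lborel (\<lambda>y. frechet_derivative G (at y) v) = 0" .
  have DG: "frechet_derivative G (at y) v = indicator W y * (\<psi> y * frechet_derivative F (at y) v) +
      indicator W y * (frechet_derivative \<psi> (at y) v * F y)" for y
  proof (cases "y \<in> W")
    case True
    have "((\<lambda>y. \<psi> y * F y) has_derivative
        (\<lambda>v. \<psi> y * frechet_derivative F (at y) v + frechet_derivative \<psi> (at y) v * F y)) (at y)"
      by (intro has_derivative_mult C1_on_has_derivative[OF _ W True] \<psi> F)
    then have "(G has_derivative
        (\<lambda>v. \<psi> y * frechet_derivative F (at y) v + frechet_derivative \<psi> (at y) v * F y)) (at y)"
      by (rule has_derivative_transform_within_open[OF _ W True]) (simp add: G_def)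
    from frechet_derivative_at[OF this]
    have "\<psi> y * frechet_derivative F (at y) v + frechet_derivative \<psi> (at y) v * F y = frechet_derivative G (at y) v"
      by (rule fun_cong)
    then show ?thesis using True by simp
  next
    case False
    then have "frechet_derivative G (at y) v = 0"
      using K Gz oK by (intro derivative_zero_outside_support[of "- K"]) auto
    then show ?thesis using False by simp
  qed
  have restr: "continuous_on K (\<lambda>y. indicator W y * H y)" if "continuous_on W H" for H :: "'a \<Rightarrow> real"
    using continuous_on_subset[OF that K(2)] by (rule continuous_on_eq) (use K(2) in auto)
  show i1: ?i1
    by (intro integrable_zero_outside_compact[OF K(1)] restr continuous_on_mult
        C1_on_continuous[OF \<psi>] C1_on_continuous_derivative[OF F W]) (auto simp: indicator_def z)
  show i2: ?i2
    by (intro integrable_zero_outside_compact[OF K(1)] restr continuous_on_mult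
        C1_on_continuous[OF F] C1_on_continuous_derivative[OF \<psi> W]) (auto simp: indicator_def zd)
  show "integral\<^sup>L lborel (\<lambda>y. indicator W y * (\<psi> y * frechet_derivative F (at y) v)) =
      - integral\<^sup>L lborel (\<lambda>y. indicator W y * (frechet_derivative \<psi> (at y) v * F y))"
    using int0 Bochner_Integration.integral_add[OF i1 i2] unfolding DG by linarith
qed

text \<open>
  A test function supported in the closed ball of radius \<open>r\<close> around \<open>p\<close>. The outer square makes the
  derivative vanish where the inner parabola is cut off.
\<close>
definition bump :: "'a::euclidean_space \<Rightarrow> real \<Rightarrow> 'a \<Rightarrow> real" where
  "bump p r y = (max 0 (r\<^sup>2 - (y - p) \<bullet> (y - p)))\<^sup>2"

lemma C1_on_bump: "C1_on UNIV (bump p r)"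
proof -
  have q: "C1_on UNIV (\<lambda>y. r\<^sup>2 - (y - p) \<bullet> (y - p))"
    by (rule C1_onI[where F' = "\<lambda>y v. - (2 * ((y - p) \<bullet> v))"])
      (auto intro!: derivative_eq_intros continuous_intros simp: inner_commute algebra_simps)
  have h: "((\<lambda>s. (max 0 s)\<^sup>2) has_real_derivative 2 * max 0 s) (at s)" for s :: real
  proof -
    consider "s > 0" | "s < 0" | "s = 0" by linarith
    then show ?thesis
    proof cases
      case 1
      have "((\<lambda>s. s\<^sup>2) has_real_derivative 2 * max 0 s) (at s)"
        using 1 by (auto intro!: derivative_eq_intros)
      then show ?thesis
        by (rule has_field_derivative_transform_within_open[of _ _ _ "{0<..}"]) (use 1 in auto)
    next
      case 2
      have "((\<lambda>s. 0) has_real_derivative 2 * max 0 s) (at s)"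
        using 2 by (auto intro!: derivative_eq_intros)
      then show ?thesis
        by (rule has_field_derivative_transform_within_open[of _ _ _ "{..<0}"]) (use 2 in auto)
    next
      \<comment> \<open>at the cut-off the difference quotient of the squared positive part at \<open>y\<close> is at most \<open>\<bar>y\<bar>\<close>\<close>
      case 3
      have "((\<lambda>y::real. (max 0 y)\<^sup>2 / y) \<longlongrightarrow> 0) (at 0)"
      proof (rule Lim_null_comparison)
        show "\<forall>\<^sub>F y::real in at 0. norm ((max 0 y)\<^sup>2 / y) \<le> \<bar>y\<bar>"
          by (rule always_eventually) (auto simp: max_def power2_eq_square)
        show "((\<lambda>y::real. \<bar>y\<bar>) \<longlongrightarrow> 0) (at 0)" by (intro tendsto_rabs_zero tendsto_ident_at)
      qed
      then show ?thesis using 3 by (simp add: has_field_derivative_iff)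
    qed
  qed
  show ?thesis
    unfolding bump_def[abs_def]
    by (rule C1_on_real_compose[OF open_UNIV q, where h = "\<lambda>s. (max 0 s)\<^sup>2" and h' = "\<lambda>s. 2 * max 0 s"])
      (use h in \<open>auto intro!: continuous_intros\<close>)
qed

lemma bump_nonneg: "bump p r y \<ge> 0" by (simp add: bump_def)

lemma bump_center: "r > 0 \<Longrightarrow> bump p r p > 0" by (simp add: bump_def)

lemma bump_outside: "r > 0 \<Longrightarrow> y \<notin> cball p r \<Longrightarrow> bump p r y = 0"
proof -
  assume r: "r > 0" and y: "y \<notin> cball p r"
  then have "r\<^sup>2 \<le> (norm (y - p))\<^sup>2" by (intro power_mono) (auto simp: dist_norm norm_minus_commute)
  then show ?thesis by (simp add: bump_def dot_square_norm)
qed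

section \<open>Charts, coordinate changes and the metric\<close>

locale riemannian =
  fixes A :: "('a::{t2_space, second_countable_topology}, 'm::finite) chart set"
    and g :: "('a, 'm) tensor2"
  assumes crm: "closed_riemannian_manifold A g"
begin

lemma chart_open: "c \<in> A \<Longrightarrow> open (cdom c)" "c \<in> A \<Longrightarrow> open (cimg c)"
  and chart_homeo: "c \<in> A \<Longrightarrow> homeomorphism (cdom c) (cimg c) (cmap c) (cinv c)"
  using crm unfolding closed_riemannian_manifold_def closed_manifold_def is_chart_def by blast+

lemma cinv_cmap: "c \<in> A \<Longrightarrow> p \<in> cdom c \<Longrightarrow> cinv c (cmap c p) = p"
  and cmap_cinv: "c \<in> A \<Longrightarrow> y \<in> cimg c \<Longrightarrow> cmap c (cinv c y) = y"
  and cinv_in: "c \<in> A \<Longrightarrow> y \<in> cimg c \<Longrightarrow> cinv c y \<in> cdom c"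
  and continuous_cmap: "c \<in> A \<Longrightarrow> continuous_on (cdom c) (cmap c)"
  and continuous_cinv: "c \<in> A \<Longrightarrow> continuous_on (cimg c) (cinv c)"
  using chart_homeo[of c] unfolding homeomorphism_def by auto

lemma compact_M: "compact (UNIV :: 'a set)"
  using crm unfolding closed_riemannian_manifold_def closed_manifold_def by blast

lemma chart_cover: "\<exists>c\<in>A. p \<in> cdom c"
proof -
  have "(\<Union>c\<in>A. cdom c) = UNIV"
    using crm unfolding closed_riemannian_manifold_def closed_manifold_def by blast
  then show ?thesis by blast
qed

lemma chart_at: "chart_at A p \<in> A" "p \<in> cdom (chart_at A p)"
  using someI_ex[of "\<lambda>c. c \<in> A \<and> p \<in> cdom c"] chart_cover[of p] unfolding chart_at_def by blast+

lemma cmap_image: "c \<in> A \<Longrightarrow> B \<subseteq> cdom c \<Longrightarrow> cmap c ` B = {y \<in> cimg c. cinv c y \<in> B}"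
  by (force simp: cinv_cmap cmap_cinv)

lemma open_cmap_image: "c \<in> A \<Longrightarrow> B \<subseteq> cdom c \<Longrightarrow> open B \<Longrightarrow> open (cmap c ` B)"
  unfolding cmap_image Int_def[symmetric] vimage_def[symmetric] Collect_conj_eq
  using continuous_open_preimage[OF continuous_cinv chart_open(2), of c B]
  by (simp add: vimage_def)

text \<open>
  The inverse chart made constant outside the coordinate image. Thereby it becomes Borel measurable
  on the whole space, so that a measure can be pushed forward along it.
\<close>
definition cinv0 :: "('a, 'm) chart \<Rightarrow> real ^ 'm \<Rightarrow> 'a" where
  "cinv0 c y = (if y \<in> cimg c then cinv c y else undefined)"

lemma measurable_cinv0: "c \<in> A \<Longrightarrow> cinv0 c \<in> borel_measurable borel"
  unfolding cinv0_def[abs_def]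
  by (intro borel_measurable_continuous_on_if continuous_cinv borel_open chart_open continuous_on_const)

lemma borel_cmap_image:
  assumes "c \<in> A" "B \<subseteq> cdom c" "B \<in> sets borel"
  shows "cmap c ` B \<in> sets borel"
proof -
  have "cmap c ` B = cinv0 c -` B \<inter> cimg c"
    unfolding cmap_image[OF assms(1,2)] by (auto simp: cinv0_def)
  then show ?thesis
    using measurable_sets_borel[OF measurable_cinv0 assms(3)] chart_open(2) assms(1) by auto
qed

lemma continuous_on_chart:
  assumes c: "c \<in> A" and U: "U \<subseteq> cdom c" and h: "continuous_on (cmap c ` U) (\<lambda>y. h (cinv c y))"
  shows "continuous_on U h"
proof -
  have "continuous_on U (\<lambda>p. h (cinv c (cmap c p)))"
    using continuous_on_compose2[OF h continuous_on_subset[OF continuous_cmap[OF c] U]] by blast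
  then show ?thesis
    by (rule continuous_on_eq) (use c U in \<open>auto simp: cinv_cmap\<close>)
qed

lemma continuous_on_charts:
  assumes "\<And>c. c \<in> A \<Longrightarrow> continuous_on (cimg c) (\<lambda>y. h (cinv c y))"
  shows "continuous_on UNIV h"
proof (rule continuous_at_imp_continuous_on, rule ballI)
  fix p
  obtain c where c: "c \<in> A" "p \<in> cdom c" using chart_cover by blast
  then have "continuous_on (cdom c) h" using continuous_on_chart[OF c(1) order_refl] assms by blast
  then show "isCont h p" using c chart_open by (simp add: continuous_on_eq_continuous_at)
qed

lemma continuous_in_chart:
  assumes "c \<in> A" "continuous_on (cdom c) h"
  shows "continuous_on (cimg c) (\<lambda>y. h (cinv c y))"
  by (rule continuous_on_compose2[OF assms(2) continuous_cinv[OF assms(1)]]) (use assms in \<open>auto simp: cinv_in\<close>)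

lemma C1_transition:
  assumes "c \<in> A" "c' \<in> A"
  shows "C1_on (cmap c ` (cdom c \<inter> cdom c')) (\<lambda>y. cmap c' (cinv c y))"
  using crm assms unfolding closed_riemannian_manifold_def closed_manifold_def smooth_on_def comp_def by blast

lemma open_overlap:
  assumes "c \<in> A" "c' \<in> A"
  shows "open (cmap c ` (cdom c \<inter> cdom c'))"
  using assms by (intro open_cmap_image) (auto intro!: open_Int chart_open)

lemma transition_has_derivative:
  assumes "c \<in> A" "c' \<in> A" "p \<in> cdom c" "p \<in> cdom c'"
  shows "((\<lambda>y. cmap c' (cinv c y)) has_derivative (\<lambda>v. jac c c' p *v v)) (at (cmap c p))"
proof -
  have "(\<lambda>y. cmap c' (cinv c y)) differentiable at (cmap c p)"
    using assms by (intro C1_on_differentiable[OF C1_transition open_overlap]) auto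
  then show ?thesis
    unfolding jacobian_works jacobian_def jac_def comp_def .
qed

lemma g_transform:
  assumes "c \<in> A" "c' \<in> A" "p \<in> cdom c" "p \<in> cdom c'"
  shows "g c p = transpose (jac c c' p) ** g c' p ** jac c c' p"
  using crm assms unfolding closed_riemannian_manifold_def riemannian_metric_def by blast

lemma g_sym: "c \<in> A \<Longrightarrow> p \<in> cdom c \<Longrightarrow> transpose (g c p) = g c p"
  and g_pos: "c \<in> A \<Longrightarrow> p \<in> cdom c \<Longrightarrow> v \<noteq> 0 \<Longrightarrow> v \<bullet> (g c p *v v) > 0"
  using crm unfolding closed_riemannian_manifold_def riemannian_metric_def by blast+

lemma det_g_pos: "c \<in> A \<Longrightarrow> p \<in> cdom c \<Longrightarrow> det (g c p) > 0"
  by (intro det_pos_of_pos_def g_pos)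

lemma C1_g: "c \<in> A \<Longrightarrow> C1_on (cimg c) (\<lambda>y. g c (cinv c y) $ i $ j)"
proof -
  assume c: "c \<in> A"
  have "C1_on (cimg c) (\<lambda>y. g c (cinv c y))"
    using crm c unfolding closed_riemannian_manifold_def riemannian_metric_def smooth_on_def comp_def by blast
  then show ?thesis by (intro C1_on_vec_nth chart_open c)
qed

definition dens :: "('a, 'm) chart \<Rightarrow> 'a \<Rightarrow> real" where
  "dens c p = sqrt (det (g c p))"

lemma dens_pos: "c \<in> A \<Longrightarrow> p \<in> cdom c \<Longrightarrow> dens c p > 0"
  by (simp add: dens_def det_g_pos)

lemma C1_dens: "c \<in> A \<Longrightarrow> C1_on (cimg c) (\<lambda>y. dens c (cinv c y))"
  unfolding dens_def by (intro C1_on_sqrt C1_on_det chart_open C1_g det_g_pos cinv_in)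

lemma continuous_dens: "c \<in> A \<Longrightarrow> continuous_on (cimg c) (\<lambda>y. dens c (cinv c y))"
  by (intro C1_on_continuous C1_dens)

text \<open>
  Take determinants in \<open>g\<^sub>c = J\<^sup>t g\<^sub>c\<^sub>' J\<close>.
\<close>
lemma dens_transform:
  assumes "c \<in> A" "c' \<in> A" "p \<in> cdom c" "p \<in> cdom c'"
  shows "dens c p = \<bar>det (jac c c' p)\<bar> * dens c' p"
  unfolding dens_def
  by (subst g_transform[OF assms])
    (simp add: det_mul det_transpose real_sqrt_mult power2_eq_square[symmetric] mult.commute mult.left_commute)

section \<open>The Riemannian volume\<close>

definition cdens :: "('a, 'm) chart \<Rightarrow> real ^ 'm \<Rightarrow> real" where
  "cdens c y = indicator (cimg c) y * dens c (cinv c y)"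

lemma measurable_cdens: "c \<in> A \<Longrightarrow> cdens c \<in> borel_measurable borel"
  using borel_measurable_continuous_on_indicator[OF _ continuous_dens, of c] chart_open(2)
  by (simp add: cdens_def[abs_def])

lemma cdens_nonneg: "c \<in> A \<Longrightarrow> cdens c y \<ge> 0"
  using dens_pos[of c "cinv c y"] by (auto simp: cdens_def indicator_def cinv_in intro: less_imp_le)

definition chart_measure :: "('a, 'm) chart \<Rightarrow> 'a measure" where
  "chart_measure c = distr (density lborel (\<lambda>y. ennreal (cdens c y))) borel (cinv0 c)"

lemma sets_chart_measure [simp]: "sets (chart_measure c) = sets borel"
  by (simp add: chart_measure_def)

lemma emeasure_chart_measure:
  assumes c: "c \<in> A" and B: "B \<in> sets borel"
  shows "emeasure (chart_measure c) B =
    (\<integral>\<^sup>+ y. ennreal (indicator (cmap c ` (B \<inter> cdom c)) y * dens c (cinv c y)) \<partial>lborel)"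
proof -
  have m: "cinv0 c -` B \<in> sets borel"
    using measurable_sets_borel[OF measurable_cinv0[OF c] B] .
  have i: "ennreal (cdens c y) * indicator (cinv0 c -` B) y =
      ennreal (indicator (cmap c ` (B \<inter> cdom c)) y * dens c (cinv c y))" for y
    unfolding cmap_image[OF c Int_lower2]
    using c by (auto simp: cdens_def cinv0_def indicator_def cinv_in)
  have "emeasure (chart_measure c) B = emeasure (density lborel (\<lambda>y. ennreal (cdens c y))) (cinv0 c -` B)"
    unfolding chart_measure_def
    by (subst emeasure_distr) (use measurable_cinv0[OF c] B in \<open>auto simp: measurable_def\<close>)
  also have "\<dots> = (\<integral>\<^sup>+ y. ennreal (cdens c y) * indicator (cinv0 c -` B) y \<partial>lborel)"
    by (rule emeasure_density) (use m measurable_cdens[OF c] in auto)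
  finally show ?thesis unfolding i .
qed

lemma emeasure_chart_measure_Int:
  assumes c: "c \<in> A" and B: "B \<in> sets borel"
  shows "emeasure (chart_measure c) (B \<inter> cdom c) = emeasure (chart_measure c) B"
  using B chart_open(1)[OF c] by (simp add: emeasure_chart_measure[OF c] Int_absorb2 Int_assoc)

lemma measurable_chart_density:
  assumes "c \<in> A" "B \<subseteq> cdom c" "B \<in> sets borel"
  shows "(\<lambda>y. indicator (cmap c ` B) y * dens c (cinv c y)) \<in> borel_measurable borel"
proof -
  have "(\<lambda>y. indicator (cmap c ` B) y * dens c (cinv c y)) = (\<lambda>y. indicator (cmap c ` B) y * cdens c y)"
    using assms by (auto simp: cdens_def indicator_def fun_eq_iff)
  then show ?thesis
    using measurable_cdens[OF assms(1)] borel_cmap_image[OF assms] by simp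
qed

text \<open>
  The coordinate change maps one image of \<open>B\<close> onto the other, and the factor \<open>\<bar>det J\<bar>\<close> in the
  change of variables formula is exactly the quotient of the two densities.
\<close>
lemma chart_measure_overlap:
  assumes c: "c \<in> A" "c' \<in> A" and B: "B \<in> sets borel" "B \<subseteq> cdom c" "B \<subseteq> cdom c'"
  shows "emeasure (chart_measure c) B = emeasure (chart_measure c') B"
proof -
  let ?S = "cmap c ` B" and ?G = "\<lambda>y. cmap c' (cinv c y)"
  let ?G' = "\<lambda>y v. jac c c' (cinv c y) *v v"
  have im: "?G ` ?S = cmap c' ` B"
    using B c by (force simp: cinv_cmap image_iff)
  have eq: "(\<lambda>x. indicator ?S x * (\<bar>det (matrix (?G' x))\<bar> * dens c' (cinv c' (?G x)))) =
      (\<lambda>x. indicator ?S x * dens c (cinv c x))"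
  proof
    fix x
    show "indicator ?S x * (\<bar>det (matrix (?G' x))\<bar> * dens c' (cinv c' (?G x))) = indicator ?S x * dens c (cinv c x)"
    proof (cases "x \<in> ?S")
      case True
      then obtain p where p: "p \<in> B" "x = cmap c p" by blast
      then have q: "p \<in> cdom c" "p \<in> cdom c'" using B by auto
      show ?thesis
        using dens_transform[OF c q] q c p by (simp add: cinv_cmap matrix_of_matrix_vector_mul)
    qed simp
  qed
  have inj: "inj_on ?G ?S"
  proof (rule inj_onI)
    fix x y assume "x \<in> ?S" "y \<in> ?S" and e: "?G x = ?G y"
    then obtain p q where pq: "p \<in> B" "q \<in> B" "x = cmap c p" "y = cmap c q" by blast
    then have d: "p \<in> cdom c" "q \<in> cdom c" "p \<in> cdom c'" "q \<in> cdom c'" using B by auto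
    then have "cmap c' p = cmap c' q" using e pq c by (simp add: cinv_cmap)
    then have "p = q" using cinv_cmap[OF c(2) d(3)] cinv_cmap[OF c(2) d(4)] by metis
    then show "x = y" using pq by simp
  qed
  have "(\<integral>\<^sup>+ y. ennreal (indicator (?G ` ?S) y * dens c' (cinv c' y)) \<partial>lborel) =
    (\<integral>\<^sup>+ x. ennreal (indicator ?S x * (\<bar>det (matrix (?G' x))\<bar> * dens c' (cinv c' (?G x)))) \<partial>lborel)"
  proof (rule nn_integral_change_of_variables)
    show "?S \<in> sets borel" using c B by (intro borel_cmap_image)
    show "?G ` ?S \<in> sets borel" unfolding im using c B by (intro borel_cmap_image)
    show "inj_on ?G ?S" by (fact inj)
    show "(?G has_derivative ?G' x) (at x within ?S)" if "x \<in> ?S" for x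
    proof -
      from that obtain p where p: "p \<in> B" "x = cmap c p" by auto
      then have q: "p \<in> cdom c" "p \<in> cdom c'" using B by auto
      show ?thesis
        unfolding p(2) cinv_cmap[OF c(1) q(1)]
        by (rule has_derivative_at_withinI[OF transition_has_derivative[OF c q]])
    qed
    show "0 \<le> dens c' (cinv c' y)" if "y \<in> ?G ` ?S" for y
    proof -
      from that[unfolded im] obtain p where p: "p \<in> B" "y = cmap c' p" by auto
      then have "p \<in> cdom c'" using B(3) by auto
      then show ?thesis using dens_pos[OF c(2)] p(2) cinv_cmap[OF c(2)] by (simp add: less_imp_le)
    qed
    show "(\<lambda>y. indicator (?G ` ?S) y * dens c' (cinv c' y)) \<in> borel_measurable borel"
      unfolding im using c B by (intro measurable_chart_density)
    show "(\<lambda>x. indicator ?S x * (\<bar>det (matrix (?G' x))\<bar> * dens c' (cinv c' (?G x)))) \<in> borel_measurable borel"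
      unfolding eq using c B by (intro measurable_chart_density)
  qed
  then show ?thesis
    unfolding im fun_cong[OF eq]
    using B c by (simp add: emeasure_chart_measure Int_absorb2)
qed

text \<open>
  The property that singles out the Riemannian volume, in terms of the measures that the single
  charts put on the manifold. It consists of local conditions, so a measure with this property has
  to be glued from pieces.
\<close>
definition is_volume :: "'a measure \<Rightarrow> bool" where
  "is_volume \<nu> \<longleftrightarrow> sets \<nu> = sets borel \<and>
    (\<forall>c\<in>A. \<forall>B\<in>sets borel. B \<subseteq> cdom c \<longrightarrow> emeasure \<nu> B = emeasure (chart_measure c) B)"

lemma riemannian_volume_alt: "riemannian_volume A g = (THE \<nu>. is_volume \<nu>)"
proof -
  have "(\<integral>\<^sup>+ y \<in> cmap c ` B. ennreal (sqrt (det (g c (cinv c y)))) \<partial>lborel) = emeasure (chart_measure c) B"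
    if "c \<in> A" "B \<in> sets borel" "B \<subseteq> cdom c" for c B
    using that by (simp add: emeasure_chart_measure Int_absorb2 dens_def)
      (auto intro!: nn_integral_cong simp: indicator_def)
  then have "(sets \<nu> = sets borel \<and>
     (\<forall>c\<in>A. \<forall>B\<in>sets borel. B \<subseteq> cdom c \<longrightarrow>
        emeasure \<nu> B = (\<integral>\<^sup>+ y \<in> cmap c ` B. ennreal (sqrt (det (g c (cinv c y)))) \<partial>lborel))) = is_volume \<nu>" for \<nu>
    unfolding is_volume_def by (intro arg_cong2[of _ _ _ _ "(\<and>)"] refl ball_cong) auto
  then show ?thesis unfolding riemannian_volume_def by simp
qed

text \<open>
  By compactness finitely many chart domains cover the manifold; removing from each one the earlier
  ones makes the cover disjoint.
\<close>
lemma chart_partition: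
  obtains cs :: "nat \<Rightarrow> ('a, 'm) chart" and P N
  where "\<And>i. i < N \<Longrightarrow> cs i \<in> A" "\<And>i. i < N \<Longrightarrow> P i \<in> sets borel" "\<And>i. i < N \<Longrightarrow> P i \<subseteq> cdom (cs i)"
    "disjoint_family_on P {..<N}" "(\<Union>i<N. P i) = UNIV"
proof -
  have "\<exists>C'\<subseteq>A. finite C' \<and> UNIV \<subseteq> (\<Union>c\<in>C'. cdom c)"
    using compactE_image[OF compact_M, of A cdom] chart_open chart_cover
    by (metis UN_iff subsetI)
  then obtain C' where C': "C' \<subseteq> A" "finite C'" "UNIV \<subseteq> (\<Union>c\<in>C'. cdom c)" by blast
  obtain N and cs :: "nat \<Rightarrow> ('a, 'm) chart" where cs: "C' = cs ` {i. i < N}"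
    using finite_imp_nat_seg_image_inj_on[OF C'(2)] by blast
  define P where "P = disjointed (\<lambda>i. cdom (cs i))"
  have csA: "cs i \<in> A" if "i < N" for i using cs C' that by auto
  have P: "P i \<subseteq> cdom (cs i)" for i by (auto simp: P_def disjointed_def)
  have d: "disjoint_family_on P {..<N}"
    using disjoint_family_disjointed[of "\<lambda>i. cdom (cs i)"] by (auto simp: P_def disjoint_family_on_def)
  have b: "P i \<in> sets borel" if "i < N" for i
    unfolding P_def disjointed_def
    using that csA chart_open(1) by (intro sets.Diff sets.finite_UN) (auto intro!: borel_open)
  have "p \<in> (\<Union>i<N. P i)" for p
  proof -
    have ex: "\<exists>i. i < N \<and> p \<in> cdom (cs i)" using C'(3) cs by auto
    define i where "i = (LEAST i. i < N \<and> p \<in> cdom (cs i))"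
    have i: "i < N" "p \<in> cdom (cs i)" using LeastI_ex[OF ex] by (auto simp: i_def)
    have "p \<notin> cdom (cs j)" if "j < i" for j
      using not_less_Least[of j "\<lambda>i. i < N \<and> p \<in> cdom (cs i)"] that i(1) by (auto simp: i_def)
    then show ?thesis using i by (auto simp: P_def disjointed_def)
  qed
  then have "(\<Union>i<N. P i) = UNIV" by blast
  then show thesis using that[of N cs P] csA b P d by blast
qed

lemma emeasure_finite_partition:
  fixes N :: nat
  assumes "sets M = sets borel" "B \<in> sets borel" "\<And>i. i < N \<Longrightarrow> P i \<in> sets borel"
    "disjoint_family_on P {..<N}" "(\<Union>i<N. P i) = (UNIV :: 'a set)"
  shows "emeasure M B = (\<Sum>i<N. emeasure M (B \<inter> P i))"
proof -
  have "emeasure M (\<Union>i\<in>{..<N}. B \<inter> P i) = (\<Sum>i<N. emeasure M (B \<inter> P i))"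
    using assms(1-3) disjoint_family_on_bisimulation[OF assms(4), of "\<lambda>i. B \<inter> P i"]
    by (intro sum_emeasure[symmetric]) auto
  moreover have "(\<Union>i\<in>{..<N}. B \<inter> P i) = B" using assms(5) by blast
  ultimately show ?thesis by simp
qed

text \<open>
  Both measures agree on Borel subsets of each piece of a finite partition subordinate to the charts.
\<close>
lemma is_volume_unique:
  assumes "is_volume \<nu>" "is_volume \<nu>'"
  shows "\<nu> = \<nu>'"
proof -
  obtain N and cs :: "nat \<Rightarrow> ('a, 'm) chart" and P
    where P: "\<And>i. i < N \<Longrightarrow> cs i \<in> A" "\<And>i. i < N \<Longrightarrow> P i \<in> sets borel" "\<And>i. i < N \<Longrightarrow> P i \<subseteq> cdom (cs i)"
      "disjoint_family_on P {..<N}" "(\<Union>i<N. P i) = UNIV"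
    by (rule chart_partition) blast
  have s: "sets \<nu> = sets borel" "sets \<nu>' = sets borel"
    using assms by (auto simp: is_volume_def)
  show ?thesis
  proof (rule measure_eqI)
    fix B assume "B \<in> sets \<nu>"
    then have B: "B \<in> sets borel" using s by simp
    have "emeasure \<nu> (B \<inter> P i) = emeasure \<nu>' (B \<inter> P i)" if "i < N" for i
    proof -
      have "B \<inter> P i \<in> sets borel" "B \<inter> P i \<subseteq> cdom (cs i)" "cs i \<in> A" using that P B by auto
      then show ?thesis using assms unfolding is_volume_def by metis
    qed
    then show "emeasure \<nu> B = emeasure \<nu>' B"
      using emeasure_finite_partition[OF s(1) B P(2,4,5)] emeasure_finite_partition[OF s(2) B P(2,4,5)] by simp
  qed (simp add: s)
qed

text \<open>
  Add up the chart measures of the pieces of a partition subordinate to the charts. The result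
  agrees with the measure of any further chart, because the two agree on each piece by
  \<open>chart_measure_overlap\<close>.
\<close>
lemma is_volume_exists: "\<exists>\<nu>. is_volume \<nu>"
proof -
  obtain N and cs :: "nat \<Rightarrow> ('a, 'm) chart" and P
    where P: "\<And>i. i < N \<Longrightarrow> cs i \<in> A" "\<And>i. i < N \<Longrightarrow> P i \<in> sets borel" "\<And>i. i < N \<Longrightarrow> P i \<subseteq> cdom (cs i)"
      "disjoint_family_on P {..<N}" "(\<Union>i<N. P i) = UNIV"
    by (rule chart_partition) blast
  define m where "m B = (\<Sum>i<N. emeasure (chart_measure (cs i)) (B \<inter> P i))" for B
  define \<nu> where "\<nu> = measure_of UNIV (sets borel) m"
  have s: "sets \<nu> = sets borel"
    using sets.sigma_sets_eq[of "borel :: 'a measure"] by (simp add: \<nu>_def)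
  have em: "emeasure \<nu> B = m B" if "B \<in> sets borel" for B
    unfolding \<nu>_def
  proof (rule emeasure_measure_of_sigma)
    show "sigma_algebra UNIV (sets (borel :: 'a measure))"
      using sets.sigma_algebra_axioms[of "borel :: 'a measure"] by simp
    show "positive (sets borel) m" by (simp add: positive_def m_def)
    show "countably_additive (sets borel) m"
    proof (rule countably_additiveI)
      fix B :: "nat \<Rightarrow> 'a set"
      assume B: "range B \<subseteq> sets borel" "disjoint_family B" "\<Union> (range B) \<in> sets borel"
      have "(\<Sum>n. emeasure (chart_measure (cs i)) (B n \<inter> P i)) = emeasure (chart_measure (cs i)) ((\<Union>n. B n) \<inter> P i)"
        if "i < N" for i
      proof -
        have "(\<Sum>n. emeasure (chart_measure (cs i)) (B n \<inter> P i)) = emeasure (chart_measure (cs i)) (\<Union>n. B n \<inter> P i)"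
          using B P(2)[OF that] by (intro suminf_emeasure) (auto simp: disjoint_family_on_def)
        also have "(\<Union>n. B n \<inter> P i) = (\<Union>n. B n) \<inter> P i" by blast
        finally show ?thesis .
      qed
      then show "(\<Sum>n. m (B n)) = m (\<Union> (range B))"
        unfolding m_def by (subst suminf_sum) auto
    qed
  qed fact
  have "emeasure \<nu> B = emeasure (chart_measure c) B" if c: "c \<in> A" and B: "B \<in> sets borel" "B \<subseteq> cdom c" for c B
  proof -
    have "emeasure (chart_measure (cs i)) (B \<inter> P i) = emeasure (chart_measure c) (B \<inter> P i)" if "i < N" for i
      using that P B c by (intro chart_measure_overlap) auto
    then have "m B = (\<Sum>i<N. emeasure (chart_measure c) (B \<inter> P i))" by (simp add: m_def)
    also have "\<dots> = emeasure (chart_measure c) B"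
      by (rule emeasure_finite_partition[symmetric]) (use B P in auto)
    finally show ?thesis using em B by simp
  qed
  then show ?thesis using s by (auto simp: is_volume_def)
qed

definition vol :: "'a measure" where "vol = riemannian_volume A g"

lemma is_volume_vol: "is_volume vol"
  unfolding vol_def riemannian_volume_alt
  using theI'[of is_volume] is_volume_exists is_volume_unique by blast

lemma sets_vol [simp, measurable_cong]: "sets vol = sets borel"
  using is_volume_vol by (simp add: is_volume_def)

lemma space_vol [simp]: "space vol = UNIV"
  using sets_eq_imp_space_eq[OF sets_vol] by simp

lemma emeasure_vol: "c \<in> A \<Longrightarrow> B \<in> sets borel \<Longrightarrow> B \<subseteq> cdom c \<Longrightarrow> emeasure vol B = emeasure (chart_measure c) B"
  using is_volume_vol by (simp add: is_volume_def)

text \<open>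
  Restricted to a chart domain, the volume is the push-forward of a measure with a density on
  Euclidean space. This reduces integrals of functions supported in a chart to Lebesgue integrals.
\<close>
lemma density_vol_chart:
  assumes c: "c \<in> A"
  shows "density vol (\<lambda>p. ennreal (indicator (cdom c) p)) = chart_measure c"
proof (rule measure_eqI)
  fix B assume "B \<in> sets (density vol (\<lambda>p. ennreal (indicator (cdom c) p)))"
  then have B: "B \<in> sets borel" by simp
  have o: "cdom c \<in> sets borel" using chart_open(1)[OF c] by simp
  have "emeasure (density vol (\<lambda>p. ennreal (indicator (cdom c) p))) B = (\<integral>\<^sup>+ p. indicator (B \<inter> cdom c) p \<partial>vol)"
  proof -
    have "emeasure (density vol (\<lambda>p. ennreal (indicator (cdom c) p))) B =
        (\<integral>\<^sup>+ p. ennreal (indicator (cdom c) p) * indicator B p \<partial>vol)"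
      using B o by (intro emeasure_density) auto
    also have "\<dots> = (\<integral>\<^sup>+ p. indicator (B \<inter> cdom c) p \<partial>vol)"
      by (rule nn_integral_cong) (auto simp: indicator_def)
    finally show ?thesis .
  qed
  also have "\<dots> = emeasure vol (B \<inter> cdom c)" using B o by simp
  also have "\<dots> = emeasure (chart_measure c) (B \<inter> cdom c)"
    using B o c by (intro emeasure_vol) auto
  finally show "emeasure (density vol (\<lambda>p. ennreal (indicator (cdom c) p))) B = emeasure (chart_measure c) B"
    using emeasure_chart_measure_Int[OF c B] by simp
qed simp

lemma integral_vol_chart:
  assumes c: "c \<in> A" and h: "h \<in> borel_measurable borel" and z: "\<And>p. p \<notin> cdom c \<Longrightarrow> h p = (0::real)"
  shows "integral\<^sup>L vol h = integral\<^sup>L lborel (\<lambda>y. indicator (cimg c) y * (dens c (cinv c y) * h (cinv c y)))"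
proof -
  have o: "cdom c \<in> sets borel" using chart_open(1)[OF c] by simp
  have "integral\<^sup>L vol h = integral\<^sup>L vol (\<lambda>p. indicator (cdom c) p *\<^sub>R h p)"
    by (rule Bochner_Integration.integral_cong) (use z in \<open>auto simp: indicator_def\<close>)
  also have "\<dots> = integral\<^sup>L (density vol (\<lambda>p. ennreal (indicator (cdom c) p))) h"
    using h o by (intro integral_density[symmetric]) auto
  also have "\<dots> = integral\<^sup>L (density lborel (\<lambda>y. ennreal (cdens c y))) (\<lambda>y. h (cinv0 c y))"
    unfolding density_vol_chart[OF c] chart_measure_def
    using h measurable_cinv0[OF c] by (intro integral_distr) auto
  also have "\<dots> = integral\<^sup>L lborel (\<lambda>y. cdens c y *\<^sub>R h (cinv0 c y))"
    using measurable_cdens[OF c] cdens_nonneg[OF c] measurable_compose[OF measurable_cinv0[OF c] h]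
    by (intro integral_density) auto
  also have "\<dots> = integral\<^sup>L lborel (\<lambda>y. indicator (cimg c) y * (dens c (cinv c y) * h (cinv c y)))"
    by (rule Bochner_Integration.integral_cong) (auto simp: cdens_def cinv0_def indicator_def)
  finally show ?thesis .
qed

text \<open>
  In a chart, a nonempty open set has positive Lebesgue measure and the density is positive.
\<close>
lemma emeasure_vol_open_pos:
  assumes U: "open U" "U \<noteq> {}"
  shows "emeasure vol U \<noteq> 0"
proof
  assume z: "emeasure vol U = 0"
  obtain p where p: "p \<in> U" using U by blast
  obtain c where c: "c \<in> A" "p \<in> cdom c" using chart_cover by blast
  let ?V = "U \<inter> cdom c"
  have V: "open ?V" "?V \<subseteq> cdom c" by (intro open_Int U chart_open c) blast
  then have V: "open ?V" "?V \<subseteq> cdom c" "?V \<in> sets borel" by auto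
  have "emeasure vol ?V = 0"
    using z U emeasure_mono[of ?V U vol] by (simp add: le_zero_eq[symmetric] del: le_zero_eq)
  then have "(\<integral>\<^sup>+ y. ennreal (indicator (cmap c ` ?V) y * dens c (cinv c y)) \<partial>lborel) = 0"
    using emeasure_vol[OF c(1) V(3,2)] emeasure_chart_measure[OF c(1) V(3)] by (simp add: Int_assoc)
  then have ae: "AE y in lborel. ennreal (indicator (cmap c ` ?V) y * dens c (cinv c y)) = 0"
    using measurable_chart_density[OF c(1) V(2,3)] by (subst (asm) nn_integral_0_iff_AE) auto
  have imp: "y \<notin> cmap c ` ?V" if e: "ennreal (indicator (cmap c ` ?V) y * dens c (cinv c y)) = 0" for y
  proof
    assume y: "y \<in> cmap c ` ?V"
    then have "cinv c y \<in> cdom c" using c(1) by (auto intro: cinv_in)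
    then have "dens c (cinv c y) > 0" using dens_pos c(1) by blast
    then show False using e y by simp
  qed
  have "AE y in lborel. y \<notin> cmap c ` ?V"
    by (rule eventually_mono[OF ae]) (erule imp)
  then have "emeasure lborel (cmap c ` ?V) = 0"
    using open_cmap_image[OF c(1) V(2,1)] by (subst (asm) AE_iff_measurable[OF _ refl]) auto
  then have "negligible (cmap c ` ?V)"
    using open_cmap_image[OF c(1) V(2,1)] by (simp add: negligible_iff_null_sets null_sets_def)
  moreover have "\<not> negligible (cmap c ` ?V)"
    using open_cmap_image[OF c(1) V(2,1)] p c by (intro open_not_negligible) auto
  ultimately show False by blast
qed

text \<open>
  Every point has a neighbourhood whose coordinate image lies in a closed ball inside the image of
  the chart, where the density is bounded. Finitely many of these cover the manifold.
\<close>
lemma finite_vol: "emeasure vol UNIV < \<infinity>"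
proof -
  have "\<exists>U. open U \<and> p \<in> U \<and> emeasure vol U < \<infinity>" for p
  proof -
    obtain c where c: "c \<in> A" "p \<in> cdom c" using chart_cover by blast
    then obtain r where r: "r > 0" "cball (cmap c p) r \<subseteq> cimg c"
      using chart_open(2)[OF c(1)] open_contains_cball by blast
    define U where "U = cdom c \<inter> cmap c -` ball (cmap c p) r"
    have U: "open U" unfolding U_def
      by (intro continuous_open_preimage continuous_cmap chart_open c open_ball)
    have "continuous_on (cball (cmap c p) r) (\<lambda>y. dens c (cinv c y))"
      using continuous_on_subset[OF continuous_dens[OF c(1)] r(2)] .
    then have i: "integrable lborel (\<lambda>y. indicator (cball (cmap c p) r) y * dens c (cinv c y))"
      using borel_integrable_compact[OF compact_cball] by fastforce
    have "emeasure vol U = emeasure (chart_measure c) U"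
      using U c by (intro emeasure_vol) (auto simp: U_def)
    also have "\<dots> = (\<integral>\<^sup>+ y. ennreal (indicator (cmap c ` (U \<inter> cdom c)) y * dens c (cinv c y)) \<partial>lborel)"
      using U c by (intro emeasure_chart_measure) auto
    also have "\<dots> \<le> (\<integral>\<^sup>+ y. ennreal (indicator (cball (cmap c p) r) y * dens c (cinv c y)) \<partial>lborel)"
    proof (intro nn_integral_mono ennreal_leI)
      fix y
      show "indicator (cmap c ` (U \<inter> cdom c)) y * dens c (cinv c y) \<le> indicator (cball (cmap c p) r) y * dens c (cinv c y)"
        using r(2) dens_pos[OF c(1) cinv_in[OF c(1)], of y]
        by (force simp: indicator_def U_def intro: less_imp_le)
    qed
    also have "\<dots> \<le> (\<integral>\<^sup>+ y. ennreal (norm (indicator (cball (cmap c p) r) y * dens c (cinv c y))) \<partial>lborel)"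
      by (intro nn_integral_mono ennreal_leI) simp
    also have "\<dots> < \<infinity>" using i unfolding integrable_iff_bounded by simp
    finally show ?thesis using U r c by (intro exI[of _ U]) (auto simp: U_def)
  qed
  then obtain U where U: "\<And>p. open (U p)" "\<And>p. p \<in> U p" "\<And>p. emeasure vol (U p) < \<infinity>" by metis
  obtain F where F: "finite F" "UNIV \<subseteq> (\<Union>p\<in>F. U p)"
    using compactE_image[OF compact_M, of UNIV U] U by (metis UN_iff subsetI UNIV_I)
  have "emeasure vol UNIV \<le> emeasure vol (\<Union>p\<in>F. U p)"
    using F U by (intro emeasure_mono) auto
  also have "\<dots> \<le> (\<Sum>p\<in>F. emeasure vol (U p))"
    using F U by (intro emeasure_subadditive_finite) auto
  also have "\<dots> < \<infinity>" using F U by (simp add: less_top)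
  finally show ?thesis .
qed

lemma bounded_continuous:
  fixes h :: "'a \<Rightarrow> 'b::real_normed_vector"
  assumes "continuous_on UNIV h"
  obtains C where "\<And>p. norm (h p) \<le> C"
  using compact_imp_bounded[OF compact_continuous_image[OF assms compact_M]] unfolding bounded_iff by auto

lemma integrable_vol:
  fixes h :: "'a \<Rightarrow> real"
  assumes "continuous_on UNIV h"
  shows "integrable vol h"
proof -
  obtain C where C: "\<And>p. norm (h p) \<le> C" using bounded_continuous[OF assms] by blast
  interpret finite_measure vol using finite_vol by (intro finite_measureI) simp
  show ?thesis
    by (rule integrable_const_bound[of _ C]) (use C assms in \<open>auto intro!: borel_measurable_continuous_onI simp: measurable_cong_sets[OF sets_vol refl]\<close>)
qed

text \<open>
  The set where \<open>h\<close> is positive is open and null, and nonempty open sets are not null.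
\<close>
lemma continuous_integral_zero:
  fixes h :: "'a \<Rightarrow> real"
  assumes h: "continuous_on UNIV h" "\<And>p. h p \<ge> 0" and z: "integral\<^sup>L vol h = 0"
  shows "h p = 0"
proof -
  let ?N = "{p. h p \<noteq> 0}"
  have o: "open ?N"
    using h(1) by (intro open_Collect_neq continuous_on_const)
  have "AE p in vol. h p = 0"
    using integral_nonneg_eq_0_iff_AE[OF integrable_vol[OF h(1)]] h(2) z by simp
  then have "emeasure vol ?N = 0"
    using o by (subst (asm) AE_iff_measurable[OF _ refl]) auto
  then show ?thesis using emeasure_vol_open_pos[OF o] by auto
qed

end

section \<open>The divergence theorem on a closed manifold\<close>

context riemannian
begin

definition C1_fun :: "('a \<Rightarrow> real) \<Rightarrow> bool" where
  "C1_fun h \<longleftrightarrow> (\<forall>c\<in>A. C1_on (cimg c) (\<lambda>y. h (cinv c y)))"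

definition vfield :: "('a, 'm) vfield \<Rightarrow> bool" where
  "vfield X \<longleftrightarrow> (\<forall>c\<in>A. \<forall>i. C1_on (cimg c) (\<lambda>y. X c (cinv c y) $ i)) \<and>
    (\<forall>c\<in>A. \<forall>c'\<in>A. \<forall>p\<in>cdom c \<inter> cdom c'. X c' p = jac c c' p *v X c p)"

definition chart_deriv :: "('a, 'm) chart \<Rightarrow> ('a \<Rightarrow> real) \<Rightarrow> 'a \<Rightarrow> real ^ 'm \<Rightarrow> real" where
  "chart_deriv c h p v = frechet_derivative (\<lambda>y. h (cinv c y)) (at (cmap c p)) v"

text \<open>
  The coordinate expression of the divergence, evaluated in a chart of choice. That it does not depend
  on the chart is proved below, in \<open>chart_div_indep\<close>.
\<close>
definition chart_div :: "('a, 'm) chart \<Rightarrow> ('a, 'm) vfield \<Rightarrow> 'a \<Rightarrow> real" where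
  "chart_div c X p =
    (\<Sum>i\<in>UNIV. frechet_derivative (\<lambda>y. dens c (cinv c y) * X c (cinv c y) $ i) (at (cmap c p)) (axis i 1)) / dens c p"

definition dir_deriv :: "('a, 'm) vfield \<Rightarrow> ('a \<Rightarrow> real) \<Rightarrow> 'a \<Rightarrow> real" where
  "dir_deriv X h p = chart_deriv (chart_at A p) h p (X (chart_at A p) p)"

lemma C1_funD: "C1_fun h \<Longrightarrow> c \<in> A \<Longrightarrow> C1_on (cimg c) (\<lambda>y. h (cinv c y))"
  unfolding C1_fun_def by blast

lemma vfield_C1: "vfield X \<Longrightarrow> c \<in> A \<Longrightarrow> C1_on (cimg c) (\<lambda>y. X c (cinv c y) $ i)"
  and vfield_transform: "vfield X \<Longrightarrow> c \<in> A \<Longrightarrow> c' \<in> A \<Longrightarrow> p \<in> cdom c \<Longrightarrow> p \<in> cdom c' \<Longrightarrow>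
    X c' p = jac c c' p *v X c p"
  unfolding vfield_def by blast+

lemma cmap_in: "p \<in> cdom c \<Longrightarrow> cmap c p \<in> cimg c" by simp

lemma C1_fun_continuous: "C1_fun h \<Longrightarrow> continuous_on UNIV h"
  by (intro continuous_on_charts C1_on_continuous C1_funD)

lemma C1_fun_mult: "C1_fun h \<Longrightarrow> C1_fun k \<Longrightarrow> C1_fun (\<lambda>p. h p * k p)"
  unfolding C1_fun_def by (intro ballI C1_on_mult chart_open) blast+

lemma C1_fun_sum: "(\<And>i. i \<in> I \<Longrightarrow> C1_fun (h i)) \<Longrightarrow> C1_fun (\<lambda>p. \<Sum>i\<in>I. h i p)"
  unfolding C1_fun_def by (intro ballI C1_on_sum chart_open) blast+

lemma C1_fun_divide: "C1_fun h \<Longrightarrow> C1_fun k \<Longrightarrow> (\<And>p. k p \<noteq> 0) \<Longrightarrow> C1_fun (\<lambda>p. h p / k p)"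
  unfolding C1_fun_def by (intro ballI C1_on_divide chart_open) blast+

lemma chart_deriv_transform:
  assumes c: "c \<in> A" "c' \<in> A" "p \<in> cdom c" "p \<in> cdom c'"
    and h: "(\<lambda>y. h (cinv c' y)) differentiable at (cmap c' p)"
  shows "chart_deriv c h p v = chart_deriv c' h p (jac c c' p *v v)"
proof -
  have d: "((\<lambda>y. h (cinv c' y)) has_derivative chart_deriv c' h p) (at (cmap c' (cinv c (cmap c p))))"
    using h c by (simp add: cinv_cmap chart_deriv_def[abs_def] frechet_derivative_works)
  have "((\<lambda>y. h (cinv c' (cmap c' (cinv c y)))) has_derivative (\<lambda>v. chart_deriv c' h p (jac c c' p *v v))) (at (cmap c p))"
    using has_derivative_compose[OF transition_has_derivative[OF c] d] .
  then have "((\<lambda>y. h (cinv c y)) has_derivative (\<lambda>v. chart_deriv c' h p (jac c c' p *v v))) (at (cmap c p))"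
  proof (rule has_derivative_transform_within_open[OF _ open_overlap[OF c(1,2)]])
    show "cmap c p \<in> cmap c ` (cdom c \<inter> cdom c')" using c by blast
    fix y assume "y \<in> cmap c ` (cdom c \<inter> cdom c')"
    then have "cinv c y \<in> cdom c'" using c(1) by (auto simp: cinv_cmap)
    then show "h (cinv c' (cmap c' (cinv c y))) = h (cinv c y)" using c(2) by (simp add: cinv_cmap)
  qed
  from frechet_derivative_at[OF this] show ?thesis
    unfolding chart_deriv_def[of c] by (rule fun_cong[symmetric])
qed

lemma C1_fun_differentiable:
  "C1_fun h \<Longrightarrow> c \<in> A \<Longrightarrow> p \<in> cdom c \<Longrightarrow> (\<lambda>y. h (cinv c y)) differentiable at (cmap c p)"
  by (rule C1_on_differentiable[OF C1_funD chart_open(2) cmap_in])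

lemma dir_deriv_chart:
  assumes h: "C1_fun h" and X: "vfield X" and c: "c \<in> A" "p \<in> cdom c"
  shows "dir_deriv X h p = chart_deriv c h p (X c p)"
  unfolding dir_deriv_def
  by (subst chart_deriv_transform[OF c(1) chart_at(1) c(2) chart_at(2) C1_fun_differentiable[OF h chart_at]])
    (simp add: vfield_transform[OF X c(1) chart_at(1) c(2) chart_at(2)])

lemma continuous_chart_deriv:
  assumes c: "c \<in> A" and h: "C1_on (cimg c) (\<lambda>y. h (cinv c y))" and X: "vfield X"
  shows "continuous_on (cdom c) (\<lambda>p. chart_deriv c h p (X c p))"
proof (rule continuous_on_chart[OF c order_refl])
  have "continuous_on (cimg c) (\<lambda>y. \<Sum>i\<in>UNIV. X c (cinv c y) $ i *\<^sub>R frechet_derivative (\<lambda>y. h (cinv c y)) (at y) (axis i 1))"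
    by (intro continuous_on_sum continuous_on_scaleR C1_on_continuous[OF vfield_C1[OF X c]]
        C1_on_continuous_derivative[OF h chart_open(2)[OF c]])
  then show "continuous_on (cimg c) (\<lambda>y. chart_deriv c h (cinv c y) (X c (cinv c y)))"
  proof (rule continuous_on_eq)
    fix y assume y: "y \<in> cimg c"
    show "(\<Sum>i\<in>UNIV. X c (cinv c y) $ i *\<^sub>R frechet_derivative (\<lambda>y. h (cinv c y)) (at y) (axis i 1)) =
        chart_deriv c h (cinv c y) (X c (cinv c y))"
      unfolding chart_deriv_def cmap_cinv[OF c y]
      by (rule frechet_derivative_axis_sum[symmetric, OF C1_on_differentiable[OF h chart_open(2)[OF c] y]])
  qed
qed

lemma C1_dens_vfield:
  "vfield X \<Longrightarrow> c \<in> A \<Longrightarrow> C1_on (cimg c) (\<lambda>y. dens c (cinv c y) * X c (cinv c y) $ i)"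
  by (intro C1_on_mult chart_open C1_dens vfield_C1)

lemma continuous_chart_div:
  assumes c: "c \<in> A" and X: "vfield X"
  shows "continuous_on (cdom c) (chart_div c X)"
proof (rule continuous_on_chart[OF c order_refl])
  have "continuous_on (cimg c) (\<lambda>y.
    (\<Sum>i\<in>UNIV. frechet_derivative (\<lambda>y. dens c (cinv c y) * X c (cinv c y) $ i) (at y) (axis i 1)) / dens c (cinv c y))"
    by (intro continuous_on_divide continuous_on_sum C1_on_continuous_derivative[OF C1_dens_vfield[OF X c]]
        continuous_dens chart_open c ballI less_imp_neq[THEN not_sym] dens_pos cinv_in)
  then show "continuous_on (cimg c) (\<lambda>y. chart_div c X (cinv c y))"
    by (rule continuous_on_eq) (simp add: chart_div_def cmap_cinv[OF c])
qed

lemma continuous_on_glue: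
  fixes h :: "'a \<Rightarrow> real"
  assumes "open U" "continuous_on U h" "compact K" "K \<subseteq> U" "\<And>p. p \<notin> K \<Longrightarrow> h p = 0"
  shows "continuous_on UNIV h"
proof -
  have o: "open (- K)" using assms(3) by (simp add: compact_imp_closed open_Compl)
  have "continuous_on (- K) h"
    by (rule continuous_on_eq[OF continuous_on_const[of _ 0]]) (simp add: assms(5))
  then have "continuous_on (U \<union> - K) h" using assms o by (intro continuous_on_open_Un)
  moreover have "U \<union> - K = UNIV" using assms(4) by blast
  ultimately show ?thesis by simp
qed

lemma chart_deriv_outside:
  assumes c: "c \<in> A" "p \<in> cdom c" and K: "compact K" "p \<notin> K" and z: "\<And>q. q \<notin> K \<Longrightarrow> h q = 0"
  shows "chart_deriv c h p v = 0"
  unfolding chart_deriv_def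
proof (rule derivative_zero_outside_support[of "cmap c ` (cdom c - K)"])
  have "open (cdom c - K)" using c K by (intro open_Diff chart_open compact_imp_closed)
  then show "open (cmap c ` (cdom c - K))" by (intro open_cmap_image c) auto
qed (use c K z in \<open>auto simp: cinv_cmap\<close>)

text \<open>
  The function \<open>h\<close> has compact support in the chart, so everything happens in the coordinate image.
  There the density of the volume cancels the denominator of the divergence, and what is left is
  Euclidean integration by parts of \<open>h\<close> against the components of \<open>\<surd>(det g) X\<close>.
\<close>
lemma integration_by_parts_in_chart:
  assumes c: "c \<in> A" and X: "vfield X" and h: "C1_on (cimg c) (\<lambda>y. h (cinv c y))"
    and K: "compact K" "K \<subseteq> cdom c" and z: "\<And>p. p \<notin> K \<Longrightarrow> h p = 0"
  defines "d \<equiv> \<lambda>p. if p \<in> cdom c then h p * chart_div c X p else 0"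
    and "e \<equiv> \<lambda>p. if p \<in> cdom c then chart_deriv c h p (X c p) else 0"
  shows "continuous_on UNIV d" "continuous_on UNIV e" "integral\<^sup>L vol d = - integral\<^sup>L vol e"
proof -
  let ?W = "cimg c" and ?\<psi> = "\<lambda>y. h (cinv c y)" and ?F = "\<lambda>i y. dens c (cinv c y) * X c (cinv c y) $ i"
  have hc: "continuous_on (cdom c) h"
    using continuous_on_chart[OF c order_refl C1_on_continuous[OF h]] .
  have "continuous_on (cdom c) d"
    by (rule continuous_on_eq[OF continuous_on_mult[OF hc continuous_chart_div[OF c X]]]) (simp add: d_def)
  then show dc: "continuous_on UNIV d"
    using K by (rule continuous_on_glue[OF chart_open(1)[OF c]]) (simp add: d_def z)
  have "continuous_on (cdom c) e"
    by (rule continuous_on_eq[OF continuous_chart_deriv[OF c h X]]) (simp add: e_def)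
  then show ec: "continuous_on UNIV e"
    using K by (rule continuous_on_glue[OF chart_open(1)[OF c]]) (simp add: e_def chart_deriv_outside[OF c _ K(1) _ z])
  have K': "compact (cmap c ` K)"
    by (intro compact_continuous_image continuous_on_subset[OF continuous_cmap[OF c]] K)
  have z': "h (cinv c y) = 0" if "y \<in> ?W - cmap c ` K" for y
  proof (rule z, rule)
    assume "cinv c y \<in> K"
    moreover have "cmap c (cinv c y) = y" using that c by (intro cmap_cinv) auto
    ultimately show False using that by (metis DiffD2 imageI)
  qed
  note ibp = integration_by_parts_compact_support[OF chart_open(2)[OF c] K' image_mono[OF K(2)] h z' C1_dens_vfield[OF X c]]
  have "integral\<^sup>L vol d = integral\<^sup>L lborel (\<lambda>y. indicator ?W y * (dens c (cinv c y) * d (cinv c y)))"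
    by (intro integral_vol_chart c borel_measurable_continuous_onI dc) (simp add: d_def)
  also have "\<dots> = integral\<^sup>L lborel (\<lambda>y. \<Sum>i\<in>UNIV. indicator ?W y * (?\<psi> y * frechet_derivative (?F i) (at y) (axis i 1)))"
  proof (rule Bochner_Integration.integral_cong[OF refl])
    fix y
    show "indicator ?W y * (dens c (cinv c y) * d (cinv c y)) =
        (\<Sum>i\<in>UNIV. indicator ?W y * (?\<psi> y * frechet_derivative (?F i) (at y) (axis i 1)))"
    proof (cases "y \<in> ?W")
      case True
      then have "dens c (cinv c y) \<noteq> 0" using dens_pos[OF c cinv_in[OF c]] by (metis less_irrefl)
      then show ?thesis
        using True by (simp add: d_def chart_div_def cinv_in[OF c] cmap_cinv[OF c] sum_distrib_left sum_divide_distrib)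
    qed simp
  qed
  also have "\<dots> = (\<Sum>i\<in>UNIV. - integral\<^sup>L lborel (\<lambda>y. indicator ?W y * (frechet_derivative ?\<psi> (at y) (axis i 1) * ?F i y)))"
    by (subst Bochner_Integration.integral_sum) (use ibp in simp_all)
  also have "\<dots> = - integral\<^sup>L lborel (\<lambda>y. \<Sum>i\<in>UNIV. indicator ?W y * (frechet_derivative ?\<psi> (at y) (axis i 1) * ?F i y))"
    by (subst Bochner_Integration.integral_sum) (use ibp in \<open>simp_all add: sum_negf\<close>)
  also have "integral\<^sup>L lborel (\<lambda>y. \<Sum>i\<in>UNIV. indicator ?W y * (frechet_derivative ?\<psi> (at y) (axis i 1) * ?F i y)) =
      integral\<^sup>L lborel (\<lambda>y. indicator ?W y * (dens c (cinv c y) * e (cinv c y)))"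
  proof (rule Bochner_Integration.integral_cong[OF refl])
    fix y
    show "(\<Sum>i\<in>UNIV. indicator ?W y * (frechet_derivative ?\<psi> (at y) (axis i 1) * ?F i y)) =
        indicator ?W y * (dens c (cinv c y) * e (cinv c y))"
    proof (cases "y \<in> ?W")
      case True
      have "chart_deriv c h (cinv c y) (X c (cinv c y)) =
          (\<Sum>i\<in>UNIV. X c (cinv c y) $ i *\<^sub>R frechet_derivative ?\<psi> (at y) (axis i 1))"
        unfolding chart_deriv_def cmap_cinv[OF c True]
        by (rule frechet_derivative_axis_sum[OF C1_on_differentiable[OF h chart_open(2)[OF c] True]])
      then show ?thesis
        using True by (simp add: e_def cinv_in[OF c] sum_distrib_left mult_ac)
    qed simp
  qed
  also have "\<dots> = integral\<^sup>L vol e"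
    by (intro integral_vol_chart[symmetric] c borel_measurable_continuous_onI ec) (simp add: e_def)
  finally show "integral\<^sup>L vol d = - integral\<^sup>L vol e" .
qed

text \<open>
  Pull back a Euclidean bump by a chart. In any other chart it is the bump after a coordinate
  change on the overlap, and zero on the open complement of its compact support.
\<close>
lemma bump_function:
  assumes V: "open V" "p \<in> V"
  obtains \<eta> K where "C1_fun \<eta>" "\<And>q. 0 \<le> \<eta> q" "\<eta> p > 0" "compact K" "K \<subseteq> V" "\<And>q. q \<notin> K \<Longrightarrow> \<eta> q = 0"
proof -
  obtain c where c: "c \<in> A" "p \<in> cdom c" using chart_cover by blast
  let ?V = "V \<inter> cdom c"
  have "open (cmap c ` ?V)" by (intro open_cmap_image c open_Int V chart_open) auto
  moreover have "cmap c p \<in> cmap c ` ?V" using V c by blast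
  ultimately obtain r where r: "r > 0" "cball (cmap c p) r \<subseteq> cmap c ` ?V"
    using open_contains_cball by blast
  define K where "K = cinv c ` cball (cmap c p) r"
  have sub: "cball (cmap c p) r \<subseteq> cimg c" using r(2) by blast
  have K: "compact K" unfolding K_def
    by (intro compact_continuous_image continuous_on_subset[OF continuous_cinv[OF c(1)] sub] compact_cball)
  have KV: "K \<subseteq> V" "K \<subseteq> cdom c"
    using r(2) by (force simp: K_def cinv_cmap[OF c(1)])+
  define \<eta> where "\<eta> q = (if q \<in> cdom c then bump (cmap c p) r (cmap c q) else 0)" for q
  have z: "\<eta> q = 0" if "q \<notin> K" for q
  proof (cases "q \<in> cdom c")
    case True
    have "cmap c q \<notin> cball (cmap c p) r"
    proof
      assume "cmap c q \<in> cball (cmap c p) r"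
      then have "cinv c (cmap c q) \<in> K" unfolding K_def by (rule imageI)
      then show False using that cinv_cmap[OF c(1) True] by simp
    qed
    then show ?thesis using bump_outside[OF r(1), of "cmap c q" "cmap c p"] by (simp add: \<eta>_def)
  qed (simp add: \<eta>_def)
  have "C1_on (cimg c') (\<lambda>y. \<eta> (cinv c' y))" if c': "c' \<in> A" for c'
  proof (rule C1_on_local[OF chart_open(2)[OF c']])
    fix y assume y: "y \<in> cimg c'"
    show "\<exists>U. open U \<and> y \<in> U \<and> C1_on U (\<lambda>y. \<eta> (cinv c' y))"
    proof (cases "cinv c' y \<in> cdom c")
      case True
      let ?U = "cmap c' ` (cdom c' \<inter> cdom c)"
      have oU: "open ?U" using open_overlap[OF c' c(1)] .
      have "C1_on ?U (\<lambda>y. bump (cmap c p) r (cmap c (cinv c' y)))"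
        by (rule C1_on_compose[OF oU open_UNIV C1_on_bump C1_transition[OF c' c(1)]]) simp
      then have "C1_on ?U (\<lambda>y. \<eta> (cinv c' y))"
        by (rule C1_on_cong[OF _ oU]) (auto simp: \<eta>_def cinv_cmap[OF c'])
      moreover have "y \<in> ?U" using True y cinv_in[OF c' y] cmap_cinv[OF c' y] by (metis IntI imageI)
      ultimately show ?thesis using oU by blast
    next
      case False
      let ?U = "cmap c' ` (cdom c' - K)"
      have "open (cdom c' - K)" using c' K by (intro open_Diff chart_open compact_imp_closed)
      then have oU: "open ?U" by (intro open_cmap_image c') auto
      have "C1_on ?U (\<lambda>y. \<eta> (cinv c' y))"
        by (rule C1_on_cong[OF C1_on_const[OF oU, of 0] oU]) (auto simp: cinv_cmap[OF c'] z)
      moreover have "cinv c' y \<in> cdom c' - K" using False KV cinv_in[OF c' y] by blast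
      then have "y \<in> ?U" using cmap_cinv[OF c' y] by (metis imageI)
      ultimately show ?thesis using oU by blast
    qed
  qed
  then have "C1_fun \<eta>" by (simp add: C1_fun_def)
  moreover have "0 \<le> \<eta> q" for q by (simp add: \<eta>_def bump_nonneg)
  moreover have "\<eta> p > 0" using c r bump_center by (simp add: \<eta>_def)
  ultimately show thesis using that[of \<eta> K] K KV(1) z by blast
qed

text \<open>
  Differentiating the Jacobian determinants of the coordinate change can be avoided by a weak
  formulation: integrated against a test function \<open>\<eta>\<close> supported in the overlap, both coordinate
  expressions give \<open>- \<integral> d\<eta>(X)\<close>, which is manifestly independent of the chart. If one expression were
  larger at \<open>p\<close>, it would be so near \<open>p\<close> by continuity, and a bump at \<open>p\<close> would detect it.
\<close>
lemma chart_div_le: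
  assumes c: "c \<in> A" "c' \<in> A" "p \<in> cdom c" "p \<in> cdom c'" and X: "vfield X"
  shows "chart_div c X p \<le> chart_div c' X p"
proof (rule ccontr)
  let ?O = "cdom c \<inter> cdom c'"
  define \<delta> where "\<delta> q = chart_div c X q - chart_div c' X q" for q
  assume "\<not> ?thesis"
  then have pos: "\<delta> p > 0" by (simp add: \<delta>_def)
  have oO: "open ?O" using c chart_open by blast
  have dO: "continuous_on ?O \<delta>" unfolding \<delta>_def
    by (intro continuous_on_diff continuous_on_subset[OF continuous_chart_div[OF c(1) X]]
        continuous_on_subset[OF continuous_chart_div[OF c(2) X]]) auto
  define V where "V = ?O \<inter> \<delta> -` {0<..}"
  have V: "open V" "p \<in> V"
    using continuous_open_preimage[OF dO oO open_greaterThan, of 0] pos c by (auto simp: V_def)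
  obtain \<eta> K where \<eta>: "C1_fun \<eta>" "\<And>q. 0 \<le> \<eta> q" "\<eta> p > 0" and K: "compact K" "K \<subseteq> V" "\<And>q. q \<notin> K \<Longrightarrow> \<eta> q = 0"
    using bump_function[OF V] by blast
  have KO: "K \<subseteq> cdom c" "K \<subseteq> cdom c'" using K by (auto simp: V_def)
  note I = integration_by_parts_in_chart[OF c(1) X C1_funD[OF \<eta>(1) c(1)] K(1) KO(1) K(3)]
  note I' = integration_by_parts_in_chart[OF c(2) X C1_funD[OF \<eta>(1) c(2)] K(1) KO(2) K(3)]
  have "(\<lambda>q. if q \<in> cdom c then chart_deriv c \<eta> q (X c q) else 0) =
      (\<lambda>q. if q \<in> cdom c' then chart_deriv c' \<eta> q (X c' q) else 0)"
  proof
    fix q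
    show "(if q \<in> cdom c then chart_deriv c \<eta> q (X c q) else 0) = (if q \<in> cdom c' then chart_deriv c' \<eta> q (X c' q) else 0)"
    proof (cases "q \<in> K")
      case True
      then have q: "q \<in> cdom c" "q \<in> cdom c'" using KO by auto
      then show ?thesis
        using dir_deriv_chart[OF \<eta>(1) X c(1) q(1)] dir_deriv_chart[OF \<eta>(1) X c(2) q(2)] by simp
    next
      case False
      show ?thesis
        using chart_deriv_outside[OF c(1) _ K(1) False K(3)] chart_deriv_outside[OF c(2) _ K(1) False K(3)] by auto
    qed
  qed
  then have "integral\<^sup>L vol (\<lambda>q. if q \<in> cdom c then \<eta> q * chart_div c X q else 0) =
      integral\<^sup>L vol (\<lambda>q. if q \<in> cdom c' then \<eta> q * chart_div c' X q else 0)"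
    using I(3) I'(3) by simp
  moreover have "integral\<^sup>L vol (\<lambda>q. (if q \<in> cdom c then \<eta> q * chart_div c X q else 0) - (if q \<in> cdom c' then \<eta> q * chart_div c' X q else 0)) =
    integral\<^sup>L vol (\<lambda>q. if q \<in> cdom c then \<eta> q * chart_div c X q else 0) - integral\<^sup>L vol (\<lambda>q. if q \<in> cdom c' then \<eta> q * chart_div c' X q else 0)"
    by (rule Bochner_Integration.integral_diff[OF integrable_vol[OF I(1)] integrable_vol[OF I'(1)]])
  ultimately have "integral\<^sup>L vol (\<lambda>q. (if q \<in> cdom c then \<eta> q * chart_div c X q else 0) - (if q \<in> cdom c' then \<eta> q * chart_div c' X q else 0)) = 0"
    by simp
  moreover have eq: "(if q \<in> cdom c then \<eta> q * chart_div c X q else 0) - (if q \<in> cdom c' then \<eta> q * chart_div c' X q else 0) = \<eta> q * \<delta> q" for q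
  proof (cases "q \<in> K")
    case True
    then show ?thesis using KO by (auto simp: \<delta>_def algebra_simps)
  qed (simp add: K(3))
  ultimately have int0: "integral\<^sup>L vol (\<lambda>q. \<eta> q * \<delta> q) = 0" by simp
  have "continuous_on UNIV (\<lambda>q. \<eta> q * \<delta> q)"
    using continuous_on_diff[OF I(1) I'(1)] unfolding eq .
  moreover have "\<eta> q * \<delta> q \<ge> 0" for q
  proof (cases "q \<in> K")
    case True
    then have "\<delta> q > 0" using K(2) by (auto simp: V_def)
    then show ?thesis using \<eta>(2)[of q] by simp
  qed (simp add: K(3))
  ultimately have "\<eta> p * \<delta> p = 0" using int0 by (rule continuous_integral_zero)
  then show False using pos \<eta>(3) by simp
qed

lemma chart_div_indep:
  assumes "c \<in> A" "c' \<in> A" "p \<in> cdom c" "p \<in> cdom c'" "vfield X"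
  shows "chart_div c X p = chart_div c' X p"
  using chart_div_le[OF assms] chart_div_le[OF assms(2,1,4,3,5)] by simp

lemma divergence_chart_at: "divergence A g X p = chart_div (chart_at A p) X p"
  by (simp add: divergence_def Let_def chart_div_def pderiv_at_def dens_def)

lemma divergence_chart:
  "vfield X \<Longrightarrow> c \<in> A \<Longrightarrow> p \<in> cdom c \<Longrightarrow> divergence A g X p = chart_div c X p"
  unfolding divergence_chart_at by (intro chart_div_indep chart_at)

lemma continuous_divergence:
  assumes X: "vfield X"
  shows "continuous_on UNIV (divergence A g X)"
proof (rule continuous_on_charts)
  fix c assume c: "c \<in> A"
  show "continuous_on (cimg c) (\<lambda>y. divergence A g X (cinv c y))"
    by (rule continuous_on_eq[OF continuous_in_chart[OF c continuous_chart_div[OF c X]]])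
      (simp add: divergence_chart[OF X c cinv_in[OF c]])
qed

lemma continuous_dir_deriv:
  assumes h: "C1_fun h" and X: "vfield X"
  shows "continuous_on UNIV (dir_deriv X h)"
proof (rule continuous_on_charts)
  fix c assume c: "c \<in> A"
  show "continuous_on (cimg c) (\<lambda>y. dir_deriv X h (cinv c y))"
    by (rule continuous_on_eq[OF continuous_in_chart[OF c continuous_chart_deriv[OF c C1_funD[OF h c] X]]])
      (simp add: dir_deriv_chart[OF h X c cinv_in[OF c]])
qed

lemma dir_deriv_sum:
  assumes "\<And>i. i \<in> I \<Longrightarrow> C1_fun (h i)"
  shows "dir_deriv X (\<lambda>p. \<Sum>i\<in>I. h i p) p = (\<Sum>i\<in>I. dir_deriv X (h i) p)"
proof -
  let ?c = "chart_at A p"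
  have "((\<lambda>y. \<Sum>i\<in>I. h i (cinv ?c y)) has_derivative (\<lambda>v. \<Sum>i\<in>I. chart_deriv ?c (h i) p v)) (at (cmap ?c p))"
    unfolding chart_deriv_def
    by (intro has_derivative_sum C1_on_has_derivative[OF C1_funD chart_open(2) cmap_in] assms chart_at)
  from frechet_derivative_at[OF this] show ?thesis
    unfolding dir_deriv_def chart_deriv_def[of ?c "\<lambda>p. \<Sum>i\<in>I. h i p"] by (rule fun_cong[symmetric])
qed

lemma integration_by_parts_supported:
  assumes X: "vfield X" and h: "C1_fun h" and c: "c \<in> A"
    and K: "compact K" "K \<subseteq> cdom c" and z: "\<And>p. p \<notin> K \<Longrightarrow> h p = 0"
  shows "integral\<^sup>L vol (\<lambda>p. h p * divergence A g X p) = - integral\<^sup>L vol (dir_deriv X h)"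
proof -
  have "(\<lambda>p. if p \<in> cdom c then h p * chart_div c X p else 0) = (\<lambda>p. h p * divergence A g X p)"
    using K z by (auto simp: fun_eq_iff divergence_chart[OF X c])
  moreover have "(\<lambda>p. if p \<in> cdom c then chart_deriv c h p (X c p) else 0) = dir_deriv X h"
  proof
    fix p
    show "(if p \<in> cdom c then chart_deriv c h p (X c p) else 0) = dir_deriv X h p"
    proof (cases "p \<in> cdom c")
      case True
      then show ?thesis using dir_deriv_chart[OF h X c] by simp
    next
      case False
      then have "p \<notin> K" using K by blast
      then show ?thesis
        using False chart_deriv_outside[OF chart_at K(1) _ z] by (simp add: dir_deriv_def)
    qed
  qed
  ultimately show ?thesis
    using integration_by_parts_in_chart(3)[OF c X C1_funD[OF h c] K z] by simp
qed

text \<open>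
  Divide suitable bumps by their sum to get a partition of unity. Each product \<open>\<zeta>\<^sub>p\<close> of \<open>h\<close> with one of
  its members is supported in a single chart, where the formula is already known.
\<close>
theorem integration_by_parts:
  assumes X: "vfield X" and h: "C1_fun h"
  shows "integral\<^sup>L vol (\<lambda>p. h p * divergence A g X p) = - integral\<^sup>L vol (dir_deriv X h)"
proof -
  have "\<exists>\<eta> K. C1_fun \<eta> \<and> (\<forall>q. 0 \<le> \<eta> q) \<and> \<eta> p > 0 \<and> compact K \<and> K \<subseteq> cdom (chart_at A p) \<and> (\<forall>q. q \<notin> K \<longrightarrow> \<eta> q = 0)" for p
    using bump_function[OF chart_open(1)[OF chart_at(1)] chart_at(2), of p] by metis
  then obtain \<eta> K where \<eta>: "\<And>p. C1_fun (\<eta> p)" "\<And>p q. 0 \<le> \<eta> p q" "\<And>p. \<eta> p p > (0::real)"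
    and K: "\<And>p. compact (K p)" "\<And>p. K p \<subseteq> cdom (chart_at A p)" "\<And>p q. q \<notin> K p \<Longrightarrow> \<eta> p q = 0"
    by metis
  have "open {q. \<eta> p q > 0}" for p
    by (intro open_Collect_less continuous_on_const C1_fun_continuous \<eta>)
  then obtain F where F: "finite F" "UNIV \<subseteq> (\<Union>p\<in>F. {q. \<eta> p q > 0})"
    using compactE_image[OF compact_M, of UNIV "\<lambda>p. {q. \<eta> p q > 0}"] \<eta>(3)
    by (metis (no_types, lifting) UNIV_I UN_iff mem_Collect_eq subsetI)
  define w where "w q = (\<Sum>p\<in>F. \<eta> p q)" for q
  have w: "w q > 0" for q
  proof -
    obtain p where "p \<in> F" "\<eta> p q > 0" using F(2) by blast
    then show ?thesis unfolding w_def using F(1) \<eta>(2) by (intro sum_pos2)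
  qed
  have wC1: "C1_fun w" unfolding w_def[abs_def] by (intro C1_fun_sum \<eta>)
  define \<zeta> where "\<zeta> p q = \<eta> p q * h q / w q" for p q
  have wn: "w q \<noteq> 0" for q using w[of q] by simp
  have \<zeta>: "C1_fun (\<zeta> p)" for p
    unfolding \<zeta>_def[abs_def] by (intro C1_fun_divide C1_fun_mult \<eta> h wC1 wn)
  have sum: "h q = (\<Sum>p\<in>F. \<zeta> p q)" for q
  proof -
    have "(\<Sum>p\<in>F. \<zeta> p q) = w q * h q / w q"
      by (simp add: \<zeta>_def w_def sum_distrib_right sum_divide_distrib)
    then show ?thesis using wn by simp
  qed
  have z: "\<zeta> p q = 0" if "q \<notin> K p" for p q using K(3)[OF that] by (simp add: \<zeta>_def)
  have i1: "integrable vol (\<lambda>q. \<zeta> p q * divergence A g X q)" for p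
    by (intro integrable_vol continuous_on_mult C1_fun_continuous \<zeta> continuous_divergence X)
  have i2: "integrable vol (dir_deriv X (\<zeta> p))" for p
    by (intro integrable_vol continuous_dir_deriv \<zeta> X)
  have "integral\<^sup>L vol (\<lambda>q. h q * divergence A g X q) = integral\<^sup>L vol (\<lambda>q. \<Sum>p\<in>F. \<zeta> p q * divergence A g X q)"
    by (simp add: sum sum_distrib_right)
  also have "\<dots> = (\<Sum>p\<in>F. integral\<^sup>L vol (\<lambda>q. \<zeta> p q * divergence A g X q))"
    by (rule Bochner_Integration.integral_sum) (rule i1)
  also have "\<dots> = (\<Sum>p\<in>F. - integral\<^sup>L vol (dir_deriv X (\<zeta> p)))"
    by (intro sum.cong refl integration_by_parts_supported[OF X \<zeta> chart_at(1) K(1,2) z])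
  also have "\<dots> = - integral\<^sup>L vol (\<lambda>q. \<Sum>p\<in>F. dir_deriv X (\<zeta> p) q)"
    by (subst Bochner_Integration.integral_sum) (simp_all add: i2 sum_negf)
  also have "(\<lambda>q. \<Sum>p\<in>F. dir_deriv X (\<zeta> p) q) = dir_deriv X (\<lambda>q. \<Sum>p\<in>F. \<zeta> p q)"
    using \<zeta> by (simp add: dir_deriv_sum fun_eq_iff)
  also have "(\<lambda>q. \<Sum>p\<in>F. \<zeta> p q) = h" by (simp add: sum fun_eq_iff)
  finally show ?thesis .
qed

end

section \<open>The weighted divergence form operator\<close>

locale weighted_riemannian = riemannian A g
  for A :: "('a::{t2_space, second_countable_topology}, 'm::finite) chart set"
    and g :: "('a, 'm) tensor2" +
  fixes T :: "('a, 'm) tensor2" and f :: "'a \<Rightarrow> real"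
  assumes spd: "spd_tensor A g T" and f: "Ck_fun A 2 f"
begin

abbreviation C2_fun :: "('a \<Rightarrow> real) \<Rightarrow> bool" where "C2_fun \<equiv> Ck_fun A 2"

abbreviation L :: "('a \<Rightarrow> real) \<Rightarrow> 'a \<Rightarrow> real" where "L \<equiv> L_op A g T f"

abbreviation flux :: "('a \<Rightarrow> real) \<Rightarrow> ('a, 'm) vfield" where
  "flux h \<equiv> apply_tensor T (grad g h)"

lemma C2_C1: "C2_fun h \<Longrightarrow> C1_fun h"
  unfolding C1_fun_def Ck_fun_def comp_def numeral_2_eq_2 using Ck_on_Suc_imp[of "Suc 0"] by metis

lemma C2_deriv:
  assumes h: "C2_fun h" and c: "c \<in> A"
  shows "C1_on (cimg c) (\<lambda>y. frechet_derivative (\<lambda>y. h (cinv c y)) (at y) v)"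
proof (rule C1_on_cong[OF _ chart_open(2)[OF c]])
  show "C1_on (cimg c) (\<lambda>y. frechet_derivative (\<lambda>y. h (cinv c y)) (at y within cimg c) v)"
    using h c unfolding Ck_fun_def comp_def numeral_2_eq_2 Ck_on.simps(2)[of "Suc 0"] by blast
qed (simp add: at_within_open[OF _ chart_open(2)[OF c]])

lemma C1_T: "c \<in> A \<Longrightarrow> C1_on (cimg c) (\<lambda>y. T c (cinv c y) $ i $ j)"
proof -
  assume c: "c \<in> A"
  have "C1_on (cimg c) (\<lambda>y. T c (cinv c y))"
    using spd c unfolding spd_tensor_def smooth_on_def comp_def by blast
  then show ?thesis by (intro C1_on_vec_nth chart_open c)
qed

lemma T_transform:
  "c \<in> A \<Longrightarrow> c' \<in> A \<Longrightarrow> p \<in> cdom c \<Longrightarrow> p \<in> cdom c' \<Longrightarrow> jac c c' p ** T c p = T c' p ** jac c c' p"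
  and T_sym: "c \<in> A \<Longrightarrow> p \<in> cdom c \<Longrightarrow> (T c p *v v) \<bullet> (g c p *v w) = v \<bullet> (g c p *v (T c p *v w))"
  using spd unfolding spd_tensor_def by blast+

lemma g_inner_sym: "c \<in> A \<Longrightarrow> p \<in> cdom c \<Longrightarrow> (g c p *v v) \<bullet> w = v \<bullet> (g c p *v w)"
  using g_sym[of c p] by (metis dot_lmul_matrix transpose_matrix_vector)

text \<open>
  The gradient is the vector that represents the differential with respect to the metric.
\<close>
lemma g_grad:
  assumes c: "c \<in> A" "p \<in> cdom c" and h: "C1_fun h"
  shows "(g c p *v grad g h c p) \<bullet> w = chart_deriv c h p w"
proof -
  have "g c p ** matrix_inv (g c p) = mat 1"
    using det_g_pos[OF c] by (intro matrix_inv_right_inverse) simp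
  then have "g c p *v grad g h c p = (\<chi> j. pderiv_at (h \<circ> cinv c) (cmap c p) j)"
    by (simp add: grad_def matrix_vector_mul_assoc)
  then show ?thesis
    using frechet_derivative_axis_sum[OF C1_fun_differentiable[OF h c], of w]
    by (simp add: chart_deriv_def inner_vec_def pderiv_at_def comp_def mult.commute)
qed

text \<open>
  Both sides represent the same differential with respect to the metric in the chart \<open>c'\<close>, and a
  positive definite form has only one such vector.
\<close>
lemma grad_transform:
  assumes c: "c \<in> A" "c' \<in> A" "p \<in> cdom c" "p \<in> cdom c'" and h: "C1_fun h"
  shows "grad g h c' p = jac c c' p *v grad g h c p"
proof -
  let ?J = "jac c c' p"
  \<comment> \<open>the difference of the two candidates is tested against itself, as \<open>J w\<close> ranges over all vectors\<close>
  define z where "z = ?J *v grad g h c p - grad g h c' p"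
  have "det ?J \<noteq> 0"
    using dens_transform[OF c] dens_pos[OF c(1,3)] by auto
  then have "invertible ?J" by (simp add: invertible_det_nz)
  then obtain w where w: "?J *v w = z"
    by (metis invertible_def matrix_vector_mul_assoc matrix_vector_mul_lid)
  have "(g c' p *v (?J *v grad g h c p)) \<bullet> (?J *v w) = (g c p *v grad g h c p) \<bullet> w"
    unfolding g_transform[OF c]
    by (simp add: matrix_vector_mul_assoc[symmetric] transpose_matrix_vector dot_lmul_matrix)
  also have "\<dots> = chart_deriv c h p w" by (rule g_grad[OF c(1,3) h])
  also have "\<dots> = chart_deriv c' h p (?J *v w)"
    by (rule chart_deriv_transform[OF c C1_fun_differentiable[OF h c(2,4)]])
  also have "\<dots> = (g c' p *v grad g h c' p) \<bullet> (?J *v w)" by (rule g_grad[OF c(2,4) h, symmetric])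
  finally have "(g c' p *v z) \<bullet> z = 0"
    unfolding w z_def by (simp add: matrix_vector_mult_diff_distrib inner_diff_left)
  then have "z = 0" using g_pos[OF c(2,4), of z] by (metis inner_commute less_irrefl)
  then show ?thesis by (simp add: z_def)
qed

lemma vfield_flux:
  assumes h: "C2_fun h"
  shows "vfield (flux h)"
  unfolding vfield_def
proof (intro conjI ballI allI)
  fix c i assume c: "c \<in> A"
  note o = chart_open(2)[OF c]
  have "C1_on (cimg c) (\<lambda>y. (\<chi> j. frechet_derivative (\<lambda>y. h (cinv c y)) (at y) (axis j 1)) $ i)" for i
    using C2_deriv[OF h c] by (simp del: Ck_on.simps)
  then have "C1_on (cimg c) (\<lambda>y. (matrix_inv (g c (cinv c y)) *v (\<chi> j. frechet_derivative (\<lambda>y. h (cinv c y)) (at y) (axis j 1))) $ i)" for i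
    by (rule C1_on_matrix_inv_mult[OF o C1_g[OF c]]) (use det_g_pos[OF c cinv_in[OF c]] in \<open>metis less_irrefl\<close>)
  then have "C1_on (cimg c) (\<lambda>y. (T c (cinv c y) *v (matrix_inv (g c (cinv c y)) *v (\<chi> j. frechet_derivative (\<lambda>y. h (cinv c y)) (at y) (axis j 1)))) $ i)"
    by (rule C1_on_matrix_vector_mult[OF o C1_T[OF c]])
  then show "C1_on (cimg c) (\<lambda>y. flux h c (cinv c y) $ i)"
    by (rule C1_on_cong[OF _ o])
      (simp add: apply_tensor_def grad_def pderiv_at_def comp_def cmap_cinv[OF c])
next
  fix c c' p assume c: "c \<in> A" "c' \<in> A" and p: "p \<in> cdom c \<inter> cdom c'"
  have "flux h c' p = (T c' p ** jac c c' p) *v grad g h c p"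
    unfolding apply_tensor_def using grad_transform[OF c _ _ C2_C1[OF h]] p
    by (simp add: matrix_vector_mul_assoc)
  also have "\<dots> = jac c c' p *v flux h c p"
    using T_transform[OF c, of p] p by (simp add: apply_tensor_def matrix_vector_mul_assoc)
  finally show "flux h c' p = jac c c' p *v flux h c p" .
qed

lemma inner_grad_flux:
  assumes h: "C2_fun h" and k: "C2_fun k"
  shows "inner_g A g (grad g h) (flux k) p = dir_deriv (flux k) h p"
  unfolding inner_g_def Let_def dir_deriv_def g_inner_sym[OF chart_at, symmetric]
  by (rule g_grad[OF chart_at C2_C1[OF h]])

lemma inner_flux_grad:
  assumes h: "C2_fun h"
  shows "inner_g A g (flux h) (grad g h) p = dir_deriv (flux h) h p"
  using g_grad[OF chart_at C2_C1[OF h], of p "flux h (chart_at A p) p"]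
  by (simp add: inner_g_def Let_def dir_deriv_def inner_commute)

text \<open>
  Both sides are the value of the symmetric form \<open>\<langle>T(\<nabla>h), \<nabla>k\<rangle>\<close>.
\<close>
lemma dir_deriv_flux_sym:
  assumes h: "C2_fun h" and k: "C2_fun k"
  shows "dir_deriv (flux k) h p = dir_deriv (flux h) k p"
proof -
  let ?c = "chart_at A p"
  note c = chart_at[of p]
  have "dir_deriv (flux k) h p = (T ?c p *v grad g k ?c p) \<bullet> (g ?c p *v grad g h ?c p)"
    using g_grad[OF c C2_C1[OF h], of "flux k ?c p"]
    by (simp add: dir_deriv_def apply_tensor_def inner_commute)
  also have "\<dots> = grad g k ?c p \<bullet> (g ?c p *v (T ?c p *v grad g h ?c p))" by (rule T_sym[OF c])
  also have "\<dots> = (g ?c p *v grad g k ?c p) \<bullet> (T ?c p *v grad g h ?c p)" by (rule g_inner_sym[OF c, symmetric])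
  also have "\<dots> = dir_deriv (flux h) k p"
    using g_grad[OF c C2_C1[OF k], of "flux h ?c p"] by (simp add: dir_deriv_def apply_tensor_def)
  finally show ?thesis .
qed

lemma L_eq: "C2_fun h \<Longrightarrow> L h p = divergence A g (flux h) p - dir_deriv (flux h) f p"
  unfolding L_op_def by (simp add: inner_grad_flux[OF f])

lemma continuous_L: "C2_fun h \<Longrightarrow> continuous_on UNIV (L h)"
  by (subst continuous_on_cong[OF refl L_eq])
    (auto intro!: continuous_on_diff continuous_divergence continuous_dir_deriv vfield_flux C2_C1 f)

abbreviation mu :: "'a measure" where "mu \<equiv> weighted_measure A g f"

lemma mu_eq: "mu = density vol (\<lambda>p. ennreal (exp (- f p)))"
  by (simp add: weighted_measure_def vol_def)

lemma sets_mu [simp, measurable_cong]: "sets mu = sets borel"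
  by (simp add: mu_eq)

lemma space_mu [simp]: "space mu = UNIV"
  by (simp add: mu_eq)

lemma continuous_weight: "continuous_on UNIV (\<lambda>p. exp (- f p))"
  by (intro continuous_on_exp continuous_on_minus C1_fun_continuous C2_C1 f)

lemma C1_weight: "C1_fun (\<lambda>p. exp (- f p))"
  unfolding C1_fun_def
proof
  fix c assume c: "c \<in> A"
  have "C1_on (cimg c) (\<lambda>y. (-1) * f (cinv c y))"
    by (intro C1_on_mult C1_on_const C1_funD[OF C2_C1[OF f]] chart_open c)
  then show "C1_on (cimg c) (\<lambda>y. exp (- f (cinv c y)))"
    using C1_on_exp[OF chart_open(2)[OF c]] by simp
qed

lemma integral_mu:
  fixes h :: "'a \<Rightarrow> real"
  assumes "h \<in> borel_measurable borel"
  shows "integral\<^sup>L mu h = integral\<^sup>L vol (\<lambda>p. exp (- f p) * h p)"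
  unfolding mu_eq
  by (subst integral_density) (use assms borel_measurable_continuous_onI[OF continuous_weight] in auto)

lemma finite_mu: "finite_measure mu"
proof (rule finite_measureI)
  have "emeasure mu UNIV = (\<integral>\<^sup>+ p. ennreal (exp (- f p)) \<partial>vol)"
    unfolding mu_eq
    by (subst emeasure_density) (use borel_measurable_continuous_onI[OF continuous_weight] in auto)
  also have "\<dots> < \<infinity>"
    using integrable_vol[OF continuous_weight] by (simp add: integrable_iff_bounded)
  finally show "emeasure mu (space mu) \<noteq> \<infinity>" by simp
qed

lemma continuous_integral_mu_zero:
  fixes h :: "'a \<Rightarrow> real"
  assumes h: "continuous_on UNIV h" "\<And>p. h p \<ge> 0" and z: "integral\<^sup>L mu h = 0"
  shows "h p = 0"
proof -
  have "exp (- f p) * h p = 0"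
    by (rule continuous_integral_zero[of "\<lambda>p. exp (- f p) * h p"])
      (use h z in \<open>auto intro!: continuous_on_mult continuous_weight simp: integral_mu[symmetric] borel_measurable_continuous_onI\<close>)
  then show ?thesis by simp
qed

lemma dir_deriv_weighted:
  assumes h: "C1_fun h" and X: "vfield X"
  shows "dir_deriv X (\<lambda>p. h p * exp (- f p)) p = exp (- f p) * dir_deriv X h p - h p * exp (- f p) * dir_deriv X f p"
proof -
  let ?c = "chart_at A p"
  note c = chart_at[of p]
  have d: "((\<lambda>y. k (cinv ?c y)) has_derivative chart_deriv ?c k p) (at (cmap ?c p))" if "C1_fun k" for k
    using C1_fun_differentiable[OF that c] by (simp add: chart_deriv_def[abs_def] frechet_derivative_works)
  have "((\<lambda>y. h (cinv ?c y) * exp (- f (cinv ?c y))) has_derivative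
     (\<lambda>v. h p * (exp (- f p) * (- chart_deriv ?c f p v)) + chart_deriv ?c h p v * exp (- f p))) (at (cmap ?c p))"
    using has_derivative_mult[OF d[OF h] has_derivative_exp[OF has_derivative_minus[OF d[OF C2_C1[OF f]]]]]
    by (simp add: cinv_cmap[OF c] mult_ac)
  from fun_cong[OF frechet_derivative_at[OF this], of "X ?c p"] show ?thesis
    by (simp add: dir_deriv_def chart_deriv_def algebra_simps)
qed

text \<open>
  Green's formula. Testing the divergence against \<open>h e\<^sup>-\<^sup>f\<close> produces, besides the Dirichlet form, a
  derivative of the weight; this is cancelled by the drift term \<open>\<langle>\<nabla>f, T(\<nabla>k)\<rangle>\<close> of the operator.
\<close>
theorem green:
  assumes h: "C1_fun h" and k: "C2_fun k"
  shows "integral\<^sup>L mu (\<lambda>p. h p * L k p) = - integral\<^sup>L mu (dir_deriv (flux k) h)"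
proof -
  note X = vfield_flux[OF k]
  let ?E = "\<lambda>p. exp (- f p)"
  have hE: "C1_fun (\<lambda>p. h p * ?E p)" by (intro C1_fun_mult h C1_weight)
  have hc: "continuous_on UNIV h" by (rule C1_fun_continuous[OF h])
  have fc: "continuous_on UNIV (dir_deriv (flux k) f)" by (intro continuous_dir_deriv C2_C1 f X)
  have hX: "continuous_on UNIV (dir_deriv (flux k) h)" by (intro continuous_dir_deriv h X)
  have i1: "integrable vol (\<lambda>p. (h p * ?E p) * divergence A g (flux k) p)"
    by (intro integrable_vol continuous_on_mult hc continuous_weight continuous_divergence X)
  have i2: "integrable vol (\<lambda>p. h p * ?E p * dir_deriv (flux k) f p)"
    by (intro integrable_vol continuous_on_mult hc continuous_weight fc)
  have i3: "integrable vol (\<lambda>p. ?E p * dir_deriv (flux k) h p)"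
    by (intro integrable_vol continuous_on_mult continuous_weight hX)
  have "integral\<^sup>L mu (\<lambda>p. h p * L k p) = integral\<^sup>L vol (\<lambda>p. ?E p * (h p * L k p))"
    by (intro integral_mu borel_measurable_continuous_onI continuous_on_mult hc continuous_L k)
  also have "\<dots> = integral\<^sup>L vol (\<lambda>p. (h p * ?E p) * divergence A g (flux k) p - h p * ?E p * dir_deriv (flux k) f p)"
    by (simp add: L_eq[OF k] algebra_simps)
  also have "\<dots> = integral\<^sup>L vol (\<lambda>p. (h p * ?E p) * divergence A g (flux k) p) - integral\<^sup>L vol (\<lambda>p. h p * ?E p * dir_deriv (flux k) f p)"
    by (rule Bochner_Integration.integral_diff[OF i1 i2])
  also have "integral\<^sup>L vol (\<lambda>p. (h p * ?E p) * divergence A g (flux k) p) = - integral\<^sup>L vol (dir_deriv (flux k) (\<lambda>p. h p * ?E p))"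
    by (rule integration_by_parts[OF X hE])
  also have "dir_deriv (flux k) (\<lambda>p. h p * ?E p) = (\<lambda>p. ?E p * dir_deriv (flux k) h p - h p * ?E p * dir_deriv (flux k) f p)"
    using dir_deriv_weighted[OF h X] by (simp add: fun_eq_iff)
  also have "integral\<^sup>L vol (\<lambda>p. ?E p * dir_deriv (flux k) h p - h p * ?E p * dir_deriv (flux k) f p) =
      integral\<^sup>L vol (\<lambda>p. ?E p * dir_deriv (flux k) h p) - integral\<^sup>L vol (\<lambda>p. h p * ?E p * dir_deriv (flux k) f p)"
    by (rule Bochner_Integration.integral_diff[OF i3 i2])
  also have "integral\<^sup>L vol (\<lambda>p. ?E p * dir_deriv (flux k) h p) = integral\<^sup>L mu (dir_deriv (flux k) h)"
    by (intro integral_mu[symmetric] borel_measurable_continuous_onI hX)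
  finally show ?thesis by simp
qed

lemma L_symmetric:
  assumes h: "C2_fun h" and k: "C2_fun k"
  shows "integral\<^sup>L mu (\<lambda>p. h p * L k p) = integral\<^sup>L mu (\<lambda>p. k p * L h p)"
  unfolding green[OF C2_C1[OF h] k] green[OF C2_C1[OF k] h]
  using dir_deriv_flux_sym[OF h k] by presburger

lemma L_energy:
  assumes h: "C2_fun h"
  shows "integral\<^sup>L mu (\<lambda>p. h p * L h p) = - integral\<^sup>L mu (inner_g A g (flux h) (grad g h))"
  unfolding green[OF C2_C1[OF h] h] using inner_flux_grad[OF h] by presburger

end

section \<open>Functions on a compact interval with one-sided derivatives\<close>

lemma mvt_within:
  fixes F :: "real \<Rightarrow> real"
  assumes F: "\<And>t. t \<in> {a..b} \<Longrightarrow> (F has_real_derivative F' t) (at t within {a..b})"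
    and st: "a \<le> s" "s \<le> t" "t \<le> b"
  shows "\<exists>r\<in>{s..t}. F t - F s = F' r * (t - s)"
proof (rule mvt_very_simple[OF st(2)])
  fix r assume r: "s \<le> r" "r \<le> t"
  then have "(F has_derivative (*) (F' r)) (at r within {a..b})"
    using F[of r] st by (simp add: has_field_derivative_def)
  then show "(F has_derivative (*) (F' r)) (at r within {s..t})"
    by (rule has_derivative_subset) (use st in auto)
qed

lemma mono_on_of_derivative_nonneg:
  fixes F :: "real \<Rightarrow> real"
  assumes F: "\<And>t. t \<in> {a..b} \<Longrightarrow> (F has_real_derivative F' t) (at t within {a..b})"
    and pos: "\<And>t. t \<in> {a..b} \<Longrightarrow> F' t \<ge> 0"
  shows "mono_on {a..b} F"
proof (rule mono_onI)
  fix s t assume st: "s \<in> {a..b}" "t \<in> {a..b}" "s \<le> t"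
  then obtain r where r: "r \<in> {s..t}" "F t - F s = F' r * (t - s)"
    using mvt_within[OF F, of s t] by auto
  then have "F' r * (t - s) \<ge> 0" using st pos by (intro mult_nonneg_nonneg) auto
  then show "F s \<le> F t" using r(2) by linarith
qed

text \<open>
  By the mean value theorem, the slopes of \<open>F\<close> to the left and to the right of an intermediate
  point are values of the derivative at points that are ordered accordingly.
\<close>
lemma convex_on_of_derivative_mono:
  fixes F :: "real \<Rightarrow> real"
  assumes F: "\<And>t. t \<in> {a..b} \<Longrightarrow> (F has_real_derivative F' t) (at t within {a..b})"
    and mono: "mono_on {a..b} F'"
  shows "convex_on {a..b} F"
proof (rule convex_on_linorderI)
  fix m x y :: real
  assume m: "0 < m" "m < 1" and xy: "x \<in> {a..b}" "y \<in> {a..b}" "x < y"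
  define z where "z = (1 - m) * x + m * y"
  have zx: "z - x = m * (y - x)" and yz: "y - z = (1 - m) * (y - x)"
    by (simp_all add: z_def algebra_simps)
  have "m * (y - x) \<ge> 0" "(1 - m) * (y - x) \<ge> 0" using m xy by auto
  then have z: "x \<le> z" "z \<le> y" unfolding zx[symmetric] yz[symmetric] by simp_all
  obtain r where r: "r \<in> {x..z}" "F z - F x = F' r * (z - x)"
    using mvt_within[OF F, of x z] xy z by auto
  obtain r' where r': "r' \<in> {z..y}" "F y - F z = F' r' * (y - z)"
    using mvt_within[OF F, of z y] xy z by auto
  have "F' r \<le> F' r'" using r r' xy z by (intro mono_onD[OF mono]) auto
  then have "F' r * (m * ((1 - m) * (y - x))) \<le> F' r' * (m * ((1 - m) * (y - x)))"
    using m xy by (intro mult_right_mono) auto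
  then have "(1 - m) * (F z - F x) \<le> m * (F y - F z)"
    unfolding r(2) r'(2) zx yz by (simp add: mult_ac)
  then show "F ((1 - m) *\<^sub>R x + m *\<^sub>R y) \<le> (1 - m) * F x + m * F y"
    unfolding real_scaleR_def z_def[symmetric] by (simp add: algebra_simps)
qed simp

lemma lipschitz_of_vector_derivative:
  fixes w :: "real \<Rightarrow> 'b::real_normed_vector"
  assumes w: "\<And>t. t \<in> {a..b} \<Longrightarrow> (w has_vector_derivative w' t) (at t within {a..b})"
    and C: "\<And>t. t \<in> {a..b} \<Longrightarrow> norm (w' t) \<le> C" and st: "s \<in> {a..b}" "t \<in> {a..b}"
  shows "norm (w s - w t) \<le> C * \<bar>s - t\<bar>"
proof -
  have "onorm (\<lambda>h. h *\<^sub>R w' t) \<le> C" if "t \<in> {a..b}" for t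
    using mult_right_mono[OF C[OF that] abs_ge_zero]
    by (intro onorm_le) (simp add: mult.commute[of "\<bar>_\<bar>"])
  then show ?thesis
    using differentiable_bound[of "{a..b}" w "\<lambda>t h. h *\<^sub>R w' t" C s t] w st
    by (simp add: has_vector_derivative_def)
qed

lemma has_vector_derivative_quotient:
  fixes w :: "real \<Rightarrow> 'b::real_normed_vector"
  assumes "(w has_vector_derivative w') (at t within S)"
  shows "((\<lambda>s. (w s - w t) /\<^sub>R (s - t)) \<longlongrightarrow> w') (at t within S)"
proof -
  have "((\<lambda>s. norm (w s - w t - (s - t) *\<^sub>R w') / norm (s - t)) \<longlongrightarrow> 0) (at t within S)"
    using assms by (simp add: has_vector_derivative_def has_derivative_iff_norm)
  then have "((\<lambda>s. norm ((w s - w t) /\<^sub>R (s - t) - w')) \<longlongrightarrow> 0) (at t within S)"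
  proof (rule Lim_transform_eventually)
    show "\<forall>\<^sub>F s in at t within S. norm (w s - w t - (s - t) *\<^sub>R w') / norm (s - t) = norm ((w s - w t) /\<^sub>R (s - t) - w')"
      unfolding eventually_at_filter
    proof (rule always_eventually, intro allI impI)
      fix s assume "s \<noteq> t"
      then have "(w s - w t) /\<^sub>R (s - t) - w' = (w s - w t - (s - t) *\<^sub>R w') /\<^sub>R (s - t)"
        by (simp add: scaleR_diff_right)
      then show "norm (w s - w t - (s - t) *\<^sub>R w') / norm (s - t) = norm ((w s - w t) /\<^sub>R (s - t) - w')"
        by (simp add: divide_inverse mult.commute)
    qed
  qed
  then show ?thesis
    by (rule LIM_zero_cancel[OF tendsto_norm_zero_cancel])
qed

section \<open>Differentiating integrals in time\<close>

context riemannian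
begin

lemma continuous_on_spacetime_charts:
  fixes w :: "'a \<Rightarrow> real \<Rightarrow> 'b::topological_space"
  assumes w: "\<And>c. c \<in> A \<Longrightarrow> continuous_on (cimg c \<times> S) (\<lambda>(y, t). w (cinv c y) t)"
  shows "continuous_on (UNIV \<times> S) (\<lambda>(x, t). w x t)"
  unfolding continuous_on_eq_continuous_within
proof (safe)
  fix x t assume t: "t \<in> S"
  obtain c where c: "c \<in> A" "x \<in> cdom c" using chart_cover by blast
  have "continuous_on (cdom c \<times> S) (\<lambda>z. (cmap c (fst z), snd z))"
    by (intro continuous_on_Pair continuous_on_compose2[OF continuous_cmap[OF c(1)]] continuous_on_fst continuous_on_snd continuous_on_id) auto
  then have "continuous_on (cdom c \<times> S) (\<lambda>z. (\<lambda>(y, t). w (cinv c y) t) (cmap c (fst z), snd z))"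
    by (rule continuous_on_compose2[OF w[OF c(1)]]) auto
  then have "continuous_on (cdom c \<times> S) (\<lambda>(x, t). w x t)"
    by (rule continuous_on_eq) (auto simp: cinv_cmap[OF c(1)])
  then have "continuous (at (x, t) within cdom c \<times> S) (\<lambda>(x, t). w x t)"
    using c t by (simp add: continuous_on_eq_continuous_within)
  moreover have "at (x, t) within UNIV \<times> S = at (x, t) within cdom c \<times> S"
    by (rule at_within_nhd[of _ "cdom c \<times> UNIV"]) (use c t chart_open(1)[OF c(1)] in \<open>auto intro!: open_Times\<close>)
  ultimately show "continuous (at (x, t) within UNIV \<times> S) (\<lambda>(x, t). w x t)" by simp
qed

lemma spacetime_slices:
  assumes "continuous_on (UNIV \<times> S) (\<lambda>(x, t). w x t)"
  shows "t \<in> S \<Longrightarrow> continuous_on UNIV (\<lambda>x. w x t)" "continuous_on S (w x)"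
proof -
  assume t: "t \<in> S"
  have "continuous_on UNIV (\<lambda>x. case (x, t) of (x, t) \<Rightarrow> w x t)"
    by (rule continuous_on_compose2[OF assms])
      (use t in \<open>auto intro!: continuous_on_Pair continuous_on_const continuous_on_id\<close>)
  then show "continuous_on UNIV (\<lambda>x. w x t)" by simp
next
  have "continuous_on S (\<lambda>t. case (x, t) of (x, t) \<Rightarrow> w x t)"
    by (rule continuous_on_compose2[OF assms])
      (auto intro!: continuous_on_Pair continuous_on_const continuous_on_id)
  then show "continuous_on S (w x)" by simp
qed

lemma spacetime_bounded:
  fixes w :: "'a \<Rightarrow> real \<Rightarrow> 'b::real_normed_vector"
  assumes "continuous_on (UNIV \<times> S) (\<lambda>(x, t). w x t)" "compact S"
  obtains C where "\<And>x t. t \<in> S \<Longrightarrow> norm (w x t) \<le> C"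
proof -
  have "bounded ((\<lambda>(x, t). w x t) ` (UNIV \<times> S))"
    by (intro compact_imp_bounded compact_continuous_image assms compact_Times compact_M)
  then obtain C where C: "\<And>z. z \<in> (\<lambda>(x, t). w x t) ` (UNIV \<times> S) \<Longrightarrow> norm z \<le> C"
    unfolding bounded_iff by blast
  have "norm (w x t) \<le> C" if "t \<in> S" for x t
    using C[of "w x t"] that by force
  then show thesis by (rule that)
qed

end

context weighted_riemannian
begin

lemma integrable_mu:
  fixes h :: "'a \<Rightarrow> real"
  assumes "continuous_on UNIV h"
  shows "integrable mu h"
proof -
  obtain C where C: "\<And>p. norm (h p) \<le> C" using bounded_continuous[OF assms] by blast
  interpret finite_measure mu by (rule finite_mu)
  show ?thesis
    by (rule integrable_const_bound[of _ C])
      (use C assms in \<open>auto intro!: borel_measurable_continuous_onI simp: measurable_cong_sets[OF sets_mu refl]\<close>)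
qed

lemma measurable_mu:
  fixes h :: "'a \<Rightarrow> real"
  assumes "continuous_on UNIV h"
  shows "h \<in> borel_measurable mu"
  using borel_measurable_continuous_onI[OF assms] by (simp add: measurable_cong_sets[OF sets_mu refl])

text \<open>
  The assumption on \<open>E\<close> puts the whole increment on \<open>u\<close>, so only \<open>u\<close> has to be differentiable in
  time while \<open>w\<close> is merely continuous. It holds for \<open>E = I\<close> with \<open>w = u\<close>, as a difference of squares,
  and for \<open>E = D\<close> with \<open>w = \<L>u\<close>, by symmetry of the operator. The difference quotients of \<open>u\<close> are
  bounded by the maximum of the time derivative over the compact space-time, whence dominated
  convergence applies.
\<close>
lemma has_derivative_bilinear_energy:
  fixes u w :: "'a \<Rightarrow> real \<Rightarrow> 'b::euclidean_space"
  assumes u: "continuous_on (UNIV \<times> {a..b}) (\<lambda>(x, t). u x t)"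
    and u': "continuous_on (UNIV \<times> {a..b}) (\<lambda>(x, t). u' x t)"
    and w: "continuous_on (UNIV \<times> {a..b}) (\<lambda>(x, t). w x t)"
    and d: "\<And>x t. t \<in> {a..b} \<Longrightarrow> (u x has_vector_derivative u' x t) (at t within {a..b})"
    and E: "\<And>s t. s \<in> {a..b} \<Longrightarrow> t \<in> {a..b} \<Longrightarrow>
      E s - E t = integral\<^sup>L mu (\<lambda>x. (u x s - u x t) \<bullet> (w x s + w x t))"
    and t: "t \<in> {a..b}"
  shows "(E has_real_derivative integral\<^sup>L mu (\<lambda>x. u' x t \<bullet> (2 *\<^sub>R w x t))) (at t within {a..b})"
  unfolding has_field_derivative_iff tendsto_at_iff_sequentially
proof (intro allI impI)
  fix X assume X: "\<forall>i. X i \<in> {a..b} - {t}" "X \<longlonglongrightarrow> t"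
  then have Xi: "X i \<in> {a..b}" "X i \<noteq> t" for i by auto
  obtain C where C: "\<And>x t. t \<in> {a..b} \<Longrightarrow> norm (u' x t) \<le> C"
    using spacetime_bounded[OF u'] by blast
  obtain C' where C': "\<And>x t. t \<in> {a..b} \<Longrightarrow> norm (w x t) \<le> C'"
    using spacetime_bounded[OF w] by blast
  define q where "q i x = inverse (X i - t) *\<^sub>R (u x (X i) - u x t)" for i x
  have uc: "continuous_on UNIV (\<lambda>x. u x s)" if "s \<in> {a..b}" for s using spacetime_slices(1)[OF u that] .
  have wc: "continuous_on UNIV (\<lambda>x. w x s)" if "s \<in> {a..b}" for s using spacetime_slices(1)[OF w that] .
  have "(E (X i) - E t) / (X i - t) = integral\<^sup>L mu (\<lambda>x. q i x \<bullet> (w x (X i) + w x t))" for i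
    unfolding q_def inner_scaleR_left E[OF Xi(1) t]
    by (simp add: divide_inverse mult.commute)
  then have eq: "((\<lambda>s. (E s - E t) / (s - t)) \<circ> X) = (\<lambda>i. integral\<^sup>L mu (\<lambda>x. q i x \<bullet> (w x (X i) + w x t)))"
    by (simp add: fun_eq_iff)
  have "(\<lambda>i. integral\<^sup>L mu (\<lambda>x. q i x \<bullet> (w x (X i) + w x t))) \<longlonglongrightarrow> integral\<^sup>L mu (\<lambda>x. u' x t \<bullet> (2 *\<^sub>R w x t))"
  proof (rule integral_dominated_convergence[where w = "\<lambda>x. C * (2 * C')"])
    show "(\<lambda>x. u' x t \<bullet> (2 *\<^sub>R w x t)) \<in> borel_measurable mu"
      by (intro measurable_mu continuous_on_inner continuous_on_scaleR continuous_on_const spacetime_slices(1)[OF u' t] wc t)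
    show "(\<lambda>x. q i x \<bullet> (w x (X i) + w x t)) \<in> borel_measurable mu" for i
      unfolding q_def
      by (intro measurable_mu continuous_on_inner continuous_on_scaleR continuous_on_add continuous_on_diff continuous_on_const uc wc t Xi)
    show "integrable mu (\<lambda>x. C * (2 * C'))" by (intro integrable_mu continuous_on_const)
    show "AE x in mu. (\<lambda>i. q i x \<bullet> (w x (X i) + w x t)) \<longlonglongrightarrow> u' x t \<bullet> (2 *\<^sub>R w x t)"
    proof (rule AE_I2)
      fix x
      have "((\<lambda>s. (u x s - u x t) /\<^sub>R (s - t)) \<longlongrightarrow> u' x t) (at t within {a..b})"
        by (rule has_vector_derivative_quotient[OF d[OF t]])
      then have 1: "(\<lambda>i. q i x) \<longlonglongrightarrow> u' x t"
        unfolding tendsto_at_iff_sequentially q_def comp_def using X by blast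
      have "(w x \<longlongrightarrow> w x t) (at t within {a..b})"
        using spacetime_slices(2)[OF w, of x] t by (simp add: continuous_on_def)
      then have "(\<lambda>i. w x (X i)) \<longlonglongrightarrow> w x t"
        unfolding tendsto_at_iff_sequentially comp_def using X by blast
      then have "(\<lambda>i. q i x \<bullet> (w x (X i) + w x t)) \<longlonglongrightarrow> u' x t \<bullet> (w x t + w x t)"
        by (intro tendsto_inner tendsto_add tendsto_const 1)
      then show "(\<lambda>i. q i x \<bullet> (w x (X i) + w x t)) \<longlonglongrightarrow> u' x t \<bullet> (2 *\<^sub>R w x t)"
        by (simp add: scaleR_2)
    qed
    show "AE x in mu. norm (q i x \<bullet> (w x (X i) + w x t)) \<le> C * (2 * C')" for i
    proof (rule AE_I2)
      fix x
      have "norm (u x (X i) - u x t) \<le> C * \<bar>X i - t\<bar>"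
        by (rule lipschitz_of_vector_derivative[OF d C Xi(1) t])
      then have 1: "norm (q i x) \<le> C"
        using Xi(2)[of i] unfolding q_def norm_scaleR
        by (simp add: pos_divide_le_eq mult.commute flip: divide_inverse_commute)
      have 2: "norm (w x (X i) + w x t) \<le> 2 * C'"
        using norm_triangle_ineq[of "w x (X i)" "w x t"] C'[OF Xi(1), of x i] C'[OF t, of x] by linarith
      have "norm (q i x \<bullet> (w x (X i) + w x t)) \<le> norm (q i x) * norm (w x (X i) + w x t)"
        by (simp add: Cauchy_Schwarz_ineq2)
      also have "\<dots> \<le> C * (2 * C')"
        by (intro mult_mono 1 2 order_trans[OF norm_ge_zero 1] norm_ge_zero)
      finally show "norm (q i x \<bullet> (w x (X i) + w x t)) \<le> C * (2 * C')" .
    qed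
  qed
  then show "((\<lambda>s. (E s - E t) / (s - t)) \<circ> X) \<longlonglongrightarrow> integral\<^sup>L mu (\<lambda>x. u' x t \<bullet> (2 *\<^sub>R w x t))"
    unfolding eq .
qed

end

section \<open>Monotonicity of the frequency\<close>

locale heat_flow = weighted_riemannian A g T f
  for A :: "('a::{t2_space, second_countable_topology}, 'm::finite) chart set"
    and g T :: "('a, 'm) tensor2" and f :: "'a \<Rightarrow> real" +
  fixes a b :: real and u :: "'a \<Rightarrow> real \<Rightarrow> real ^ 'n::finite" and \<phi> :: "real \<Rightarrow> real"
  assumes ab: "a < b" and smooth: "smooth_spacetime A a b u" and smooth_\<phi>: "smooth_on {a..b} \<phi>"
    and heat: "\<forall>x. \<forall>t\<in>{a..b}.
       vector_derivative (u x) (at t within {a..b}) - L_vec A g T f (\<lambda>x. u x t) x = \<phi> t *\<^sub>R u x t"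
    and mass_nonzero: "\<forall>t\<in>{a..b}. mass_I A g f u t \<noteq> 0"
begin

definition u_t :: "'a \<Rightarrow> real \<Rightarrow> real ^ 'n" where
  "u_t x t = vector_derivative (u x) (at t within {a..b})"

definition Lu :: "'a \<Rightarrow> real \<Rightarrow> real ^ 'n" where
  "Lu x t = L_vec A g T f (\<lambda>x. u x t) x"

abbreviation I :: "real \<Rightarrow> real" where "I \<equiv> mass_I A g f u"
abbreviation D :: "real \<Rightarrow> real" where "D \<equiv> energy_D A g T f u"
abbreviation U :: "real \<Rightarrow> real" where "U \<equiv> frequency_U A g T f u"

lemma smooth_chart: "c \<in> A \<Longrightarrow> Ck_on k (cimg c \<times> {a..b}) (\<lambda>(y, t). u (cinv c y) t)"
  using smooth unfolding smooth_spacetime_def smooth_on_def by blast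

lemma C2_component:
  assumes t: "t \<in> {a..b}"
  shows "C2_fun (\<lambda>x. u x t $ i)"
  unfolding Ck_fun_def comp_def
proof
  fix c assume c: "c \<in> A"
  have "Ck_on 2 (cimg c) (\<lambda>y. (\<lambda>(y, t). u (cinv c y) t) (y, t))"
    by (rule Ck_on_slice[OF chart_open(2)[OF c] t smooth_chart[OF c]])
  then have "Ck_on 2 (cimg c) (\<lambda>y. u (cinv c y) t)" by (simp only: prod.case)
  then show "Ck_on 2 (cimg c) (\<lambda>y. u (cinv c y) t $ i)"
    by (rule Ck_on_linear_compose[OF bounded_linear_vec_nth chart_open(2)[OF c]])
qed

lemma time_derivative_chart:
  assumes c: "c \<in> A" and y: "y \<in> cimg c" and t: "t \<in> {a..b}"
  shows "(u (cinv c y) has_vector_derivative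
    frechet_derivative (\<lambda>(y, t). u (cinv c y) t) (at (y, t) within cimg c \<times> {a..b}) (0, 1)) (at t within {a..b})"
proof -
  let ?F = "\<lambda>(y, t). u (cinv c y) t" and ?S = "cimg c \<times> {a..b}"
  let ?D = "frechet_derivative ?F (at (y, t) within ?S)"
  have "?F differentiable_on ?S" using smooth_chart[OF c, of "Suc 0"] by (simp only: Ck_on.simps)
  then have D: "(?F has_derivative ?D) (at (y, t) within ?S)"
    using y t unfolding differentiable_on_def frechet_derivative_works by blast
  then have "(?F has_derivative ?D) (at (y, t) within (\<lambda>s. (y, s)) ` {a..b})"
    by (rule has_derivative_subset) (use y in auto)
  moreover have "((\<lambda>s. (y, s)) has_derivative (\<lambda>h. (0, h))) (at t within {a..b})"
    by (intro has_derivative_Pair has_derivative_ident has_derivative_const)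
  ultimately have "((\<lambda>s. ?F (y, s)) has_derivative (\<lambda>h. ?D (0, h))) (at t within {a..b})"
    using has_derivative_in_compose by fast
  moreover have "(\<lambda>h. ?D (0, h)) = (\<lambda>h. h *\<^sub>R ?D (0, 1))"
  proof
    show "?D (0, h) = h *\<^sub>R ?D (0, 1)" for h
      using linear_scale[OF has_derivative_linear[OF D], of h "(0, 1)"] by simp
  qed
  ultimately show ?thesis
    unfolding has_vector_derivative_def prod.case by (simp only:)
qed

lemma u_has_derivative:
  assumes t: "t \<in> {a..b}"
  shows "(u x has_vector_derivative u_t x t) (at t within {a..b})"
proof -
  obtain c where c: "c \<in> A" "x \<in> cdom c" using chart_cover by blast
  show ?thesis
    using time_derivative_chart[OF c(1) _ t, of "cmap c x"] c
    unfolding u_t_def vector_derivative_works[symmetric]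
    by (auto simp: cinv_cmap intro: differentiableI_vector)
qed

lemma continuous_u: "continuous_on (UNIV \<times> {a..b}) (\<lambda>(x, t). u x t)"
  by (rule continuous_on_spacetime_charts) (use smooth_chart[of _ 0] in simp)

lemma continuous_u_t: "continuous_on (UNIV \<times> {a..b}) (\<lambda>(x, t). u_t x t)"
proof (rule continuous_on_spacetime_charts)
  fix c assume c: "c \<in> A"
  let ?F = "\<lambda>(y, t). u (cinv c y) t" and ?S = "cimg c \<times> {a..b}"
  have "continuous_on ?S (\<lambda>z. frechet_derivative ?F (at z within ?S) (0, 1))"
    using smooth_chart[OF c, of "Suc 0"] by (simp only: Ck_on.simps)
  then show "continuous_on ?S (\<lambda>(y, t). u_t (cinv c y) t)"
  proof (rule continuous_on_eq)
    fix z assume "z \<in> ?S"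
    then obtain y t where z: "z = (y, t)" "y \<in> cimg c" "t \<in> {a..b}" by auto
    show "frechet_derivative ?F (at z within ?S) (0, 1) = (case z of (y, t) \<Rightarrow> u_t (cinv c y) t)"
      unfolding z(1) prod.case
      by (rule vector_derivative_unique_within_closed_interval[unfolded box_real,
            OF ab z(3) time_derivative_chart[OF c z(2,3)] u_has_derivative[OF z(3)]])
  qed
qed

lemma continuous_\<phi>: "continuous_on {a..b} \<phi>"
proof -
  have "Ck_on 0 {a..b} \<phi>" using smooth_\<phi> unfolding smooth_on_def by blast
  then show ?thesis by simp
qed

text \<open>
  The equation trades the operator for a time derivative. Hence \<open>\<L>u\<close> is continuous in space-time, and
  \<open>D\<close> can be differentiated without exchanging space and time derivatives.
\<close>
lemma Lu_eq: "t \<in> {a..b} \<Longrightarrow> Lu x t = u_t x t - \<phi> t *\<^sub>R u x t"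
  using heat unfolding u_t_def Lu_def by (metis add_diff_cancel_left' diff_add_cancel)

lemma continuous_Lu: "continuous_on (UNIV \<times> {a..b}) (\<lambda>(x, t). Lu x t)"
proof -
  have "continuous_on (UNIV \<times> {a..b}) (\<lambda>z::'a \<times> real. \<phi> (snd z))"
    by (rule continuous_on_compose2[OF continuous_\<phi>]) (auto intro!: continuous_on_snd continuous_on_id)
  then have "continuous_on (UNIV \<times> {a..b}) (\<lambda>z. (case z of (x, t) \<Rightarrow> u_t x t) - \<phi> (snd z) *\<^sub>R (case z of (x, t) \<Rightarrow> u x t))"
    by (intro continuous_on_diff continuous_on_scaleR continuous_u continuous_u_t)
  then show ?thesis
    by (rule continuous_on_eq) (auto simp: Lu_eq)
qed

lemma continuous_slices:
  "t \<in> {a..b} \<Longrightarrow> continuous_on UNIV (\<lambda>x. u x t)"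
  "t \<in> {a..b} \<Longrightarrow> continuous_on UNIV (\<lambda>x. u_t x t)"
  "t \<in> {a..b} \<Longrightarrow> continuous_on UNIV (\<lambda>x. Lu x t)"
  using spacetime_slices(1)[OF continuous_u] spacetime_slices(1)[OF continuous_u_t]
    spacetime_slices(1)[OF continuous_Lu] by blast+

lemma inner_Lu:
  assumes s: "s \<in> {a..b}" and t: "t \<in> {a..b}"
  shows "integral\<^sup>L mu (\<lambda>x. u x s \<bullet> Lu x t) = (\<Sum>i\<in>UNIV. integral\<^sup>L mu (\<lambda>x. u x s $ i * L (\<lambda>x. u x t $ i) x))"
proof -
  have "integrable mu (\<lambda>x. u x s $ i * L (\<lambda>x. u x t $ i) x)" for i
    by (intro integrable_mu continuous_on_mult C1_fun_continuous C2_C1 C2_component continuous_L s t)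
  then show ?thesis
    by (subst Bochner_Integration.integral_sum[symmetric]) (auto simp: Lu_def L_vec_def inner_vec_def)
qed

lemma inner_Lu_sym:
  assumes "s \<in> {a..b}" "t \<in> {a..b}"
  shows "integral\<^sup>L mu (\<lambda>x. u x s \<bullet> Lu x t) = integral\<^sup>L mu (\<lambda>x. u x t \<bullet> Lu x s)"
  unfolding inner_Lu[OF assms] inner_Lu[OF assms(2,1)]
  by (intro sum.cong refl L_symmetric C2_component assms)

text \<open>
  Green's formula, component by component.
\<close>
lemma energy_eq:
  assumes t: "t \<in> {a..b}"
  shows "D t = integral\<^sup>L mu (\<lambda>x. u x t \<bullet> Lu x t)"
proof -
  let ?e = "\<lambda>i. inner_g A g (flux (\<lambda>x. u x t $ i)) (grad g (\<lambda>x. u x t $ i))"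
  have e: "?e i = dir_deriv (flux (\<lambda>x. u x t $ i)) (\<lambda>x. u x t $ i)" for i
    by (rule ext) (rule inner_flux_grad[OF C2_component[OF t]])
  have "continuous_on UNIV (?e i)" for i
    unfolding e by (intro continuous_dir_deriv C2_C1 C2_component t vfield_flux)
  then have "integrable mu (?e i)" for i
    by (rule integrable_mu)
  then have "D t = - (\<Sum>i\<in>UNIV. integral\<^sup>L mu (?e i))"
    unfolding energy_D_def by (subst Bochner_Integration.integral_sum) auto
  also have "\<dots> = (\<Sum>i\<in>UNIV. integral\<^sup>L mu (\<lambda>x. u x t $ i * L (\<lambda>x. u x t $ i) x))"
    unfolding sum_negf[symmetric] by (intro sum.cong refl L_energy[symmetric] C2_component t)
  finally show ?thesis unfolding inner_Lu[OF t t] .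
qed

lemma integrable_inner:
  assumes "continuous_on UNIV w" "continuous_on UNIV (w' :: 'a \<Rightarrow> real ^ 'n)"
  shows "integrable mu (\<lambda>x. w x \<bullet> w' x)"
  by (intro integrable_mu continuous_on_inner assms)

definition Q :: "real \<Rightarrow> real" where "Q t = integral\<^sup>L mu (\<lambda>x. Lu x t \<bullet> Lu x t)"

lemma mass_derivative:
  assumes t: "t \<in> {a..b}"
  shows "(I has_real_derivative 2 * D t + 2 * \<phi> t * I t) (at t within {a..b})"
proof -
  note c = continuous_slices
  have "I s - I r = integral\<^sup>L mu (\<lambda>x. (u x s - u x r) \<bullet> (u x s + u x r))"
    if s: "s \<in> {a..b}" and r: "r \<in> {a..b}" for s r
  proof -
    have "I s - I r = integral\<^sup>L mu (\<lambda>x. u x s \<bullet> u x s - u x r \<bullet> u x r)"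
      unfolding mass_I_def by (intro Bochner_Integration.integral_diff[symmetric] integrable_inner c s r)
    then show ?thesis by (simp add: inner_diff_left inner_add_right inner_commute algebra_simps)
  qed
  from has_derivative_bilinear_energy[OF continuous_u continuous_u_t continuous_u u_has_derivative this t]
  have "(I has_real_derivative integral\<^sup>L mu (\<lambda>x. u_t x t \<bullet> (2 *\<^sub>R u x t))) (at t within {a..b})" .
  moreover have "integral\<^sup>L mu (\<lambda>x. u_t x t \<bullet> (2 *\<^sub>R u x t)) =
      integral\<^sup>L mu (\<lambda>x. 2 * (u x t \<bullet> Lu x t) + 2 * \<phi> t * (u x t \<bullet> u x t))"
    by (simp add: Lu_eq[OF t] inner_diff_right inner_commute algebra_simps)
  moreover have "\<dots> = 2 * D t + 2 * \<phi> t * I t"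
    unfolding energy_eq[OF t] mass_I_def
    by (subst Bochner_Integration.integral_add) (auto intro!: integrable_inner c t)
  ultimately show ?thesis by simp
qed

text \<open>
  The increment of \<open>D\<close> is \<open>\<integral> (u(s) - u(r)) \<bullet> (\<L>u(s) + \<L>u(r))\<close>, since the mixed terms cancel by
  symmetry. Therefore \<open>D'\<close> is twice the integral of \<open>u\<^sub>t \<bullet> \<L>u\<close>, and here the equation is inserted.
\<close>
lemma energy_derivative:
  assumes t: "t \<in> {a..b}"
  shows "(D has_real_derivative 2 * Q t + 2 * \<phi> t * D t) (at t within {a..b})"
proof -
  note c = continuous_slices
  have "D s - D r = integral\<^sup>L mu (\<lambda>x. (u x s - u x r) \<bullet> (Lu x s + Lu x r))"
    if s: "s \<in> {a..b}" and r: "r \<in> {a..b}" for s r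
  proof -
    have "D s - D r = (D s + integral\<^sup>L mu (\<lambda>x. u x s \<bullet> Lu x r)) - (integral\<^sup>L mu (\<lambda>x. u x r \<bullet> Lu x s) + D r)"
      using inner_Lu_sym[OF s r] by simp
    also have "\<dots> = integral\<^sup>L mu (\<lambda>x. (u x s \<bullet> Lu x s + u x s \<bullet> Lu x r) - (u x r \<bullet> Lu x s + u x r \<bullet> Lu x r))"
      unfolding energy_eq[OF s] energy_eq[OF r]
      by (subst Bochner_Integration.integral_diff Bochner_Integration.integral_add,
          (intro Bochner_Integration.integrable_add integrable_inner c s r)+)+ simp
    finally show ?thesis by (simp add: inner_diff_left inner_add_right algebra_simps)
  qed
  from has_derivative_bilinear_energy[OF continuous_u continuous_u_t continuous_Lu u_has_derivative this t]
  have "(D has_real_derivative integral\<^sup>L mu (\<lambda>x. u_t x t \<bullet> (2 *\<^sub>R Lu x t))) (at t within {a..b})" .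
  moreover have "u_t x t \<bullet> (2 *\<^sub>R Lu x t) = 2 * (Lu x t \<bullet> Lu x t) + 2 * \<phi> t * (u x t \<bullet> Lu x t)" for x
  proof -
    have "u_t x t = Lu x t + \<phi> t *\<^sub>R u x t" using Lu_eq[OF t] by simp
    then show ?thesis by (simp add: inner_add_left algebra_simps)
  qed
  moreover have "integral\<^sup>L mu (\<lambda>x. 2 * (Lu x t \<bullet> Lu x t) + 2 * \<phi> t * (u x t \<bullet> Lu x t)) = 2 * Q t + 2 * \<phi> t * D t"
    unfolding energy_eq[OF t] Q_def
    by (subst Bochner_Integration.integral_add) (auto intro!: integrable_inner c t)
  ultimately show ?thesis by (simp only:)
qed

lemma mass_pos: "t \<in> {a..b} \<Longrightarrow> I t > 0"
proof -
  assume t: "t \<in> {a..b}"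
  have "I t \<ge> 0" unfolding mass_I_def by (rule integral_nonneg_AE) simp
  then show ?thesis using mass_nonzero t by force
qed

text \<open>
  The squared distance, in the weighted \<open>L\<^sup>2\<close> norm, from being an eigenfunction whose eigenvalue is
  the current frequency.
\<close>
definition defect :: "real \<Rightarrow> real" where
  "defect t = integral\<^sup>L mu (\<lambda>x. (Lu x t - U t *\<^sub>R u x t) \<bullet> (Lu x t - U t *\<^sub>R u x t))"

lemma defect_eq:
  assumes t: "t \<in> {a..b}"
  shows "defect t = Q t - U t * D t"
proof -
  note c = continuous_slices
  have "defect t = integral\<^sup>L mu (\<lambda>x. Lu x t \<bullet> Lu x t - (2 * U t * (u x t \<bullet> Lu x t) - U t * U t * (u x t \<bullet> u x t)))"
    unfolding defect_def by (simp add: inner_diff_left inner_diff_right inner_commute algebra_simps)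
  also have "\<dots> = Q t - (2 * U t * D t - U t * U t * I t)"
    unfolding Q_def energy_eq[OF t] mass_I_def
    by (subst Bochner_Integration.integral_diff, (auto intro!: integrable_inner c t)[2])+ simp
  also have "U t * U t * I t = U t * D t"
    using mass_pos[OF t] by (simp add: frequency_U_def)
  finally show ?thesis by simp
qed

lemma defect_nonneg: "defect t \<ge> 0"
  unfolding defect_def by (rule integral_nonneg_AE) simp

text \<open>
  In the quotient rule the contributions of \<open>\<phi>\<close> cancel, and \<open>2 (Q I - D\<^sup>2) / I\<^sup>2\<close> remains. Its
  numerator is nonnegative by the Cauchy-Schwarz inequality;
  writing the quotient through the defect shows this and the case of equality at once.
\<close>
lemma frequency_derivative:
  assumes t: "t \<in> {a..b}"
  shows "(U has_real_derivative 2 * defect t / I t) (at t within {a..b})"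
proof -
  have I: "I t \<noteq> 0" using mass_pos[OF t] by simp
  have "((\<lambda>t. D t / I t) has_real_derivative
      ((2 * Q t + 2 * \<phi> t * D t) * I t - D t * (2 * D t + 2 * \<phi> t * I t)) / (I t * I t)) (at t within {a..b})"
    by (rule DERIV_divide[OF energy_derivative[OF t] mass_derivative[OF t] I])
  moreover have "((2 * Q t + 2 * \<phi> t * D t) * I t - D t * (2 * D t + 2 * \<phi> t * I t)) / (I t * I t) = 2 * defect t / I t"
    using I by (simp add: defect_eq[OF t] frequency_U_def field_simps)
  ultimately show ?thesis by (simp add: frequency_U_def[abs_def])
qed

theorem frequency_mono: "mono_on {a..b} U"
  by (rule mono_on_of_derivative_nonneg[OF frequency_derivative])
    (use defect_nonneg mass_pos in \<open>auto intro!: divide_nonneg_pos\<close>)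

text \<open>
  A constant frequency has zero defect, and the continuous integrand of the defect then vanishes
  at every point.
\<close>
lemma eigen_of_constant:
  assumes const: "\<And>t. t \<in> {a..b} \<Longrightarrow> U t = k" and t: "t \<in> {a..b}"
  shows "Lu x t = k *\<^sub>R u x t"
proof -
  have "(U has_vector_derivative 0) (at t within {a..b})"
    by (rule has_vector_derivative_transform[OF t _ has_vector_derivative_const[of k]]) (simp add: const)
  moreover have "(U has_vector_derivative 2 * defect t / I t) (at t within {a..b})"
    using frequency_derivative[OF t] by (simp add: has_real_derivative_iff_has_vector_derivative)
  ultimately have "2 * defect t / I t = 0"
    using vector_derivative_unique_within_closed_interval[unfolded box_real, OF ab t] by metis
  then have "defect t = 0" using mass_pos[OF t] by simp
  then have "(Lu x t - U t *\<^sub>R u x t) \<bullet> (Lu x t - U t *\<^sub>R u x t) = 0"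
    unfolding defect_def
    by (rule continuous_integral_mu_zero[rotated -1])
      (auto intro!: continuous_on_inner continuous_on_diff continuous_on_scaleR continuous_on_const continuous_slices t)
  then show ?thesis using const[OF t] by simp
qed

text \<open>
  For fixed \<open>x\<close> the equation becomes the linear differential equation \<open>u\<^sub>t = (k + \<phi>) u\<close>; multiplication
  with the integrating factor \<open>e\<^sup>-\<^sup>h\<close> makes the solution constant in time.
\<close>
lemma solution_of_constant:
  assumes const: "\<And>t. t \<in> {a..b} \<Longrightarrow> U t = k" and t: "t \<in> {a..b}"
  shows "u x t = exp (t * k - a * k + integral {a..t} \<phi>) *\<^sub>R u x a"
proof -
  define h where "h s = s * k - a * k + integral {a..s} \<phi>" for s
  define w where "w s = exp (- h s) *\<^sub>R u x s" for s
  have "(w has_vector_derivative 0) (at s within {a..b})" if s: "s \<in> {a..b}" for s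
  proof -
    have "(h has_real_derivative k + \<phi> s) (at s within {a..b})"
      unfolding h_def
      by (auto intro!: derivative_eq_intros integral_has_real_derivative continuous_\<phi> s)
    then have e: "((\<lambda>s. exp (- h s)) has_real_derivative - (k + \<phi> s) * exp (- h s)) (at s within {a..b})"
      by (auto intro!: derivative_eq_intros)
    have "u_t x s = (k + \<phi> s) *\<^sub>R u x s"
      using Lu_eq[OF s, of x] eigen_of_constant[OF const s, of x] by (simp add: algebra_simps)
    then have "(u x has_vector_derivative (k + \<phi> s) *\<^sub>R u x s) (at s within {a..b})"
      using u_has_derivative[OF s, of x] by simp
    from has_vector_derivative_scaleR[OF e this] show ?thesis
      unfolding w_def by (simp add: algebra_simps)
  qed
  then obtain k' where "\<And>s. s \<in> {a..b} \<Longrightarrow> w s = k'"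
    using has_vector_derivative_zero_constant[of "{a..b}" w] by auto
  then have "w t = w a" using t ab by auto
  moreover have "h a = 0" by (simp add: h_def)
  ultimately have "exp (- h t) *\<^sub>R u x t = u x a" by (simp add: w_def)
  then have "exp (h t) *\<^sub>R u x a = exp (h t) *\<^sub>R exp (- h t) *\<^sub>R u x t" by simp
  also have "\<dots> = u x t" by (simp add: exp_minus)
  finally show ?thesis by (simp add: h_def)
qed

text \<open>
  \<open>(log I)' = 2 U + 2 \<phi>\<close> is a sum of nondecreasing functions.
\<close>
lemma log_mass_convex:
  assumes "mono_on {a..b} \<phi>"
  shows "convex_on {a..b} (\<lambda>t. ln (I t))"
proof (rule convex_on_of_derivative_mono)
  fix t assume t: "t \<in> {a..b}"
  have "((\<lambda>t. ln (I t)) has_real_derivative (2 * D t + 2 * \<phi> t * I t) / I t) (at t within {a..b})"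
    using mass_derivative[OF t] mass_pos[OF t] by (auto intro!: derivative_eq_intros)
  then show "((\<lambda>t. ln (I t)) has_real_derivative 2 * U t + 2 * \<phi> t) (at t within {a..b})"
    using mass_pos[OF t] by (simp add: frequency_U_def add_divide_distrib)
next
  show "mono_on {a..b} (\<lambda>t. 2 * U t + 2 * \<phi> t)"
    by (intro mono_onI add_mono mult_left_mono mono_onD[OF frequency_mono] mono_onD[OF assms]) auto
qed

end

theorem theorem2p1:
  fixes A :: "('a::{t2_space, second_countable_topology}, 'm::finite) chart set"
    and g T :: "('a, 'm) tensor2"
    and f :: "'a \<Rightarrow> real"
    and a b :: real
    and u :: "'a \<Rightarrow> real \<Rightarrow> real ^ 'n::finite"
    and \<phi> :: "real \<Rightarrow> real"
  assumes "closed_riemannian_manifold A g"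
    and "spd_tensor A g T"
    and "Ck_fun A 2 f"
    and "a < b"
    and "smooth_spacetime A a b u"
    and "smooth_on {a..b} \<phi>"
    and "\<forall>x. \<forall>t\<in>{a..b}.
           vector_derivative (u x) (at t within {a..b}) - L_vec A g T f (\<lambda>x. u x t) x = \<phi> t *\<^sub>R u x t"
    and "\<forall>t\<in>{a..b}. mass_I A g f u t \<noteq> 0"
  shows "mono_on {a..b} (frequency_U A g T f u) \<and>
    (frequency_U A g T f u constant_on {a..b} \<longrightarrow>
       is_eigenfunction A g T f a b u \<and>
       (\<forall>x. \<forall>t\<in>{a..b}. u x t =
          exp (t * frequency_U A g T f u t - a * frequency_U A g T f u a + integral {a..t} \<phi>) *\<^sub>R u x a)) \<and>
    (mono_on {a..b} \<phi> \<longrightarrow> convex_on {a..b} (\<lambda>t. ln (mass_I A g f u t)))"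
proof -
  interpret heat_flow A g T f a b u \<phi>
    by unfold_locales (use assms in auto)
  show ?thesis
  proof (intro conjI impI allI ballI)
    show "mono_on {a..b} U" by (rule frequency_mono)
    show "convex_on {a..b} (\<lambda>t. ln (I t))" if "mono_on {a..b} \<phi>"
      using that by (rule log_mass_convex)
  next
    assume "U constant_on {a..b}"
    then obtain k where k: "\<And>t. t \<in> {a..b} \<Longrightarrow> U t = k" unfolding constant_on_def by blast
    show "is_eigenfunction A g T f a b u"
      unfolding is_eigenfunction_def using eigen_of_constant[OF k] unfolding Lu_def by blast
    fix x t assume t: "t \<in> {a..b}"
    then have "a \<in> {a..b}" by auto
    then show "u x t = exp (t * U t - a * U a + integral {a..t} \<phi>) *\<^sub>R u x a"
      using solution_of_constant[OF k t] k[OF t] k[of a] by simp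
  qed
qed

end
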